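(* Let $m>1$ and $n>1$ be integers, let $R=(r_1,\ldots,r_m)$ and $C=(c_1,\ldots,c_n)$ be vectors of positive integers with $r_1+\cdots+r_m=c_1+\cdots+c_n=N$, and let $W=(w_{ij})$ be an $m\times n$ matrix with non-negative real entries. Define $$T(R,C;W)=\sum_{D=(d_{ij})}\prod_{i,j}w_{ij}^{d_{ij}},$$ where the sum is over all $m\times n$ non-negative integer matrices $D$ with row sums $r_1,\ldots,r_m$ and column sums $c_1,\ldots,c_n$, and where $0^0=1$. For $\mathbf{x}=(x_1,\ldots,x_m)$, $\mathbf{y}=(y_1,\ldots,y_n)$ let $$F(\mathbf{x},\mathbf{y};W)=\Big(\prod_{i=1}^m x_i^{-r_i}\Big)\Big(\prod_{j=1}^n y_j^{-c_j}\Big)\prod_{i,j}\frac{1}{1-w_{ij}x_iy_j},$$ and let $$\rho=\rho(R,C;W)=\inf\{F(\mathbf{x},\mathbf{y};W):\ x_1,\ldots,x_m>0,\ y_1,\ldots,y_n>0,\ w_{ij}x_iy_j<1\ \text{for all } i,j\}.$$ Then $$\rho\ \ge\ T(R,C;W)\ \ge\ N^{-\gamma(m+n)}\rho,$$ where $\gamma>0$ is an absolute constant. *)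

theory Defs
  imports Complex_Main
begin

text \<open>
  Vectors of length \<open>m\<close> are functions on \<open>nat\<close> and \<open>m \<times> n\<close> matrices are functions
  \<open>nat \<Rightarrow> nat \<Rightarrow> _\<close>, both indexed from 0; values at indices outside the range are
  irrelevant. The dimensions are terms and not types because the absolute
  constant of the theorem has to be chosen before \<open>m\<close> and \<open>n\<close>.
\<close>

text \<open>
  Contingency tables with row sums \<open>R\<close> and column sums \<open>C\<close>. Entries outside the range
  are fixed to 0, so that every matrix is counted exactly once.
\<close>

definition tables :: "nat \<Rightarrow> nat \<Rightarrow> (nat \<Rightarrow> nat) \<Rightarrow> (nat \<Rightarrow> nat) \<Rightarrow> (nat \<Rightarrow> nat \<Rightarrow> nat) set" where
  "tables m n R C =
     {D. (\<forall>i<m. (\<Sum>j<n. D i j) = R i) \<and>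
         (\<forall>j<n. (\<Sum>i<m. D i j) = C j) \<and>
         (\<forall>i j. \<not> (i < m \<and> j < n) \<longrightarrow> D i j = 0)}"

definition T :: "nat \<Rightarrow> nat \<Rightarrow> (nat \<Rightarrow> nat) \<Rightarrow> (nat \<Rightarrow> nat) \<Rightarrow> (nat \<Rightarrow> nat \<Rightarrow> real) \<Rightarrow> real" where
  "T m n R C W = (\<Sum>D\<in>tables m n R C. \<Prod>i<m. \<Prod>j<n. W i j ^ D i j)"

definition F ::
  "nat \<Rightarrow> nat \<Rightarrow> (nat \<Rightarrow> nat) \<Rightarrow> (nat \<Rightarrow> nat) \<Rightarrow> (nat \<Rightarrow> nat \<Rightarrow> real) \<Rightarrow>
   (nat \<Rightarrow> real) \<Rightarrow> (nat \<Rightarrow> real) \<Rightarrow> real" where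
  "F m n R C W x y =
     (\<Prod>i<m. x i powi (- int (R i))) * (\<Prod>j<n. y j powi (- int (C j))) *
     (\<Prod>i<m. \<Prod>j<n. 1 / (1 - W i j * x i * y j))"

definition admissible ::
  "nat \<Rightarrow> nat \<Rightarrow> (nat \<Rightarrow> nat \<Rightarrow> real) \<Rightarrow> ((nat \<Rightarrow> real) \<times> (nat \<Rightarrow> real)) set" where
  "admissible m n W =
     {(x, y). (\<forall>i<m. x i > 0) \<and> (\<forall>j<n. y j > 0) \<and>
              (\<forall>i<m. \<forall>j<n. W i j * x i * y j < 1)}"

definition rho :: "nat \<Rightarrow> nat \<Rightarrow> (nat \<Rightarrow> nat) \<Rightarrow> (nat \<Rightarrow> nat) \<Rightarrow> (nat \<Rightarrow> nat \<Rightarrow> real) \<Rightarrow> real" where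
  "rho m n R C W = (INF (x, y)\<in>admissible m n W. F m n R C W x y)"

text \<open>
  The sum in \<open>T\<close> is finite and the infimum in \<open>rho\<close> is taken over a non-empty set bounded
  below, so neither falls back on a default value.
\<close>

lemma finite_tables: "finite (tables m n R C)"
proof -
  let ?M = "Max (R ` {..<m})"
  let ?S = "{g. \<forall>j. (j \<in> {..<n} \<longrightarrow> g j \<in> {..?M}) \<and> (j \<notin> {..<n} \<longrightarrow> g j = (0::nat))}"
  have S: "finite ?S"
    by (rule finite_set_of_finite_funs) auto
  let ?T = "{D. \<forall>i. (i \<in> {..<m} \<longrightarrow> D i \<in> ?S) \<and> (i \<notin> {..<m} \<longrightarrow> D i = (\<lambda>_. 0))}"
  have T: "finite ?T"
    by (rule finite_set_of_finite_funs) (use S in auto)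
  have "tables m n R C \<subseteq> ?T"
  proof
    fix D assume D: "D \<in> tables m n R C"
    have "D i j \<le> ?M" if "i < m" "j < n" for i j
    proof -
      have "D i j \<le> (\<Sum>j<n. D i j)"
        using that by (intro member_le_sum) auto
      also have "\<dots> = R i"
        using D that by (auto simp: tables_def)
      also have "\<dots> \<le> ?M"
        using that by (intro Max_ge) auto
      finally show ?thesis .
    qed
    with D show "D \<in> ?T"
      by (auto simp: tables_def)
  qed
  then show ?thesis
    using T by (rule finite_subset)
qed

lemma admissible_nonempty: "admissible m n W \<noteq> {}"
proof -
  define B where "B = 1 + (\<Sum>i<m. \<Sum>j<n. \<bar>W i j\<bar>)"
  have B: "B > 0"
    unfolding B_def by (intro add_pos_nonneg sum_nonneg) auto
  have "W i j * (1 / B) * 1 < 1" if "i < m" "j < n" for i j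
  proof -
    have "W i j \<le> (\<Sum>j<n. \<bar>W i j\<bar>)"
      using that member_le_sum[of j "{..<n}" "\<lambda>j. \<bar>W i j\<bar>"] by force
    also have "\<dots> \<le> (\<Sum>i<m. \<Sum>j<n. \<bar>W i j\<bar>)"
      using that by (intro member_le_sum[of i "{..<m}" "\<lambda>i. \<Sum>j<n. \<bar>W i j\<bar>"]) (auto intro: sum_nonneg)
    also have "\<dots> < B"
      by (simp add: B_def)
    finally show ?thesis
      using B by (simp add: field_simps)
  qed
  with B have "((\<lambda>_. 1 / B), (\<lambda>_. 1)) \<in> admissible m n W"
    by (auto simp: admissible_def)
  then show ?thesis by blast
qed

lemma F_pos: "(x, y) \<in> admissible m n W \<Longrightarrow> F m n R C W x y > 0"
  unfolding F_def admissible_def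
  by (auto intro!: mult_pos_pos prod_pos zero_less_power_int)

lemma bdd_below_F: "bdd_below ((\<lambda>(x, y). F m n R C W x y) ` admissible m n W)"
  by (rule bdd_belowI[of _ 0]) (auto intro: less_imp_le F_pos)

end

theory Submission
  imports Defs "HOL-Probability.Probability" "HOL-Computational_Algebra.Fundamental_Theorem_Algebra"
begin

text \<open>
  Since \<open>1 / (1 - z) = \<Sum>d. z ^ d\<close>, the sum of \<open>T m n R c W * y ^ c\<close> over all column sums \<open>c\<close> is
  a product over the rows of complete homogeneous polynomials \<open>h\<close>, and \<open>T \<le> rho\<close> is immediate.

  For the lower bound, the degree \<open>r\<close> part of a row is comparable with
  \<open>min x. x ^ (- r) * (\<Prod>j. 1 / (1 - z j * x))\<close> because \<open>h\<close> is log-concave in \<open>r\<close>. So it suffices to compare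
  \<open>T m n R C W\<close> with the minimum over \<open>y\<close> of \<open>\<Sum>c. T m n R c W * y ^ (c - C)\<close>. At the minimum the terms
  of this sum form a distribution with mean \<open>C\<close>, and the comparison follows if \<open>T\<close> is log-concave in the
  column sums up to a factor \<open>(N + 1) ^ n\<close>.

  To prove this, write \<open>\<Prod>i. fact (R i)\<close> times \<open>T\<close> as the expectation, over independent exponential
  variables \<open>g i j\<close>, of the coefficient of \<open>y ^ C\<close> in \<open>\<Prod>i. (\<Sum>j. W i j * g i j * y j) ^ R i\<close>. This product
  of linear forms does not vanish when all \<open>y j\<close> have positive real part, so by Gurvits' capacity argument the
  coefficient agrees up to a factor \<open>(N + 1) ^ n\<close> with the infimum over \<open>y > 0\<close> of the product divided by
  \<open>y ^ C\<close>. The infimum is jointly log-concave in \<open>g\<close> and \<open>C\<close>, and the Prekopa-Leindler inequality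
  transfers log-concavity to the expectation. Matrices with zero entries are reached by a limit.
\<close>

section \<open>Compositions and tables\<close>

text \<open>The rows' own generating polynomials are not stable: already x^2 + x y + y^2, the
  complete homogeneous polynomial of degree 2, vanishes at x = e^(i pi/3), y = e^(-i pi/3). Powers
  of linear forms are stable, but they weight a table by multinomial coefficients instead of 1. This
  is why the exponential variables enter: their moments \<open>fact d\<close> cancel the
  denominators of those coefficients. Prekopa-Leindler is required for a whole family of functions,
  because the distribution at the minimum charges every column sum vector. The inequality itself
  loses nothing, so the factor (N + 1)^n from the capacity at C is paid once, whatever the size of
  the family. Returning from the minimum to T costs the entropy of the distribution, a factor at
  most the number of compositions, again (N + 1)^n. Each row costs 4 (N + 1). As m > 1 forces N >=
  2, we have N + 1 <= N^2 and 4 (N + 1) <= N^4. The total loss is at most N^(4 (m + n)), whence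
  gamma = 4.\<close>

definition compositions :: "nat \<Rightarrow> nat \<Rightarrow> (nat \<Rightarrow> nat) set" where
  "compositions n r = {d. (\<Sum>j<n. d j) = r \<and> (\<forall>j\<ge>n. d j = 0)}"

lemma compositions_le: "d \<in> compositions n r \<Longrightarrow> d j \<le> r"
proof (cases "j < n")
  case True
  assume "d \<in> compositions n r"
  then show ?thesis
    using True member_le_sum[of j "{..<n}" d] by (auto simp: compositions_def)
qed (auto simp: compositions_def)

lemma compositions_inj:
  "inj_on (\<lambda>d. restrict d {..<n}) (compositions n r)"
proof (rule inj_onI, rule ext)
  fix d e j
  assume de: "d \<in> compositions n r" "e \<in> compositions n r"
    and "restrict d {..<n} = restrict e {..<n}"
  then have "restrict d {..<n} j = restrict e {..<n} j"
    by simp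
  then show "d j = e j"
    using de by (cases "j < n") (auto simp: compositions_def)
qed

lemma compositions_image:
  "(\<lambda>d. restrict d {..<n}) ` compositions n r \<subseteq> {..<n} \<rightarrow>\<^sub>E {..r}"
  by (auto simp: compositions_le split: if_splits)

lemma finite_compositions: "finite (compositions n r)"
proof -
  have "finite ({..<n} \<rightarrow>\<^sub>E {..r})"
    by (simp add: finite_PiE)
  then have "finite ((\<lambda>d. restrict d {..<n}) ` compositions n r)"
    by (rule finite_subset[OF compositions_image])
  then show ?thesis
    by (rule finite_imageD[OF _ compositions_inj])
qed

lemma card_compositions_le: "card (compositions n r) \<le> (r + 1) ^ n"
proof -
  have "card (compositions n r) = card ((\<lambda>d. restrict d {..<n}) ` compositions n r)"
    by (rule card_image[OF compositions_inj, symmetric])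
  also have "\<dots> \<le> card ({..<n} \<rightarrow>\<^sub>E {..r})"
    by (rule card_mono[OF finite_PiE compositions_image]) auto
  also have "\<dots> = (r + 1) ^ n"
    by (simp add: card_PiE)
  finally show ?thesis .
qed

lemma compositions_0: "compositions 0 r = (if r = 0 then {\<lambda>_. 0} else {})"
  by (auto simp: compositions_def)

text \<open>Splitting off the last entry \<open>k = d n\<close> is the common recursion behind the
  multinomial theorem and the complete homogeneous polynomials; arbitrary factors
  \<open>f j (d j)\<close> let it serve both.\<close>

lemma sum_compositions_Suc:
  fixes f :: "nat \<Rightarrow> nat \<Rightarrow> 'a :: comm_semiring_1"
  shows "(\<Sum>d\<in>compositions (Suc n) r. \<Prod>j<Suc n. f j (d j)) =
    (\<Sum>k\<le>r. f n k * (\<Sum>d\<in>compositions n (r - k). \<Prod>j<n. f j (d j)))"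
proof -
  have "(\<Sum>k\<le>r. f n k * (\<Sum>d\<in>compositions n (r - k). \<Prod>j<n. f j (d j))) =
      (\<Sum>(k, d)\<in>Sigma {..r} (\<lambda>k. compositions n (r - k)). f n k * (\<Prod>j<n. f j (d j)))"
    by (simp add: sum_distrib_left sum.Sigma finite_compositions)
  also have "\<dots> = (\<Sum>d\<in>compositions (Suc n) r. \<Prod>j<Suc n. f j (d j))"
  proof (rule sum.reindex_bij_witness[where j = "\<lambda>(k, d). d(n := k)" and i = "\<lambda>d. (d n, d(n := 0))"],
      goal_cases)
    case (1 a)
    then show ?case
      by (auto simp: compositions_def fun_eq_iff)
  next
    case (2 a)
    obtain k d where [simp]: "a = (k, d)"
      by (cases a)
    have "(\<Sum>j<n. (d(n := k)) j) = (\<Sum>j<n. d j)"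
      by (intro sum.cong) auto
    with 2 show ?case
      by (auto simp: compositions_def)
  next
    case (3 b)
    then show ?case by simp
  next
    case (4 b)
    have "(\<Sum>j<n. (b(n := 0)) j) = (\<Sum>j<n. b j)"
      by (intro sum.cong) auto
    with 4 show ?case
      by (auto simp: compositions_def)
  next
    case (5 a)
    obtain k d where [simp]: "a = (k, d)"
      by (cases a)
    have "(\<Prod>j<n. f j ((d(n := k)) j)) = (\<Prod>j<n. f j (d j))"
      by (intro prod.cong) auto
    then show ?case
      by (simp add: mult.commute)
  qed
  finally show ?thesis by simp
qed

text \<open>Without the column constraints the rows are independent, so sums over these matrices
  factor. The sets \<open>tables m n R c\<close> are the fibres of \<open>col_sums\<close> in
  them.\<close>

definition row_tables :: "nat \<Rightarrow> nat \<Rightarrow> (nat \<Rightarrow> nat) \<Rightarrow> (nat \<Rightarrow> nat \<Rightarrow> nat) set" where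
  "row_tables m n R = {D. (\<forall>i<m. D i \<in> compositions n (R i)) \<and> (\<forall>i\<ge>m. D i = (\<lambda>_. 0))}"

lemma sum_row_tables:
  fixes f :: "nat \<Rightarrow> (nat \<Rightarrow> nat) \<Rightarrow> 'a :: comm_semiring_1"
  shows "(\<Sum>D\<in>row_tables m n R. \<Prod>i<m. f i (D i)) = (\<Prod>i<m. \<Sum>d\<in>compositions n (R i). f i d)"
proof -
  have "(\<Prod>i<m. \<Sum>d\<in>compositions n (R i). f i d) =
      (\<Sum>g\<in>Pi\<^sub>E {..<m} (\<lambda>i. compositions n (R i)). \<Prod>i<m. f i (g i))"
    by (rule prod_sum_PiE) (auto simp: finite_compositions)
  also have "\<dots> = (\<Sum>D\<in>row_tables m n R. \<Prod>i<m. f i (D i))"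
    by (rule sum.reindex_bij_witness[where j = "\<lambda>g i. if i < m then g i else (\<lambda>_. 0)"
          and i = "\<lambda>D. restrict D {..<m}"])
      (auto simp: row_tables_def PiE_def extensional_def fun_eq_iff Pi_def)
  finally show ?thesis by simp
qed

lemma finite_row_tables: "finite (row_tables m n R)"
proof -
  have "inj_on (\<lambda>D. restrict D {..<m}) (row_tables m n R)"
  proof (rule inj_onI, rule ext)
    fix D E i
    assume DE: "D \<in> row_tables m n R" "E \<in> row_tables m n R"
      and "restrict D {..<m} = restrict E {..<m}"
    then have "restrict D {..<m} i = restrict E {..<m} i"
      by simp
    then show "D i = E i"
      using DE by (cases "i < m") (auto simp: row_tables_def)
  qed
  moreover have "(\<lambda>D. restrict D {..<m}) ` row_tables m n R \<subseteq> Pi\<^sub>E {..<m} (\<lambda>i. compositions n (R i))"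
    by (auto simp: row_tables_def)
  ultimately show ?thesis
    by (meson finite_PiE finite_compositions finite_imageD finite_lessThan finite_subset)
qed

definition col_sums :: "nat \<Rightarrow> nat \<Rightarrow> (nat \<Rightarrow> nat \<Rightarrow> nat) \<Rightarrow> nat \<Rightarrow> nat" where
  "col_sums m n D j = (if j < n then \<Sum>i<m. D i j else 0)"

lemma tables_eq:
  assumes "c \<in> compositions n N"
  shows "tables m n R c = {D \<in> row_tables m n R. col_sums m n D = c}"
  using assms
  by (auto simp: tables_def row_tables_def compositions_def col_sums_def fun_eq_iff not_less)
    (metis not_less)

lemma col_sums_in:
  assumes "D \<in> row_tables m n R"
  shows "col_sums m n D \<in> compositions n (\<Sum>i<m. R i)"
proof -
  have "(\<Sum>j<n. col_sums m n D j) = (\<Sum>j<n. \<Sum>i<m. D i j)"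
    by (simp add: col_sums_def)
  also have "\<dots> = (\<Sum>i<m. \<Sum>j<n. D i j)"
    by (rule sum.swap)
  also have "\<dots> = (\<Sum>i<m. R i)"
    using assms by (intro sum.cong) (auto simp: row_tables_def compositions_def)
  finally show ?thesis
    by (simp add: compositions_def col_sums_def)
qed

lemma sum_row_tables_by_col_sums:
  fixes \<phi> :: "(nat \<Rightarrow> nat \<Rightarrow> nat) \<Rightarrow> 'a :: comm_monoid_add"
  assumes "N = (\<Sum>i<m. R i)"
  shows "(\<Sum>c\<in>compositions n N. \<Sum>D\<in>tables m n R c. \<phi> D) = (\<Sum>D\<in>row_tables m n R. \<phi> D)"
proof -
  have "(\<Sum>c\<in>compositions n N. \<Sum>D\<in>tables m n R c. \<phi> D) =
      (\<Sum>c\<in>compositions n N. \<Sum>D\<in>{D \<in> row_tables m n R. col_sums m n D = c}. \<phi> D)"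
    by (intro sum.cong) (auto simp: tables_eq)
  also have "\<dots> = (\<Sum>D\<in>row_tables m n R. \<phi> D)"
    using col_sums_in by (intro sum.group) (auto simp: finite_row_tables finite_compositions assms)
  finally show ?thesis .
qed

lemma prod_weights_tables:
  fixes a :: "nat \<Rightarrow> nat \<Rightarrow> 'a :: comm_semiring_1"
  assumes "D \<in> tables m n R c"
  shows "(\<Prod>i<m. \<Prod>j<n. (a i j * y j) ^ D i j) = (\<Prod>i<m. \<Prod>j<n. a i j ^ D i j) * (\<Prod>j<n. y j ^ c j)"
proof -
  have "(\<Prod>i<m. \<Prod>j<n. y j ^ D i j) = (\<Prod>j<n. \<Prod>i<m. y j ^ D i j)"
    by (rule prod.swap)
  also have "\<dots> = (\<Prod>j<n. y j ^ c j)"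
    using assms by (intro prod.cong) (auto simp: tables_def power_sum[symmetric])
  finally show ?thesis
    by (simp add: power_mult_distrib prod.distrib)
qed

definition complete_homogeneous :: "nat \<Rightarrow> (nat \<Rightarrow> real) \<Rightarrow> nat \<Rightarrow> real" where
  "complete_homogeneous n z r = (\<Sum>d\<in>compositions n r. \<Prod>j<n. z j ^ d j)"

lemma sum_T:
  assumes "N = (\<Sum>i<m. R i)"
  shows "(\<Sum>c\<in>compositions n N. T m n R c W * (\<Prod>j<n. y j ^ c j)) =
    (\<Prod>i<m. complete_homogeneous n (\<lambda>j. W i j * y j) (R i))"
proof -
  have "(\<Sum>c\<in>compositions n N. T m n R c W * (\<Prod>j<n. y j ^ c j)) =
      (\<Sum>c\<in>compositions n N. \<Sum>D\<in>tables m n R c. \<Prod>i<m. \<Prod>j<n. (W i j * y j) ^ D i j)"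
    unfolding T_def sum_distrib_right by (intro sum.cong) (auto simp: prod_weights_tables)
  also have "\<dots> = (\<Sum>D\<in>row_tables m n R. \<Prod>i<m. \<Prod>j<n. (W i j * y j) ^ D i j)"
    by (rule sum_row_tables_by_col_sums[OF assms])
  also have "\<dots> = (\<Prod>i<m. complete_homogeneous n (\<lambda>j. W i j * y j) (R i))"
    unfolding complete_homogeneous_def by (rule sum_row_tables)
  finally show ?thesis .
qed

text \<open>The term with exponent vector \<open>d\<close> in the expansion of a power of the sum of
  the \<open>z j\<close>. The field is generic because the expansion is used over the reals and, for
  stability, over the complex numbers.\<close>

definition multi_weight :: "nat \<Rightarrow> (nat \<Rightarrow> nat) \<Rightarrow> (nat \<Rightarrow> 'a) \<Rightarrow> 'a :: field_char_0" where
  "multi_weight n d z = fact (\<Sum>j<n. d j) * (\<Prod>j<n. z j ^ d j / fact (d j))"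

lemma multi_weight_mult:
  "multi_weight n d (\<lambda>j. z j * y j) = multi_weight n d z * (\<Prod>j<n. y j ^ d j)"
  by (simp add: multi_weight_def power_mult_distrib prod.distrib prod_dividef)

lemma multinomial:
  fixes z :: "nat \<Rightarrow> 'a :: field_char_0"
  shows "(\<Sum>j<n. z j) ^ r = (\<Sum>d\<in>compositions n r. multi_weight n d z)"
proof -
  \<comment> \<open>After division by \<open>fact r\<close> the summands are products over
    \<open>j\<close>, and the binomial theorem becomes the plain convolution of
    \<open>sum_compositions_Suc\<close>.\<close>
  have "(\<Sum>j<n. z j) ^ r / fact r = (\<Sum>d\<in>compositions n r. \<Prod>j<n. z j ^ d j / fact (d j))"
  proof (induction n arbitrary: r)
    case 0
    then show ?case
      by (simp add: compositions_0)
  next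
    case (Suc n)
    have "(\<Sum>j<Suc n. z j) ^ r / fact r =
        (\<Sum>k\<le>r. of_nat (r choose k) * z n ^ k * (\<Sum>j<n. z j) ^ (r - k)) / fact r"
      by (simp add: add.commute[of _ "z n"] binomial_ring)
    also have "\<dots> = (\<Sum>k\<le>r. z n ^ k / fact k * ((\<Sum>j<n. z j) ^ (r - k) / fact (r - k)))"
      unfolding sum_divide_distrib by (intro sum.cong) (auto simp: binomial_fact)
    also have "\<dots> = (\<Sum>d\<in>compositions (Suc n) r. \<Prod>j<Suc n. z j ^ d j / fact (d j))"
      unfolding sum_compositions_Suc[where f = "\<lambda>j k. z j ^ k / fact k"] Suc.IH ..
    finally show ?case .
  qed
  then have "(\<Sum>j<n. z j) ^ r = (\<Sum>d\<in>compositions n r. fact r * (\<Prod>j<n. z j ^ d j / fact (d j)))"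
    by (simp add: sum_distrib_left[symmetric] field_simps)
  also have "\<dots> = (\<Sum>d\<in>compositions n r. multi_weight n d z)"
    by (intro sum.cong) (auto simp: multi_weight_def compositions_def)
  finally show ?thesis .
qed

text \<open>The coefficient of \<open>\<Prod>j<n. y j ^ c j\<close> in \<open>\<Prod>i<m. (\<Sum>j<n. a i j * y j) ^ R i\<close>.\<close>

definition multi_coeff :: "nat \<Rightarrow> nat \<Rightarrow> (nat \<Rightarrow> nat) \<Rightarrow> (nat \<Rightarrow> nat \<Rightarrow> 'a) \<Rightarrow> (nat \<Rightarrow> nat) \<Rightarrow> 'a :: field_char_0" where
  "multi_coeff m n R a c = (\<Sum>D\<in>tables m n R c. \<Prod>i<m. multi_weight n (D i) (a i))"

lemma multi_coeff_of_real:
  "multi_coeff m n R (\<lambda>i j. of_real (a i j)) c =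
    (of_real (multi_coeff m n R a c) :: 'a :: {field_char_0, real_div_algebra})"
  by (simp add: multi_coeff_def multi_weight_def)

lemma sum_multi_coeff:
  assumes "N = (\<Sum>i<m. R i)"
  shows "(\<Sum>c\<in>compositions n N. multi_coeff m n R a c * (\<Prod>j<n. y j ^ c j)) =
    (\<Prod>i<m. (\<Sum>j<n. a i j * y j) ^ R i)"
proof -
  have "multi_coeff m n R a c * (\<Prod>j<n. y j ^ c j) =
      (\<Sum>D\<in>tables m n R c. \<Prod>i<m. multi_weight n (D i) (\<lambda>j. a i j * y j))" for c
    unfolding multi_coeff_def sum_distrib_right
  proof (rule sum.cong[OF refl])
    fix D
    assume D: "D \<in> tables m n R c"
    show "(\<Prod>i<m. multi_weight n (D i) (a i)) * (\<Prod>j<n. y j ^ c j) =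
        (\<Prod>i<m. multi_weight n (D i) (\<lambda>j. a i j * y j))"
      using prod_weights_tables[OF D, of "\<lambda>_ _. 1" y] by (simp add: multi_weight_mult prod.distrib)
  qed
  then have "(\<Sum>c\<in>compositions n N. multi_coeff m n R a c * (\<Prod>j<n. y j ^ c j)) =
      (\<Sum>c\<in>compositions n N. \<Sum>D\<in>tables m n R c. \<Prod>i<m. multi_weight n (D i) (\<lambda>j. a i j * y j))"
    by simp
  also have "\<dots> = (\<Sum>D\<in>row_tables m n R. \<Prod>i<m. multi_weight n (D i) (\<lambda>j. a i j * y j))"
    by (rule sum_row_tables_by_col_sums[OF assms])
  also have "\<dots> = (\<Prod>i<m. (\<Sum>j<n. a i j * y j) ^ R i)"
    by (simp add: sum_row_tables[where f = "\<lambda>i d. multi_weight n d (\<lambda>j. a i j * y j)"] multinomial)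
  finally show ?thesis .
qed

section \<open>Log-concave sequences\<close>

text \<open>
  Log-concavity without internal zeros (Polya frequency sequences of order two). Stating it for
  arbitrary distances \<open>d\<close> makes it stable under convolution without positivity assumptions.
\<close>

definition pf2 :: "(nat \<Rightarrow> real) \<Rightarrow> bool" where
  "pf2 f \<longleftrightarrow> (\<forall>k. 0 \<le> f k) \<and> (\<forall>a b d. a \<le> b \<longrightarrow> f a * f (b + d) \<le> f (a + d) * f b)"

lemma pf2_nonneg: "pf2 f \<Longrightarrow> 0 \<le> f k"
  by (simp add: pf2_def)

lemma pf2D: "pf2 f \<Longrightarrow> a \<le> b \<Longrightarrow> f a * f (b + d) \<le> f (a + d) * f b"
  by (simp add: pf2_def)

text \<open>The weight \<open>t = f c / f (Suc c)\<close> makes the terms of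
  \<open>f k * t ^ k\<close> at \<open>c\<close> and \<open>Suc c\<close> equal. Log-concavity then
  makes the sequence rise up to this plateau and fall after it. This is how the evaluation point is
  chosen in both capacity arguments, for a row and for a column variable.\<close>

lemma pf2_ratio_bound:
  assumes f: "pf2 f" and pos: "f c > 0" "f (Suc c) > 0"
  shows "f k * (f c / f (Suc c)) ^ k \<le> f (Suc c) * (f c / f (Suc c)) ^ Suc c"
proof -
  define t where "t = f c / f (Suc c)"
  have t: "t > 0" "f c = t * f (Suc c)"
    using pos by (auto simp: t_def)
  have up: "f (Suc c + l) * t ^ (Suc c + l) \<le> f (Suc c) * t ^ Suc c" for l
  proof (induction l)
    case (Suc l)
    have "f c * f (c + l + 1 + 1) \<le> f (c + 1) * f (c + l + 1)"
      by (rule pf2D[OF f]) auto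
    then have "f (Suc c) * (t * f (c + l + 2)) \<le> f (Suc c) * f (c + l + 1)"
      by (simp add: t(2) mult_ac)
    then have "t * f (c + l + 2) \<le> f (c + l + 1)"
      using pos by simp
    then have "t * f (c + l + 2) * t ^ (Suc c + l) \<le> f (c + l + 1) * t ^ (Suc c + l)"
      using t by (intro mult_right_mono) auto
    also have "\<dots> \<le> f (Suc c) * t ^ Suc c"
      using Suc by simp
    finally show ?case
      by (simp add: mult_ac)
  qed simp
  have down: "f (Suc c - l) * t ^ (Suc c - l) \<le> f (Suc c) * t ^ Suc c" for l
  proof (induction l)
    case (Suc l)
    show ?case
    proof (cases "l \<le> c")
      case True
      then have l: "Suc c - l = Suc (Suc c - Suc l)"
        by simp
      have "f (c - l) * f (c + 1) \<le> f (c - l + 1) * f c"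
        by (rule pf2D[OF f]) auto
      then have "f (Suc c) * f (c - l) \<le> f (Suc c) * (t * f (c - l + 1))"
        by (simp add: t(2) mult_ac)
      then have "f (c - l) \<le> t * f (c - l + 1)"
        using pos by simp
      then have "f (c - l) * t ^ (c - l) \<le> t * f (c - l + 1) * t ^ (c - l)"
        using t by (intro mult_right_mono) auto
      also have "\<dots> = f (Suc c - l) * t ^ (Suc c - l)"
        using True by (simp add: Suc_diff_le)
      also note Suc
      finally show ?thesis by simp
    qed (use Suc in auto)
  qed simp
  show ?thesis
    unfolding t_def[symmetric]
    using up[of "k - Suc c"] down[of "Suc c - k"] by (cases "k \<le> Suc c") auto
qed

text \<open>These are the coefficients of (\<alpha> + X) f(X). Expanding both sides gives four
  comparisons, each an instance of \<open>pf2D\<close> for \<open>f\<close> with indices shifted by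
  at most one; for a = b or d = 0 the two sides agree.\<close>

lemma pf2_mult_linear:
  assumes f: "pf2 f" and \<alpha>: "0 \<le> \<alpha>"
  shows "pf2 (\<lambda>k. \<alpha> * f k + (case k of 0 \<Rightarrow> 0 | Suc k \<Rightarrow> f k))"
proof -
  define g where "g k = (case k of 0 \<Rightarrow> 0 | Suc k \<Rightarrow> f k)" for k
  have g [simp]: "g 0 = 0" "g (Suc k) = f k" for k
    by (auto simp: g_def)
  have nn: "0 \<le> f k" "0 \<le> g k" for k
    using f by (auto simp: pf2_def g_def split: nat.split)
  have "(\<alpha> * f a + g a) * (\<alpha> * f (b + d) + g (b + d)) \<le> (\<alpha> * f (a + d) + g (a + d)) * (\<alpha> * f b + g b)"
    if ab: "a \<le> b" for a b d
  proof (cases "a < b \<and> 0 < d")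
    case True
    then obtain b' d' where [simp]: "b = Suc b'" "d = Suc d'"
      by (cases b; cases d) auto
    have 1: "f a * f (b + d) \<le> f (a + d) * f b"
      by (rule pf2D[OF f ab])
    have 2: "g a * g (b + d) \<le> g (a + d) * g b"
    proof (cases a)
      case (Suc a')
      then show ?thesis
        using pf2D[OF f, of a' b' d] ab by simp
    qed (use nn in auto)
    have 3: "f a * g (b + d) \<le> f (a + d) * g b"
      using pf2D[OF f, of a b' d] True by simp
    have 4: "g a * f (b + d) \<le> g (a + d) * f b"
    proof (cases a)
      case (Suc a')
      then show ?thesis
        using pf2D[OF f, of a' b d] ab by simp
    qed (use nn in auto)
    have "(\<alpha> * f a + g a) * (\<alpha> * f (b + d) + g (b + d)) =
        \<alpha>\<^sup>2 * (f a * f (b + d)) + g a * g (b + d) + \<alpha> * (f a * g (b + d)) + \<alpha> * (g a * f (b + d))"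
      by (simp add: algebra_simps power2_eq_square)
    also have "\<dots> \<le> \<alpha>\<^sup>2 * (f (a + d) * f b) + g (a + d) * g b + \<alpha> * (f (a + d) * g b) + \<alpha> * (g (a + d) * f b)"
      using 1 2 3 4 \<alpha> by (intro add_mono mult_left_mono) auto
    also have "\<dots> = (\<alpha> * f (a + d) + g (a + d)) * (\<alpha> * f b + g b)"
      by (simp add: algebra_simps power2_eq_square)
    finally show ?thesis .
  next
    case False
    then have "a = b \<or> d = 0"
      using ab by auto
    then show ?thesis
      by (auto simp: mult.commute)
  qed
  then show ?thesis
    using nn \<alpha> unfolding pf2_def g_def[symmetric] by simp
qed

text \<open>The convolution \<open>g\<close> obeys g(r + 1) = f(r + 1) + z g(r). Induction on the
  distance \<open>d\<close> therefore reduces the claim to the mixed comparison \<open>cross\<close>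
  of \<open>g\<close> with \<open>f\<close>.\<close>

lemma pf2_conv_geometric:
  assumes f: "pf2 f" and z: "0 \<le> z"
  shows "pf2 (\<lambda>r. \<Sum>k\<le>r. z ^ k * f (r - k))"
proof -
  define g where "g r = (\<Sum>k\<le>r. z ^ k * f (r - k))" for r
  have nn: "0 \<le> f k" "0 \<le> g k" for k
    using f z by (auto simp: pf2_def g_def intro!: sum_nonneg)
  have g_Suc: "g (Suc r) = f (Suc r) + z * g r" for r
    by (simp add: g_def sum.atMost_Suc_shift sum_distrib_left mult_ac del: sum.atMost_Suc)
  have cross: "g a * f (Suc (b + d)) \<le> f (Suc (a + d)) * g b" if "a \<le> b" for a b d
  proof -
    have "g a * f (Suc (b + d)) = (\<Sum>k\<le>a. z ^ k * (f (a - k) * f (Suc (b + d))))"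
      unfolding g_def sum_distrib_right by (simp add: mult.assoc)
    \<comment> \<open>Lowering both base points by \<open>k\<close> while raising the distance by
      \<open>k\<close> leaves the two outer indices fixed; this is where arbitrary distances in
      \<open>pf2\<close> pay off.\<close>
    also have "\<dots> \<le> (\<Sum>k\<le>a. z ^ k * (f (Suc (a + d)) * f (b - k)))"
    proof (intro sum_mono mult_left_mono)
      fix k assume "k \<in> {..a}"
      then show "f (a - k) * f (Suc (b + d)) \<le> f (Suc (a + d)) * f (b - k)"
        using pf2D[OF f, of "a - k" "b - k" "Suc (d + k)"] that by simp
    qed (use z in auto)
    also have "\<dots> \<le> (\<Sum>k\<le>b. z ^ k * (f (Suc (a + d)) * f (b - k)))"
      using that z nn by (intro sum_mono2) auto
    also have "\<dots> = f (Suc (a + d)) * g b"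
      by (simp add: g_def sum_distrib_left mult_ac)
    finally show ?thesis .
  qed
  have "g a * g (b + d) \<le> g (a + d) * g b" if ab: "a \<le> b" for a b d
  proof (induction d)
    case (Suc d)
    have "g a * g (b + Suc d) = g a * f (Suc (b + d)) + z * (g a * g (b + d))"
      by (simp add: g_Suc algebra_simps)
    also have "\<dots> \<le> f (Suc (a + d)) * g b + z * (g (a + d) * g b)"
      using Suc z cross[OF ab] by (intro add_mono mult_left_mono) auto
    also have "\<dots> = g (a + Suc d) * g b"
      by (simp add: g_Suc algebra_simps)
    finally show ?case .
  qed simp
  then show ?thesis
    using nn unfolding pf2_def g_def[symmetric] by simp
qed

section \<open>Complete homogeneous polynomials and the capacity of a single row\<close>

lemma complete_homogeneous_0: "complete_homogeneous 0 z r = (if r = 0 then 1 else 0)"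
  by (simp add: complete_homogeneous_def compositions_0)

lemma complete_homogeneous_Suc: "complete_homogeneous (Suc n) z r = (\<Sum>k\<le>r. z n ^ k * complete_homogeneous n z (r - k))"
  unfolding complete_homogeneous_def by (rule sum_compositions_Suc[where f = "\<lambda>j k. z j ^ k"])

lemma pf2_complete_homogeneous:
  assumes "\<And>j. j < n \<Longrightarrow> 0 \<le> z j"
  shows "pf2 (complete_homogeneous n z)"
  using assms
proof (induction n)
  case 0
  then show ?case
    by (auto simp: pf2_def complete_homogeneous_0)
next
  case (Suc n)
  then show ?case
    unfolding complete_homogeneous_Suc by (intro pf2_conv_geometric) auto
qed

lemma complete_homogeneous_pos:
  assumes "0 < n" and "\<And>j. j < n \<Longrightarrow> 0 < z j"
  shows "0 < complete_homogeneous n z r"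
  unfolding complete_homogeneous_def
proof (rule sum_pos)
  show "compositions n r \<noteq> {}"
  proof -
    have "(\<lambda>j. if j = 0 then r else 0) \<in> compositions n r"
      using assms(1) by (auto simp: compositions_def sum.If_cases)
    then show ?thesis by blast
  qed
qed (use assms in \<open>auto simp: finite_compositions intro!: prod_pos\<close>)

lemma complete_homogeneous_nonneg: "(\<And>j. j < n \<Longrightarrow> 0 \<le> z j) \<Longrightarrow> 0 \<le> complete_homogeneous n z r"
  using pf2_complete_homogeneous pf2_nonneg by blast

lemma complete_homogeneous_scale: "complete_homogeneous n (\<lambda>j. x * z j) r = x ^ r * complete_homogeneous n z r"
proof -
  have "(\<Prod>j<n. (x * z j) ^ d j) = x ^ r * (\<Prod>j<n. z j ^ d j)" if "d \<in> compositions n r" for d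
    using that by (simp add: power_mult_distrib prod.distrib compositions_def power_sum[symmetric])
  then show ?thesis
    by (simp add: complete_homogeneous_def sum_distrib_left)
qed

lemma complete_homogeneous_sums:
  assumes "\<And>j. j < n \<Longrightarrow> 0 \<le> z j" and "\<And>j. j < n \<Longrightarrow> z j < 1"
  shows "complete_homogeneous n z sums (\<Prod>j<n. 1 / (1 - z j))"
  using assms
proof (induction n)
  case 0
  then show ?case
    using sums_single[of 0 "\<lambda>_. 1::real"] by (simp add: complete_homogeneous_0[abs_def])
next
  case (Suc n)
  have IH: "complete_homogeneous n z sums (\<Prod>j<n. 1 / (1 - z j))"
    using Suc by auto
  have geo: "(\<lambda>k. z n ^ k) sums (1 / (1 - z n))"
    using Suc.prems by (intro geometric_sums) auto
  have "(\<lambda>r. \<Sum>k\<le>r. z n ^ k * complete_homogeneous n z (r - k)) sums ((\<Sum>k. z n ^ k) * (\<Sum>k. complete_homogeneous n z k))"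
    by (rule Cauchy_product_sums)
      (use IH geo Suc.prems in \<open>auto simp: sums_iff complete_homogeneous_nonneg norm_power\<close>)
  then show ?case
    using IH geo by (simp add: complete_homogeneous_Suc[abs_def] sums_iff mult.commute)
qed

lemma complete_homogeneous_le:
  assumes "\<And>j. j < n \<Longrightarrow> 0 \<le> z j" and "\<And>j. j < n \<Longrightarrow> z j < 1"
  shows "complete_homogeneous n z r \<le> (\<Prod>j<n. 1 / (1 - z j))"
proof -
  note s = complete_homogeneous_sums[OF assms]
  have "(\<Sum>k\<in>{r}. complete_homogeneous n z k) \<le> suminf (complete_homogeneous n z)"
    using s complete_homogeneous_nonneg[OF assms(1)] by (intro sum_le_suminf) (auto simp: sums_iff)
  then show ?thesis
    using s by (simp add: sums_iff)
qed

text \<open>Raising the exponent of \<open>z j\<close> by one maps compositions of r injectively to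
  compositions of r + 1. The bound keeps the ratio of consecutive values at most 1 / z j, which
  makes the point chosen in \<open>complete_homogeneous_capacity\<close> admissible.\<close>

lemma complete_homogeneous_ge_mult:
  assumes "\<And>j. j < n \<Longrightarrow> 0 \<le> z j" and "j < n"
  shows "z j * complete_homogeneous n z r \<le> complete_homogeneous n z (Suc r)"
proof -
  have "z j * complete_homogeneous n z r = (\<Sum>d\<in>compositions n r. \<Prod>i<n. z i ^ (d(j := Suc (d j))) i)"
    unfolding complete_homogeneous_def sum_distrib_left
  proof (intro sum.cong refl)
    fix d
    have "(\<Prod>i<n. z i ^ (d(j := Suc (d j))) i) = (\<Prod>i<n. (if i = j then z j else 1) * z i ^ d i)"
      by (intro prod.cong) auto
    also have "\<dots> = z j * (\<Prod>i<n. z i ^ d i)"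
      using assms(2) by (simp add: prod.distrib)
    finally show "z j * (\<Prod>i<n. z i ^ d i) = (\<Prod>i<n. z i ^ (d(j := Suc (d j))) i)" ..
  qed
  also have "\<dots> = (\<Sum>d\<in>(\<lambda>d. d(j := Suc (d j))) ` compositions n r. \<Prod>i<n. z i ^ d i)"
    by (subst sum.reindex) (auto simp: inj_on_def fun_eq_iff split: if_splits)
  also have "\<dots> \<le> complete_homogeneous n z (Suc r)"
    unfolding complete_homogeneous_def
  proof (rule sum_mono2)
    show "(\<lambda>d. d(j := Suc (d j))) ` compositions n r \<subseteq> compositions n (Suc r)"
    proof safe
      fix d assume d: "d \<in> compositions n r"
      have "(\<Sum>i<n. (d(j := Suc (d j))) i) = (\<Sum>i<n. d i + (if i = j then 1 else 0))"
        by (intro sum.cong) auto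
      also have "\<dots> = Suc r"
        using d assms(2) by (simp add: sum.distrib compositions_def)
      finally show "d(j := Suc (d j)) \<in> compositions n (Suc r)"
        using d assms(2) by (auto simp: compositions_def)
    qed
  qed (use assms in \<open>auto simp: finite_compositions intro!: prod_nonneg\<close>)
  finally show ?thesis .
qed

text \<open>At the ratio \<open>q\<close> of the values in degrees r - 1 and r,
  \<open>pf2_ratio_bound\<close> makes the degree r term the largest of the generating series. The
  series may diverge there, so \<open>q\<close> is shrunk by \<theta> < 1, and the series is
  dominated by its largest term times a geometric series in \<theta>.\<close>

lemma complete_homogeneous_capacity:
  assumes n: "0 < n" and z: "\<And>j. j < n \<Longrightarrow> 0 < z j" and r: "0 < r"
  shows "\<exists>x>0. (\<forall>j<n. z j * x < 1) \<and>
    (\<Prod>j<n. 1 / (1 - z j * x)) \<le> 4 * real (r + 1) * complete_homogeneous n z r * x ^ r"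
proof -
  obtain s where s: "r = Suc s"
    using r by (cases r) auto
  define q where "q = complete_homogeneous n z s / complete_homogeneous n z r"
  \<comment> \<open>This value maximises \<theta>^r (1 - \<theta>): the geometric series sums to r +
    1, while the loss \<theta>^(-r) = (1 + 1/r)^r stays below e, hence below 4.\<close>
  define \<theta> where "\<theta> = real r / real (r + 1)"
  define x where "x = q * \<theta>"
  have pf: "pf2 (complete_homogeneous n z)"
    using z by (intro pf2_complete_homogeneous) (auto intro: less_imp_le)
  have pos: "complete_homogeneous n z k > 0" for k
    by (rule complete_homogeneous_pos[OF n z])
  have q: "q > 0"
    using pos by (simp add: q_def)
  have \<theta>: "0 < \<theta>" "\<theta> < 1"
    using r by (auto simp: \<theta>_def)
  have x: "x > 0"
    using q \<theta> by (simp add: x_def)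
  have zx: "z j * x < 1" if j: "j < n" for j
  proof -
    have "z j * q \<le> 1"
      using complete_homogeneous_ge_mult[of n z j s] z j pos[of r] by (simp add: q_def s field_simps less_imp_le)
    then have "z j * q * \<theta> \<le> 1 * \<theta>"
      using \<theta> by (intro mult_right_mono) auto
    then have "z j * q * \<theta> < 1"
      using \<theta> by linarith
    then show ?thesis
      by (simp add: x_def mult.assoc)
  qed
  have sums: "complete_homogeneous n (\<lambda>j. z j * x) sums (\<Prod>j<n. 1 / (1 - z j * x))"
  proof (rule complete_homogeneous_sums)
    show "0 \<le> z j * x" if "j < n" for j
      using z[OF that] x by simp
  qed (rule zx)
  have le: "complete_homogeneous n (\<lambda>j. z j * x) k \<le> complete_homogeneous n z r * q ^ r * \<theta> ^ k" for k
  proof -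
    have "complete_homogeneous n (\<lambda>j. z j * x) k = complete_homogeneous n z k * q ^ k * \<theta> ^ k"
      using complete_homogeneous_scale[of n x z k] by (simp add: x_def power_mult_distrib mult_ac)
    also have "\<dots> \<le> complete_homogeneous n z r * q ^ r * \<theta> ^ k"
      using pf2_ratio_bound[OF pf, of s k] pos \<theta>
      by (intro mult_right_mono) (auto simp: q_def s)
    finally show ?thesis .
  qed
  have geo: "(\<lambda>k. complete_homogeneous n z r * q ^ r * \<theta> ^ k) sums (complete_homogeneous n z r * q ^ r * (1 / (1 - \<theta>)))"
    using \<theta> by (intro sums_mult geometric_sums) auto
  have "(\<Prod>j<n. 1 / (1 - z j * x)) \<le> complete_homogeneous n z r * q ^ r * (1 / (1 - \<theta>))"
    by (rule sums_le[OF le sums geo])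
  also have "\<dots> = complete_homogeneous n z r * q ^ r * real (r + 1)"
    by (simp add: \<theta>_def field_simps)
  also have "\<dots> \<le> complete_homogeneous n z r * q ^ r * real (r + 1) * (4 * \<theta> ^ r)"
  proof -
    have "(1 / \<theta>) ^ r = (1 + 1 / real r) ^ r"
      using r by (simp add: \<theta>_def field_simps)
    also have "\<dots> \<le> exp (1 / real r) ^ r"
      by (intro power_mono exp_ge_add_one_self) auto
    also have "\<dots> = exp 1"
      using r by (simp add: exp_of_nat_mult[symmetric])
    also have "\<dots> \<le> 4"
      using exp_le by simp
    finally have "1 \<le> 4 * \<theta> ^ r"
      using \<theta> by (simp add: field_simps)
    moreover have "0 \<le> complete_homogeneous n z r * q ^ r * real (r + 1)"
      using pos[of r] q by simp
    ultimately show ?thesis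
      using mult_left_mono[of 1 "4 * \<theta> ^ r" "complete_homogeneous n z r * q ^ r * real (r + 1)"]
      by simp
  qed
  also have "\<dots> = 4 * real (r + 1) * complete_homogeneous n z r * x ^ r"
    by (simp add: x_def power_mult_distrib)
  finally show ?thesis
    using x zx by (intro exI[of _ x]) simp
qed

section \<open>Half-plane stability and capacity\<close>

text \<open>The logarithmic derivative is the sum of 1 / (z - w) over the roots w with multiplicity,
  and each summand has positive real part because Re z >= 0 > Re w. Hence the derivative has no root
  with Re z >= 0, as in the Gauss-Lucas theorem.\<close>

lemma Re_logderiv_pos:
  fixes p :: "complex poly"
  assumes "\<And>w. poly p w = 0 \<Longrightarrow> Re w < 0" and "degree p > 0" and "Re z \<ge> 0"
  shows "Re (poly (pderiv p) z / poly p z) > 0"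
  using assms(1,2)
proof (induction "degree p" arbitrary: p)
  case 0
  then show ?case by simp
next
  case (Suc d p)
  obtain w where w: "poly p w = 0"
    using Suc.prems(2) alg_closed_imp_poly_has_root by blast
  then obtain q where q: "p = [:-w, 1:] * q"
    unfolding poly_eq_0_iff_dvd by (elim dvdE)
  have "p \<noteq> 0"
    using Suc.hyps(2) by auto
  then have q0: "q \<noteq> 0"
    using q by auto
  have Rew: "Re w < 0"
    using Suc.prems(1) w by blast
  have deg: "degree p = Suc (degree q)"
    unfolding q using q0 by (subst degree_mult_eq) auto
  have roots: "Re v < 0" if "poly q v = 0" for v
    using Suc.prems(1)[of v] that by (simp add: q)
  have pos: "Re (1 / (z - w)) > 0"
  proof -
    have "Re (z - w) > 0"
      using Rew assms(3) by simp
    then show ?thesis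
      by (simp add: Re_divide divide_pos_pos zero_less_power2 sum_power2_gt_zero_iff)
  qed
  have nz: "z \<noteq> w" "poly q z \<noteq> 0"
    using Rew assms(3) roots[of z] by auto
  have pd: "poly (pderiv p) z = poly q z + (z - w) * poly (pderiv q) z"
    unfolding q pderiv_mult by (simp add: pderiv_pCons algebra_simps del: mult_pCons_left)
  have "poly p z = (z - w) * poly q z"
    by (simp add: q algebra_simps)
  then have eq: "poly (pderiv p) z / poly p z = 1 / (z - w) + poly (pderiv q) z / poly q z"
    using nz by (simp add: pd add_divide_distrib)
  show ?case
  proof (cases "degree q = 0")
    case True
    then have "pderiv q = 0"
      by (simp add: pderiv_eq_0_iff)
    then show ?thesis
      using eq pos by simp
  next
    case False
    then show ?thesis
      using Suc.hyps(1)[of q] Suc.hyps(2) deg roots pos eq by simp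
  qed
qed

text \<open>Up to a factorial, the k-th coefficient is the k-th derivative at 0, and by
  \<open>Re_logderiv_pos\<close> differentiation keeps all roots in the open left
  half-plane.\<close>

lemma coeff_nonzero_of_left_half_plane:
  fixes p :: "complex poly"
  assumes "p \<noteq> 0" and "\<And>w. poly p w = 0 \<Longrightarrow> Re w < 0" and "k \<le> degree p"
  shows "coeff p k \<noteq> 0"
  using assms
proof (induction k arbitrary: p)
  case 0
  then show ?case
    using poly_0_coeff_0[of p] by fastforce
next
  case (Suc k)
  have roots: "Re w < 0" if "poly (pderiv p) w = 0" for w
    using Re_logderiv_pos[of p w] Suc.prems that by fastforce
  have "pderiv p \<noteq> 0"
    using Suc.prems(3) by (simp add: pderiv_eq_0_iff)
  then have "coeff (pderiv p) k \<noteq> 0"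
    using Suc.prems(3) roots by (intro Suc.IH) (auto simp: degree_pderiv)
  then show ?case
    by (simp add: coeff_pderiv)
qed

lemma poly_map_poly_of_real:
  "poly (map_poly complex_of_real p) (complex_of_real x) = complex_of_real (poly p x)"
  by (induction p) (auto simp: map_poly_pCons)

lemma map_poly_of_real_linear_mult:
  "map_poly complex_of_real ([:\<alpha>, 1:] * q) = [:complex_of_real \<alpha>, 1:] * map_poly complex_of_real q"
  by (rule poly_eqI) (simp add: coeff_map_poly coeff_pCons split: nat.split)

text \<open>A root -\<alpha> with \<alpha> >= 0 splits off the real factor X + \<alpha>, and
  \<open>pf2_mult_linear\<close> puts it back. This is a form of Newton's inequalities that also
  excludes internal zeros.\<close>

lemma pf2_coeff_real_rooted:
  fixes p :: "real poly"
  assumes "lead_coeff p > 0"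
    and "\<And>z. poly (map_poly complex_of_real p) z = 0 \<Longrightarrow> z \<in> \<real> \<and> Re z \<le> 0"
  shows "pf2 (coeff p)"
  using assms
proof (induction "degree p" arbitrary: p)
  case 0
  then obtain c where c: "p = [:c:]"
    by (metis degree_eq_zeroE)
  show ?case
    using 0 unfolding c pf2_def by (auto simp: coeff_pCons split: nat.splits)
next
  case (Suc d p)
  have "degree (map_poly complex_of_real p) = degree p"
    by (rule degree_map_poly) simp
  then obtain z where z: "poly (map_poly complex_of_real p) z = 0"
    using Suc.hyps(2) alg_closed_imp_poly_has_root[of "map_poly complex_of_real p"] by auto
  define \<alpha> where "\<alpha> = - Re z"
  have \<alpha>: "z = complex_of_real (-\<alpha>)" "\<alpha> \<ge> 0"
    using Suc.prems(2)[OF z] by (auto simp: \<alpha>_def complex_is_Real_iff complex_eq_iff)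
  have "poly p (-\<alpha>) = 0"
    using z unfolding \<alpha>(1) poly_map_poly_of_real by simp
  then obtain q where q: "p = [:\<alpha>, 1:] * q"
    unfolding poly_eq_0_iff_dvd by (auto elim!: dvdE)
  have q0: "q \<noteq> 0"
    using Suc.hyps(2) q by auto
  have "pf2 (coeff q)"
  proof (rule Suc.hyps(1))
    show "d = degree q"
      using Suc.hyps(2) q0 unfolding q by (subst (asm) degree_mult_eq) auto
    show "lead_coeff q > 0"
      using Suc.prems(1) unfolding q lead_coeff_mult by simp
    show "z \<in> \<real> \<and> Re z \<le> 0" if "poly (map_poly complex_of_real q) z = 0" for z
    proof (rule Suc.prems(2))
      show "poly (map_poly complex_of_real p) z = 0"
        unfolding q map_poly_of_real_linear_mult
        using that by simp
    qed
  qed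
  from pf2_mult_linear[OF this \<alpha>(2)]
  have "pf2 (\<lambda>k. \<alpha> * coeff q k + (case k of 0 \<Rightarrow> 0 | Suc k \<Rightarrow> coeff q k))" .
  also have "(\<lambda>k. \<alpha> * coeff q k + (case k of 0 \<Rightarrow> 0 | Suc k \<Rightarrow> coeff q k)) = coeff p"
    by (rule ext) (auto simp: q coeff_pCons split: nat.split)
  finally show ?case .
qed

text \<open>
  Arguments equal to 0 are admitted, so that stability passes to the coefficients of a single
  variable: a root on the imaginary axis can be rotated into the open half plane by homogeneity.
\<close>

locale stable_coeffs =
  fixes n N :: nat and S :: "(nat \<Rightarrow> nat) \<Rightarrow> real"
  assumes coeff_nonneg: "\<And>c. c \<in> compositions n N \<Longrightarrow> 0 \<le> S c"
    and nonvanishing: "\<And>y :: nat \<Rightarrow> complex. (\<And>l. l < n \<Longrightarrow> y l = 0 \<or> Re (y l) > 0) \<Longrightarrow> (\<exists>l<n. y l \<noteq> 0) \<Longrightarrow>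
      (\<Sum>c\<in>compositions n N. of_real (S c) * (\<Prod>l<n. y l ^ c l)) \<noteq> 0"
begin

text \<open>
  The coefficient of \<open>y\<^sub>0\<^bsup>C 0\<^esup> \<cdots> y\<^bsub>j-1\<^esub>\<^bsup>C (j-1)\<^esup>\<close> as a polynomial in the remaining variables.
\<close>

definition partial :: "nat \<Rightarrow> (nat \<Rightarrow> nat) \<Rightarrow> (nat \<Rightarrow> 'a :: real_normed_field) \<Rightarrow> 'a" where
  "partial j C y = (\<Sum>c | c \<in> compositions n N \<and> (\<forall>l<j. c l = C l). of_real (S c) * (\<Prod>l\<in>{j..<n}. y l ^ c l))"

lemma finite_partial: "finite {c. c \<in> compositions n N \<and> P c}"
  by (rule finite_subset[OF _ finite_compositions[of n N]]) auto

lemma partial_0: "partial 0 C y = (\<Sum>c\<in>compositions n N. of_real (S c) * (\<Prod>l<n. y l ^ c l))"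
  by (simp add: partial_def lessThan_atLeast0)

lemma partial_of_real: "partial j C (\<lambda>l. of_real (y l)) = (of_real (partial j C y) :: complex)"
  unfolding partial_def by simp

lemma partial_expand:
  assumes j: "j < n"
  shows "partial j C (y(j := t)) = (\<Sum>k\<le>N. partial (Suc j) (C(j := k)) y * t ^ k)"
proof -
  let ?A = "{c. c \<in> compositions n N \<and> (\<forall>l<j. c l = C l)}"
  let ?g = "\<lambda>c. of_real (S c) * (\<Prod>l\<in>{Suc j..<n}. y l ^ c l) * t ^ c j"
  have "partial j C (y(j := t)) = (\<Sum>c\<in>?A. ?g c)"
    unfolding partial_def
  proof (intro sum.cong refl)
    fix c
    have "(\<Prod>l\<in>{j..<n}. (y(j := t)) l ^ c l) = t ^ c j * (\<Prod>l\<in>{Suc j..<n}. (y(j := t)) l ^ c l)"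
      using j by (subst prod.atLeast_Suc_lessThan) auto
    also have "(\<Prod>l\<in>{Suc j..<n}. (y(j := t)) l ^ c l) = (\<Prod>l\<in>{Suc j..<n}. y l ^ c l)"
      by (intro prod.cong) auto
    finally show "of_real (S c) * (\<Prod>l\<in>{j..<n}. (y(j := t)) l ^ c l) = ?g c"
      by simp
  qed
  also have "\<dots> = (\<Sum>k\<le>N. \<Sum>c\<in>{c\<in>?A. c j = k}. ?g c)"
    using compositions_le by (intro sum.group[symmetric] finite_partial) auto
  also have "\<dots> = (\<Sum>k\<le>N. partial (Suc j) (C(j := k)) y * t ^ k)"
    unfolding partial_def sum_distrib_right
    by (intro sum.cong) (auto simp: less_Suc_eq)
  finally show ?thesis .
qed

lemma sum_tail:
  assumes "c \<in> compositions n N" "\<And>l. l < j \<Longrightarrow> c l = C l" "j \<le> n"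
  shows "(\<Sum>l<j. C l) + (\<Sum>l\<in>{j..<n}. c l) = N"
proof -
  have "(\<Sum>l<j. C l) = (\<Sum>l<j. c l)"
    using assms by (intro sum.cong) auto
  moreover have "(\<Sum>l<j. c l) + (\<Sum>l\<in>{j..<n}. c l) = (\<Sum>l<n. c l)"
    using assms(3) sum.atLeastLessThan_concat[of 0 j n c] by (simp add: lessThan_atLeast0)
  ultimately show ?thesis
    using assms(1) by (simp add: compositions_def)
qed

lemma partial_scale:
  assumes "j \<le> n"
  shows "partial j C (\<lambda>l. u * y l) = u ^ (N - (\<Sum>l<j. C l)) * partial j C y"
  unfolding partial_def sum_distrib_left
proof (intro sum.cong refl)
  fix c assume "c \<in> {c. c \<in> compositions n N \<and> (\<forall>l<j. c l = C l)}"
  then have "(\<Sum>l\<in>{j..<n}. c l) = N - (\<Sum>l<j. C l)"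
    using sum_tail[of c j C] assms by auto
  then show "of_real (S c) * (\<Prod>l\<in>{j..<n}. (u * y l) ^ c l) =
      u ^ (N - (\<Sum>l<j. C l)) * (of_real (S c) * (\<Prod>l\<in>{j..<n}. y l ^ c l))"
    by (simp add: power_mult_distrib prod.distrib power_sum[symmetric])
qed

text \<open>With \<open>partial_full\<close> and \<open>partial_zero\<close> this distinguishes the
  sign of the remaining degree N minus the sum of the fixed exponents: no monomial is left if it is
  negative, a constant if it is 0, and a polynomial vanishing at the origin if it is
  positive.\<close>

lemma partial_eq_0:
  assumes "j \<le> n" "N < (\<Sum>l<j. C l)"
  shows "partial j C y = 0"
proof -
  have "{c. c \<in> compositions n N \<and> (\<forall>l<j. c l = C l)} = {}"
  proof (intro equals0I)
    fix c assume "c \<in> {c. c \<in> compositions n N \<and> (\<forall>l<j. c l = C l)}"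
    then show False
      using sum_tail[of c j C] assms by auto
  qed
  then show ?thesis
    unfolding partial_def by (simp only: sum.empty)
qed

lemma partial_full:
  fixes y y' :: "nat \<Rightarrow> 'a :: real_normed_field"
  assumes "j \<le> n" "(\<Sum>l<j. C l) = N"
  shows "partial j C y = partial j C y'"
  unfolding partial_def
proof (intro sum.cong refl arg_cong2[of _ _ _ _ "(*)"] prod.cong)
  fix c l assume "c \<in> {c. c \<in> compositions n N \<and> (\<forall>l<j. c l = C l)}" "l \<in> {j..<n}"
  then have "c l = 0"
    using sum_tail[of c j C] assms by auto
  then show "y l ^ c l = y' l ^ c l"
    by simp
qed

lemma partial_zero:
  assumes "j \<le> n" "(\<Sum>l<j. C l) < N"
  shows "partial j C (\<lambda>_. 0) = 0"
  unfolding partial_def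
proof (intro sum.neutral ballI)
  fix c assume "c \<in> {c. c \<in> compositions n N \<and> (\<forall>l<j. c l = C l)}"
  then have "(\<Sum>l<j. C l) + (\<Sum>l\<in>{j..<n}. c l) = N"
    using sum_tail[of c j C] assms by auto
  then have "(\<Sum>l\<in>{j..<n}. c l) \<noteq> 0"
    using assms(2) by linarith
  then obtain l where "l \<in> {j..<n}" "c l \<noteq> 0"
    by (meson sum.neutral)
  then have "(\<Prod>l\<in>{j..<n}. (0::'a) ^ c l) = 0"
    by (intro prod_zero bexI[of _ l]) auto
  then show "of_real (S c) * (\<Prod>l\<in>{j..<n}. (0::'a) ^ c l) = 0"
    by simp
qed

definition tail_poly :: "nat \<Rightarrow> (nat \<Rightarrow> nat) \<Rightarrow> (nat \<Rightarrow> 'a :: real_normed_field) \<Rightarrow> 'a poly" where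
  "tail_poly j C y = (\<Sum>k\<le>N. monom (partial (Suc j) (C(j := k)) y) k)"

lemma coeff_tail_poly:
  "coeff (tail_poly j C y) k = (if k \<le> N then partial (Suc j) (C(j := k)) y else 0)"
  by (simp add: tail_poly_def coeff_sum)

lemma poly_tail_poly: "j < n \<Longrightarrow> poly (tail_poly j C y) t = partial j C (y(j := t))"
  by (simp add: tail_poly_def poly_sum poly_monom partial_expand)

definition semistable :: "nat \<Rightarrow> (nat \<Rightarrow> nat) \<Rightarrow> bool" where
  "semistable j C \<longleftrightarrow> (\<forall>y :: nat \<Rightarrow> complex. (\<forall>l\<in>{j..<n}. y l = 0 \<or> Re (y l) > 0) \<longrightarrow>
    (\<exists>l\<in>{j..<n}. y l \<noteq> 0) \<longrightarrow> partial j C y \<noteq> 0)"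

text \<open>By homogeneity a common rotation of the arguments only multiplies the value by a nonzero
  number, so any open half-plane with 0 on its boundary can replace the right one.\<close>

lemma semistable_rotate:
  assumes st: "semistable j C" and j: "j \<le> n"
    and y: "\<And>l. l \<in> {j..<n} \<Longrightarrow> y l = 0 \<or> Re (u * y l) > 0" "\<exists>l\<in>{j..<n}. y l \<noteq> 0" and u: "u \<noteq> 0"
  shows "partial j C y \<noteq> 0"
proof -
  have "partial j C (\<lambda>l. u * y l) \<noteq> 0"
    by (rule st[unfolded semistable_def, rule_format]) (use y u in auto)
  then show ?thesis
    unfolding partial_scale[OF j] by auto
qed

text \<open>The top coefficient has no variables left, so it does not depend on \<open>y\<close> and
  may be read off at the unit vector in direction \<open>j\<close>. There all other coefficients
  vanish by degree, and semistability, which admits zero arguments, says that the value is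
  nonzero.\<close>

lemma tail_poly_degree:
  assumes st: "semistable j C" and j: "j < n" and sum: "(\<Sum>l<j. C l) \<le> N"
  shows "degree (tail_poly j C (y :: nat \<Rightarrow> complex)) = N - (\<Sum>l<j. C l)"
    and "tail_poly j C y \<noteq> 0"
proof -
  let ?M = "N - (\<Sum>l<j. C l)"
  have sumj: "(\<Sum>l<Suc j. (C(j := k)) l) = (\<Sum>l<j. C l) + k" for k
  proof -
    have "(\<Sum>l<j. (C(j := k)) l) = (\<Sum>l<j. C l)"
      by (intro sum.cong) auto
    then show ?thesis by simp
  qed
  have "partial j C ((\<lambda>_. 0)(j := 1)) \<noteq> (0 :: complex)"
    using st j unfolding semistable_def by auto
  moreover have "partial j C ((\<lambda>_. 0)(j := 1 :: complex)) = (\<Sum>k\<le>N. partial (Suc j) (C(j := k)) (\<lambda>_. 0))"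
    using partial_expand[OF j, of C "\<lambda>_. 0 :: complex" 1] by simp
  moreover have "\<dots> = (\<Sum>k\<in>{?M}. partial (Suc j) (C(j := k)) (\<lambda>_. 0))"
  proof (rule sum.mono_neutral_right)
    show "\<forall>k\<in>{..N} - {?M}. partial (Suc j) (C(j := k)) (\<lambda>_. 0 :: complex) = 0"
    proof
      fix k assume "k \<in> {..N} - {?M}"
      then have "k < ?M \<or> ?M < k"
        by auto
      then show "partial (Suc j) (C(j := k)) (\<lambda>_. 0 :: complex) = 0"
      proof
        assume "k < ?M"
        then show ?thesis
          using j sum by (intro partial_zero, unfold sumj) auto
      next
        assume "?M < k"
        then show ?thesis
          using j sum by (intro partial_eq_0, unfold sumj) auto
      qed
    qed
  qed auto
  moreover have "partial (Suc j) (C(j := ?M)) (\<lambda>_. 0) = partial (Suc j) (C(j := ?M)) y"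
    by (rule partial_full, unfold sumj) (use j sum in auto)
  ultimately have top: "coeff (tail_poly j C y) ?M \<noteq> 0"
    by (simp add: coeff_tail_poly)
  have above: "coeff (tail_poly j C y) k = 0" if "?M < k" for k
  proof -
    have "partial (Suc j) (C(j := k)) y = 0"
      by (rule partial_eq_0, unfold sumj) (use that j in auto)
    then show ?thesis
      by (simp add: coeff_tail_poly)
  qed
  show deg: "degree (tail_poly j C y) = ?M"
    by (rule antisym[OF degree_le le_degree[OF top]]) (use above in auto)
  show "tail_poly j C y \<noteq> 0"
    using top by auto
qed

end

lemma ex_rotation_into_half_plane:
  fixes s :: real and y :: "'i \<Rightarrow> complex"
  assumes "finite L" "s \<noteq> 0" "\<And>l. l \<in> L \<Longrightarrow> Re (y l) > 0"
  shows "\<exists>u. u \<noteq> 0 \<and> Re (u * (\<i> * of_real s)) > 0 \<and> (\<forall>l\<in>L. Re (u * y l) > 0)"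
proof -
  have "\<forall>\<^sub>F \<delta> in at_right 0. \<forall>l\<in>L. Re (y l) + \<delta> * (s * Im (y l)) > 0"
  proof (rule eventually_ball_finite[OF assms(1)], rule ballI)
    fix l assume l: "l \<in> L"
    have "((\<lambda>\<delta>. Re (y l) + \<delta> * (s * Im (y l))) \<longlongrightarrow> Re (y l) + 0 * (s * Im (y l))) (at_right 0)"
      by (intro tendsto_intros)
    then show "\<forall>\<^sub>F \<delta> in at_right 0. Re (y l) + \<delta> * (s * Im (y l)) > 0"
      using assms(3)[OF l] by (intro order_tendstoD(1)) auto
  qed
  then have "\<forall>\<^sub>F \<delta> in at_right 0. 0 < \<delta> \<and> (\<forall>l\<in>L. Re (y l) + \<delta> * (s * Im (y l)) > 0)"
    using eventually_at_right_less by eventually_elim auto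
  then obtain \<delta> where \<delta>: "0 < \<delta>" "\<forall>l\<in>L. Re (y l) + \<delta> * (s * Im (y l)) > 0"
    using eventually_happens'[OF trivial_limit_at_right_real] by blast
  show ?thesis
  \<comment> \<open>Multiplication by 1 - i \<delta> s adds \<delta> s^2 to the real part of i s.
    The finitely many points already in the open half-plane stay there when \<delta> is
    small.\<close>
  proof (intro exI[of _ "1 - \<i> * of_real (\<delta> * s)"] conjI ballI)
    show "1 - \<i> * complex_of_real (\<delta> * s) \<noteq> 0"
      by (simp add: complex_eq_iff)
    show "Re ((1 - \<i> * complex_of_real (\<delta> * s)) * (\<i> * complex_of_real s)) > 0"
    proof -
      have eq: "Re ((1 - \<i> * complex_of_real (\<delta> * s)) * (\<i> * complex_of_real s)) = \<delta> * s\<^sup>2"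
        by (simp add: power2_eq_square)
      show ?thesis
        unfolding eq using \<delta>(1) assms(2) by simp
    qed
    show "Re ((1 - \<i> * complex_of_real (\<delta> * s)) * y l) > 0" if "l \<in> L" for l
      using \<delta>(2) that by (auto simp: algebra_simps)
  qed
qed

context stable_coeffs
begin

text \<open>Fixing the exponent of variable \<open>j\<close> means taking a coefficient of
  \<open>tail_poly\<close>, which is nonzero once all roots lie in the open left half-plane. A root
  that is 0 or has positive real part contradicts \<open>semistable j C\<close> directly; a nonzero
  imaginary root does so after a small rotation.\<close>

lemma semistable_Suc:
  assumes st: "semistable j C" and j: "Suc j < n" and sum: "(\<Sum>l<Suc j. C l) \<le> N"
  shows "semistable (Suc j) C"
  unfolding semistable_def
proof (intro allI impI)
  fix y :: "nat \<Rightarrow> complex"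
  assume y: "\<forall>l\<in>{Suc j..<n}. y l = 0 \<or> 0 < Re (y l)" and ex: "\<exists>l\<in>{Suc j..<n}. y l \<noteq> 0"
  have jn: "j < n" "(\<Sum>l<j. C l) \<le> N"
    using j sum by auto
  let ?p = "tail_poly j C y"
  have "Re w < 0" if "poly ?p w = 0" for w
  proof (rule ccontr)
    assume "\<not> Re w < 0"
    then consider "w = 0 \<or> Re w > 0" | "w \<noteq> 0" "Re w = 0"
      by fastforce
    then have "partial j C (y(j := w)) \<noteq> 0"
    proof cases
      case 1
      show ?thesis
        by (rule st[unfolded semistable_def, rule_format])
          (use 1 y ex in \<open>force+\<close>)
    next
      case 2
      define L where "L = {l\<in>{Suc j..<n}. y l \<noteq> 0}"
      have w: "w = \<i> * of_real (Im w)" "Im w \<noteq> 0"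
        using 2 by (auto simp: complex_eq_iff)
      have L: "finite L" "\<And>l. l \<in> L \<Longrightarrow> 0 < Re (y l)"
        using y by (auto simp: L_def)
      have "\<exists>u. u \<noteq> 0 \<and> Re (u * (\<i> * of_real (Im w))) > 0 \<and> (\<forall>l\<in>L. Re (u * y l) > 0)"
        by (rule ex_rotation_into_half_plane[OF L(1) w(2)]) (rule L(2))
      then obtain u where u: "u \<noteq> 0" "Re (u * (\<i> * of_real (Im w))) > 0" "\<forall>l\<in>L. Re (u * y l) > 0"
        by blast
      show ?thesis
      proof (rule semistable_rotate[OF st less_imp_le[OF jn(1)] _ _ u(1)])
        show "(y(j := w)) l = 0 \<or> 0 < Re (u * (y(j := w)) l)" if "l \<in> {j..<n}" for l
          using u(2)[folded w(1)] bspec[OF u(3), of l] that by (cases "l = j") (auto simp: L_def)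
        show "\<exists>l\<in>{j..<n}. (y(j := w)) l \<noteq> 0"
          using 2 jn by (intro bexI[of _ j]) auto
      qed
    qed
    with that show False
      by (simp add: poly_tail_poly[OF jn(1)])
  qed
  then have "coeff ?p (C j) \<noteq> 0"
    using tail_poly_degree[OF st jn] sum by (intro coeff_nonzero_of_left_half_plane) auto
  moreover have "C j \<le> N"
    using sum by auto
  ultimately show "partial (Suc j) C y \<noteq> 0"
    by (simp add: coeff_tail_poly)
qed

lemma semistable:
  assumes "j < n" "(\<Sum>l<j. C l) \<le> N"
  shows "semistable j C"
  using assms
proof (induction j)
  case 0
  show ?case
    unfolding semistable_def partial_0
  proof (intro allI impI)
    fix y :: "nat \<Rightarrow> complex"
    assume "\<forall>l\<in>{0..<n}. y l = 0 \<or> 0 < Re (y l)" "\<exists>l\<in>{0..<n}. y l \<noteq> 0"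
    then show "(\<Sum>c\<in>compositions n N. complex_of_real (S c) * (\<Prod>l<n. y l ^ c l)) \<noteq> 0"
      by (intro nonvanishing) auto
  qed
next
  case (Suc j)
  then show ?case
    by (intro semistable_Suc) auto
qed

section \<open>Positivity and capacity of coefficients, one variable at a time\<close>

lemma partial_nonneg:
  assumes "\<And>l. 0 \<le> y l"
  shows "0 \<le> (partial j C y :: real)"
  unfolding partial_def using assms coeff_nonneg by (auto intro!: sum_nonneg mult_nonneg_nonneg prod_nonneg)

lemma partial_pos:
  assumes "j < n" "(\<Sum>l<j. C l) \<le> N" "\<And>l. 0 < y l"
  shows "0 < (partial j C y :: real)"
proof -
  have "partial j C (\<lambda>l. complex_of_real (y l)) \<noteq> 0"
    by (rule semistable[OF assms(1,2), unfolded semistable_def, rule_format])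
      (use assms in \<open>auto simp: less_imp_neq[symmetric]\<close>)
  then have "partial j C y \<noteq> 0"
    unfolding partial_of_real by simp
  then show ?thesis
    using partial_nonneg[of y j C] assms(3) by (simp add: less_le)
qed

lemma pf2_partial:
  assumes j: "Suc j < n" and sum: "(\<Sum>l<j. C l) \<le> N" and y: "\<And>l. 0 < y l"
  shows "pf2 (\<lambda>k. if k \<le> N then partial (Suc j) (C(j := k)) y else 0)"
proof -
  have jn: "j < n" using j by simp
  note st = semistable[OF jn sum]
  let ?p = "tail_poly j C y" and ?M = "N - (\<Sum>l<j. C l)"
  let ?yc = "\<lambda>l. complex_of_real (y l)"
  have map: "map_poly complex_of_real ?p = tail_poly j C ?yc"
    by (rule poly_eqI) (simp add: coeff_map_poly coeff_tail_poly partial_of_real)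
  have "degree ?p = degree (map_poly complex_of_real ?p)"
    by (rule degree_map_poly[symmetric]) simp
  then have deg: "degree ?p = ?M"
    unfolding map using tail_poly_degree(1)[OF st jn sum] by simp
  have sumj: "(\<Sum>l<Suc j. (C(j := ?M)) l) = N"
  proof -
    have "(\<Sum>l<j. (C(j := ?M)) l) = (\<Sum>l<j. C l)"
      by (intro sum.cong) auto
    then show ?thesis using sum by simp
  qed
  have "pf2 (coeff ?p)"
  proof (rule pf2_coeff_real_rooted)
    show "lead_coeff ?p > 0"
      unfolding deg using partial_pos[OF j, of "C(j := ?M)" y] y sumj by (simp add: coeff_tail_poly)
    fix w assume "poly (map_poly complex_of_real ?p) w = 0"
    then have root: "partial j C (?yc(j := w)) = 0"
      unfolding map poly_tail_poly[OF jn] .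
    show "w \<in> \<real> \<and> Re w \<le> 0"
    proof (rule ccontr)
      assume "\<not> (w \<in> \<real> \<and> Re w \<le> 0)"
      then have nr: "w \<notin> \<real>\<^sub>\<le>\<^sub>0"
        by (auto simp: complex_nonpos_Reals_iff complex_is_Real_iff)
      \<comment> \<open>Multiplying by the conjugate of the principal square root turns
        \<open>w\<close> into |r|^2 r and a positive y into y times the conjugate of r. Both have
        positive real part because Re r > 0, so a root off the nonpositive real axis contradicts
        stability.\<close>
      define r where "r = csqrt w"
      have r2: "r\<^sup>2 = w"
        by (simp add: r_def)
      have "Re r \<noteq> 0"
      proof
        assume "Re r = 0"
        then have "w = complex_of_real (- ((Im r)\<^sup>2))"
          unfolding r2[symmetric] by (simp add: complex_eq_iff power2_eq_square)
        then show False
          using nr by (simp add: complex_nonpos_Reals_iff)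
      qed
      then have r: "r\<^sup>2 = w" "Re r > 0"
        using r2 csqrt_principal[of w] by (auto simp: r_def)
      have "partial j C (?yc(j := w)) \<noteq> 0"
      proof (rule semistable_rotate[OF st less_imp_le[OF jn]])
        show "cnj r \<noteq> 0"
          using r(2) by auto
        have "cnj r * w = of_real ((norm r)\<^sup>2) * r"
          unfolding r(1)[symmetric] complex_norm_square by (simp add: power2_eq_square mult_ac)
        then have eq: "Re (cnj r * w) = (norm r)\<^sup>2 * Re r"
          by simp
        have "r \<noteq> 0"
          using r(2) by auto
        then have "Re (cnj r * w) > 0"
          unfolding eq using r(2) by simp
        then show "(?yc(j := w)) l = 0 \<or> 0 < Re (cnj r * (?yc(j := w)) l)" for l
          using r(2) y[of l] by (cases "l = j") auto
        show "\<exists>l\<in>{j..<n}. (?yc(j := w)) l \<noteq> 0"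
          using j y[of "Suc j"] by (intro bexI[of _ "Suc j"]) auto
      qed
      with root show False by contradiction
    qed
  qed
  then show ?thesis
    by (simp add: coeff_tail_poly[abs_def])
qed

text \<open>As a polynomial in variable \<open>j\<close> the value has N + 1 coefficients forming a
  \<open>pf2\<close> sequence. At the \<open>t\<close> of \<open>pf2_ratio_bound\<close> none of its
  terms exceeds the one of degree \<open>C j\<close>, which gives the factor N + 1.\<close>

lemma partial_capacity_step:
  assumes j: "Suc j < n" and sum: "(\<Sum>l<Suc j. C l) \<le> N" and Cj: "0 < C j" and y: "\<And>l. 0 < y l"
  obtains t where "0 < t" "partial j C (y(j := t)) \<le> real (N + 1) * t ^ C j * partial (Suc j) C y"
proof -
  obtain c where c: "C j = Suc c"
    using Cj by (cases "C j") auto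
  define f where "f k = (if k \<le> N then partial (Suc j) (C(j := k)) y else 0)" for k
  have sumj: "(\<Sum>l<Suc j. (C(j := k)) l) = (\<Sum>l<j. C l) + k" for k
  proof -
    have "(\<Sum>l<j. (C(j := k)) l) = (\<Sum>l<j. C l)"
      by (intro sum.cong) auto
    then show ?thesis by simp
  qed
  have fpos: "f k > 0" if "k \<le> C j" for k
  proof -
    have "(\<Sum>l<Suc j. (C(j := k)) l) \<le> N"
      unfolding sumj using that sum by simp
    then show ?thesis
      using partial_pos[OF j, of "C(j := k)" y] y that sum by (simp add: f_def)
  qed
  have pf: "pf2 f"
    unfolding f_def using pf2_partial[OF j _ y, of C] sum by simp
  define t where "t = f c / f (Suc c)"
  have t: "t > 0"
    using fpos[of c] fpos[of "Suc c"] c by (simp add: t_def)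
  have le: "f k * t ^ k \<le> f (C j) * t ^ C j" for k
    using pf2_ratio_bound[OF pf, of c k] fpos[of c] fpos[of "Suc c"] c by (simp add: t_def)
  have "partial j C (y(j := t)) = (\<Sum>k\<le>N. f k * t ^ k)"
    using partial_expand[of j C y t] j by (simp add: f_def)
  also have "\<dots> \<le> (\<Sum>k\<le>N. f (C j) * t ^ C j)"
    by (intro sum_mono le)
  also have "\<dots> = real (N + 1) * t ^ C j * partial (Suc j) C y"
    using sum by (simp add: f_def)
  finally show ?thesis
    using t that by blast
qed

text \<open>The point \<open>t\<close> for variable \<open>j\<close> depends on the values of the
  later variables. The induction therefore runs over all \<open>z\<close>, and \<open>y\<close> is
  required to agree with \<open>z\<close> from index \<open>j\<close> on.\<close>

lemma partial_capacity:
  assumes "j < n" and "(\<Sum>l<j. C l) \<le> N" and "\<And>l. l < j \<Longrightarrow> 0 < C l" and "\<And>l. 0 < z l"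
  shows "\<exists>y. (\<forall>l. 0 < y l) \<and> (\<forall>l\<ge>j. y l = z l) \<and>
    partial 0 C y \<le> real (N + 1) ^ j * (\<Prod>l<j. y l ^ C l) * partial j C z"
  using assms
proof (induction j arbitrary: z)
  case 0
  then show ?case
    by (intro exI[of _ z]) auto
next
  case (Suc j)
  obtain t where t: "0 < t" "partial j C (z(j := t)) \<le> real (N + 1) * t ^ C j * partial (Suc j) C z"
    using partial_capacity_step[of j C z] Suc.prems by auto
  have "\<exists>y. (\<forall>l. 0 < y l) \<and> (\<forall>l\<ge>j. y l = (z(j := t)) l) \<and>
      partial 0 C y \<le> real (N + 1) ^ j * (\<Prod>l<j. y l ^ C l) * partial j C (z(j := t))"
    by (rule Suc.IH) (use Suc.prems t in auto)
  then obtain y where y: "\<forall>l. 0 < y l" "\<forall>l\<ge>j. y l = (z(j := t)) l"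
      "partial 0 C y \<le> real (N + 1) ^ j * (\<Prod>l<j. y l ^ C l) * partial j C (z(j := t))"
    by blast
  have "partial 0 C y \<le> real (N + 1) ^ j * (\<Prod>l<j. y l ^ C l) * (real (N + 1) * t ^ C j * partial (Suc j) C z)"
    using y(1) by (intro order_trans[OF y(3)] mult_left_mono[OF t(2)] mult_nonneg_nonneg prod_nonneg)
      (auto intro: less_imp_le)
  also have "\<dots> = real (N + 1) ^ Suc j * (\<Prod>l<Suc j. y l ^ C l) * partial (Suc j) C z"
    using y(2) by (simp add: mult_ac)
  finally show ?case
    using y by (intro exI[of _ y]) auto
qed

text \<open>By homogeneity the first n - 1 exponents determine the last one, so the last variable
  can be set to 1 at no cost.\<close>

lemma partial_last:
  assumes j: "n = Suc j" and C: "C \<in> compositions n N"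
  shows "partial j C (\<lambda>_. 1) = S C"
proof -
  have sum: "(\<Sum>l<j. C l) + C j = N"
    using C by (simp add: compositions_def j)
  have "partial j C (\<lambda>_. 1 :: real) = (\<Sum>c\<in>{C}. S c)"
    unfolding partial_def
  proof (rule sum.cong)
    show "{c. c \<in> compositions n N \<and> (\<forall>l<j. c l = C l)} = {C}"
    proof (intro equalityI subsetI)
      fix c assume c: "c \<in> {c. c \<in> compositions n N \<and> (\<forall>l<j. c l = C l)}"
      then have "(\<Sum>l<j. c l) = (\<Sum>l<j. C l)"
        by (intro sum.cong) auto
      moreover have "c \<in> compositions n N"
        using c by blast
      then have "(\<Sum>l<j. c l) + c j = N"
        by (simp add: compositions_def j)
      ultimately have cj: "c j = C j"
        using sum by simp
      have "c l = C l" for l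
      proof -
        consider "l < j" | "l = j" | "n \<le> l"
          using j by linarith
        then show ?thesis
          using c C cj by cases (auto simp: compositions_def)
      qed
      then show "c \<in> {C}" by auto
    qed (use C in auto)
  qed simp
  then show ?thesis by simp
qed

theorem coeff_pos:
  assumes n: "0 < n" and C: "C \<in> compositions n N"
  shows "0 < S C"
proof -
  obtain j where j: "n = Suc j"
    using n by (cases n) auto
  have "(\<Sum>l<j. C l) \<le> N"
    using C by (simp add: compositions_def j)
  then have "0 < partial j C (\<lambda>_. 1 :: real)"
    using j by (intro partial_pos) auto
  then show ?thesis
    by (simp add: partial_last[OF j C])
qed

theorem coeff_capacity:
  assumes n: "0 < n" and C: "C \<in> compositions n N" "\<And>l. l < n \<Longrightarrow> 0 < C l"
  obtains y where "\<And>l. 0 < y l"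
    "(\<Sum>c\<in>compositions n N. S c * (\<Prod>l<n. y l ^ c l)) \<le> real (N + 1) ^ n * S C * (\<Prod>l<n. y l ^ C l)"
proof -
  obtain j where j: "n = Suc j"
    using n by (cases n) auto
  have sum: "(\<Sum>l<j. C l) + C j = N"
    using C(1) by (simp add: compositions_def j)
  obtain y where y: "\<forall>l. 0 < y l" "\<forall>l\<ge>j. y l = (1::real)"
      "partial 0 C y \<le> real (N + 1) ^ j * (\<Prod>l<j. y l ^ C l) * partial j C (\<lambda>_. 1)"
    using partial_capacity[of j C "\<lambda>_. 1"] sum C(2) j by auto
  then have "partial 0 C y \<le> real (N + 1) ^ j * (\<Prod>l<n. y l ^ C l) * S C"
    using y(2,3) partial_last[OF j C(1)] by (simp add: j)
  \<comment> \<open>Only n - 1 variables were eliminated; the power is rounded up to n.\<close>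
  also have "\<dots> \<le> real (N + 1) ^ n * (\<Prod>l<n. y l ^ C l) * S C"
  proof (intro mult_right_mono power_increasing)
    show "0 \<le> (\<Prod>l<n. y l ^ C l)"
      using y(1) by (intro prod_nonneg) (auto intro: less_imp_le)
  qed (use j coeff_nonneg[OF C(1)] in auto)
  finally show ?thesis
    using y(1) that[of y] by (simp add: partial_0 mult_ac)
qed

end

section \<open>The Prekopa-Leindler inequality\<close>

lemma weighted_am_gm:
  fixes p g :: "'k \<Rightarrow> real"
  assumes "finite K" "K \<noteq> {}" "\<And>k. k \<in> K \<Longrightarrow> 0 \<le> p k" "sum p K = 1" "\<And>k. k \<in> K \<Longrightarrow> 0 \<le> g k"
  shows "(\<Prod>k\<in>K. g k powr p k) \<le> (\<Sum>k\<in>K. p k * g k)"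
\<comment> \<open>Convexity of \<open>exp\<close> is applied to logarithms, which requires positive
  values. A zero value makes the left side 0, even with weight 0, since
  \<open>0 powr 0 = 0\<close>.\<close>
proof (cases "\<exists>k\<in>K. g k = 0")
  case True
  then have "(\<Prod>k\<in>K. g k powr p k) = 0"
    using assms(1) by (auto intro!: prod_zero)
  moreover have "0 \<le> (\<Sum>k\<in>K. p k * g k)"
    using assms by (intro sum_nonneg) auto
  ultimately show ?thesis
    by simp
next
  case False
  then have pos: "g k > 0" if "k \<in> K" for k
    using assms(5) that by (metis less_eq_real_def)
  have "(\<Prod>k\<in>K. g k powr p k) = exp (\<Sum>k\<in>K. p k *\<^sub>R ln (g k))"
    unfolding exp_sum[OF assms(1)] by (intro prod.cong refl) (use pos in \<open>force simp: powr_def\<close>)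
  also have "\<dots> \<le> (\<Sum>k\<in>K. p k * exp (ln (g k)))"
    using assms by (intro convex_on_sum[OF _ _ exp_convex]) auto
  also have "\<dots> = (\<Sum>k\<in>K. p k * g k)"
    using pos by (intro sum.cong) auto
  finally show ?thesis .
qed

section \<open>The one-dimensional Brunn-Minkowski inequality\<close>

lemma emeasure_lborel_affine_image:
  fixes c t :: real
  assumes c: "c > 0" and B: "compact B"
  shows "emeasure lborel ((\<lambda>x. t + c * x) ` B) = ennreal c * emeasure lborel B"
proof -
  let ?S = "(\<lambda>x. t + c * x) ` B"
  have S: "compact ?S"
    by (intro compact_continuous_image continuous_intros B)
  have vim: "(\<lambda>x. t + c * x) -` ?S = B"
    using c by auto
  have "emeasure lborel ?S = emeasure (density (distr lborel borel (\<lambda>x. t + c * x)) (\<lambda>_. ennreal \<bar>c\<bar>)) ?S"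
    using lborel_real_affine[of c t] c by simp
  also have "\<dots> = ennreal c * emeasure lborel B"
    using c S B
    by (subst emeasure_density_const) (auto simp: emeasure_distr vim borel_compact)
  finally show ?thesis .
qed

text \<open>The translates of A by min B and of B by max A both lie in the sumset, and they meet
  only in the point max A + min B, a null set.\<close>

lemma emeasure_compact_sums:
  fixes A B :: "real set"
  assumes A: "compact A" "A \<noteq> {}" and B: "compact B" "B \<noteq> {}"
  shows "emeasure lborel A + emeasure lborel B \<le> emeasure lborel {a + b |a b. a \<in> A \<and> b \<in> B}"
proof -
  obtain a0 where a0: "a0 \<in> A" "\<And>a. a \<in> A \<Longrightarrow> a \<le> a0"
    using compact_attains_sup[OF A] by blast
  obtain b0 where b0: "b0 \<in> B" "\<And>b. b \<in> B \<Longrightarrow> b0 \<le> b"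
    using compact_attains_inf[OF B] by blast
  let ?X = "(\<lambda>x. b0 + 1 * x) ` A" and ?Y = "(\<lambda>x. a0 + 1 * x) ` B"
  let ?S = "{a + b |a b. a \<in> A \<and> b \<in> B}"
  have cX: "compact ?X" and cY: "compact ?Y"
    by (intro compact_continuous_image continuous_intros A B)+
  have cS: "compact ?S"
    by (rule compact_sums[OF A(1) B(1)])
  have eX: "emeasure lborel ?X = emeasure lborel A" and eY: "emeasure lborel ?Y = emeasure lborel B"
    using emeasure_lborel_affine_image[OF zero_less_one A(1), of b0]
      emeasure_lborel_affine_image[OF zero_less_one B(1), of a0] by simp_all
  have "emeasure lborel A + emeasure lborel B = emeasure lborel ?X + emeasure lborel (?Y - {a0 + b0})"
  proof -
    have "emeasure lborel (?Y - {a0 + b0}) = emeasure lborel ?Y"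
      using cY by (intro emeasure_Diff_null_set) (auto simp: borel_compact null_sets_def)
    then show ?thesis
      by (simp only: eX eY)
  qed
  also have "\<dots> = emeasure lborel (?X \<union> (?Y - {a0 + b0}))"
  proof (rule plus_emeasure)
    show "?X \<inter> (?Y - {a0 + b0}) = {}"
    proof -
      have False if "a \<in> A" "b \<in> B" "b0 + 1 * a = a0 + 1 * b" "a0 + 1 * b \<noteq> a0 + b0" for a b
        using a0(2)[OF that(1)] b0(2)[OF that(2)] that(3,4) by simp
      then show ?thesis by (auto simp: disjoint_iff image_iff)
    qed
  qed (use cX cY in \<open>auto simp: borel_compact\<close>)
  also have "\<dots> \<le> emeasure lborel ?S"
  proof (rule emeasure_mono)
    have "b0 + 1 * a \<in> ?S" if "a \<in> A" for a
      using that b0(1) by (auto simp: add.commute)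
    moreover have "a0 + 1 * b \<in> ?S" if "b \<in> B" for b
      using that a0(1) by auto
    ultimately show "?X \<union> (?Y - {a0 + b0}) \<subseteq> ?S"
      by blast
  qed (use cS in \<open>simp add: borel_compact\<close>)
  finally show ?thesis .
qed

text \<open>The sets are added one at a time. Compactness keeps the sumset measurable and provides
  the extreme points used in \<open>emeasure_compact_sums\<close>.\<close>

lemma brunn_minkowski_real_compact:
  fixes B :: "'k \<Rightarrow> real set"
  assumes "finite K" "K \<noteq> {}" "\<And>k. k \<in> K \<Longrightarrow> p k > 0"
    and "\<And>k. k \<in> K \<Longrightarrow> compact (B k)" "\<And>k. k \<in> K \<Longrightarrow> B k \<noteq> {}"
  shows "\<exists>S. compact S \<and> S \<noteq> {} \<and> (\<forall>s\<in>S. \<exists>a. (\<forall>k\<in>K. a k \<in> B k) \<and> s = (\<Sum>k\<in>K. p k * a k)) \<and>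
    (\<Sum>k\<in>K. ennreal (p k) * emeasure lborel (B k)) \<le> emeasure lborel S"
  using assms
proof (induction K rule: finite_ne_induct)
  case (singleton k)
  have c: "compact (B k)" and p: "p k > 0"
    using singleton by auto
  have "compact ((\<lambda>x. 0 + p k * x) ` B k)"
    by (intro compact_continuous_image continuous_intros c)
  moreover have "\<exists>a. (\<forall>k'\<in>{k}. a k' \<in> B k') \<and> s = (\<Sum>k'\<in>{k}. p k' * a k')"
    if "s \<in> (\<lambda>x. 0 + p k * x) ` B k" for s
    using that by (auto intro: exI[of _ "\<lambda>_. x" for x])
  ultimately show ?case
    using singleton emeasure_lborel_affine_image[OF p c, of 0]
    by (intro exI[of _ "(\<lambda>x. 0 + p k * x) ` B k"]) (simp)
next
  case (insert k K)
  have "\<exists>S. compact S \<and> S \<noteq> {} \<and> (\<forall>s\<in>S. \<exists>a. (\<forall>k\<in>K. a k \<in> B k) \<and> s = (\<Sum>k\<in>K. p k * a k)) \<and>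
      (\<Sum>k\<in>K. ennreal (p k) * emeasure lborel (B k)) \<le> emeasure lborel S"
    by (rule insert.IH) (use insert.prems in auto)
  then obtain S where S: "compact S" "S \<noteq> {}"
      "\<forall>s\<in>S. \<exists>a. (\<forall>k\<in>K. a k \<in> B k) \<and> s = (\<Sum>k\<in>K. p k * a k)"
      "(\<Sum>k\<in>K. ennreal (p k) * emeasure lborel (B k)) \<le> emeasure lborel S"
    by blast
  have c: "compact (B k)" and p: "p k > 0" and ne: "B k \<noteq> {}"
    using insert.prems by auto
  let ?X = "(\<lambda>x. 0 + p k * x) ` B k"
  let ?S = "{x + s |x s. x \<in> ?X \<and> s \<in> S}"
  have cX: "compact ?X"
    by (intro compact_continuous_image continuous_intros c)
  have "\<exists>a. (\<forall>k\<in>insert k K. a k \<in> B k) \<and> s = (\<Sum>k\<in>insert k K. p k * a k)" if "s \<in> ?S" for s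
  proof -
    obtain b t where bt: "b \<in> B k" "t \<in> S" "s = p k * b + t"
      using \<open>s \<in> ?S\<close> by auto
    obtain a where a: "\<forall>k\<in>K. a k \<in> B k" "t = (\<Sum>k\<in>K. p k * a k)"
      using S(3) bt(2) by blast
    have "(\<Sum>l\<in>K. p l * (a(k := b)) l) = (\<Sum>l\<in>K. p l * a l)"
      using insert.hyps by (intro sum.cong) auto
    then show ?thesis
      using a bt insert.hyps by (intro exI[of _ "a(k := b)"]) auto
  qed
  moreover have "compact ?S"
    by (rule compact_sums[OF cX S(1)])
  moreover have "?S \<noteq> {}"
    using ne S(2) by blast
  moreover have "(\<Sum>k\<in>insert k K. ennreal (p k) * emeasure lborel (B k)) \<le> emeasure lborel ?S"
  proof -
    have "(\<Sum>k\<in>insert k K. ennreal (p k) * emeasure lborel (B k)) \<le> emeasure lborel ?X + emeasure lborel S"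
      unfolding emeasure_lborel_affine_image[OF p c]
      using insert.hyps S(4) by (simp add: add_left_mono)
    also have "\<dots> \<le> emeasure lborel ?S"
      using ne by (intro emeasure_compact_sums[OF cX _ S(1,2)]) auto
    finally show ?thesis .
  qed
  ultimately show ?case
    by (intro exI[of _ ?S] conjI ballI)
qed

text \<open>Inner regularity is applied to Lebesgue measure restricted to A, which is
  finite.\<close>

lemma lborel_inner_compact:
  fixes A :: "real set"
  assumes A: "A \<in> sets borel" "emeasure lborel A < \<infinity>" "A \<noteq> {}" and e: "e > 0"
  obtains K where "compact K" "K \<subseteq> A" "K \<noteq> {}" "emeasure lborel A \<le> emeasure lborel K + ennreal e"
proof -
  define N where "N = density lborel (indicator A)"
  have N: "emeasure N B = emeasure lborel (A \<inter> B)" if "B \<in> sets borel" for B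
  proof -
    have "emeasure N B = (\<integral>\<^sup>+x. indicator A x * indicator B x \<partial>lborel)"
      unfolding N_def using A that by (intro emeasure_density) auto
    also have "\<dots> = (\<integral>\<^sup>+x. indicator (A \<inter> B) x \<partial>lborel)"
      by (intro nn_integral_cong) (auto split: split_indicator)
    also have "\<dots> = emeasure lborel (A \<inter> B)"
      using A that by (intro nn_integral_indicator) auto
    finally show ?thesis .
  qed
  have sup: "emeasure N A = (SUP K \<in> {K. K \<subseteq> A \<and> compact K}. emeasure N K)"
    using A N[of UNIV] by (intro inner_regular) (auto simp: N_def)
  have fin: "emeasure N A \<noteq> \<infinity>"
    using N A by simp
  have "\<exists>K\<in>{K. K \<subseteq> A \<and> compact K}. emeasure N A < emeasure N K + ennreal e"
    by (rule SUP_approx_ennreal[OF e _ sup fin]) (auto intro: exI[of _ "{}"])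
  then obtain K where K: "K \<subseteq> A" "compact K" "emeasure N A < emeasure N K + ennreal e"
    by auto
  then have le: "emeasure lborel A \<le> emeasure lborel K + ennreal e"
    using A by (simp add: N borel_compact Int_absorb1 less_imp_le)
  show ?thesis
  \<comment> \<open>Brunn-Minkowski fails for empty sets. If the approximating set is empty, then A
    has measure at most e and any of its points will do.\<close>
  proof (cases "K = {}")
    case True
    obtain a where "a \<in> A" using A by auto
    then show ?thesis
      using that[of "{a}"] le True by simp
  next
    case False
    then show ?thesis
      using that[of K] K le by simp
  qed
qed

text \<open>The Minkowski combination of Borel sets may fail to be Borel, so the bound is stated for
  a Borel set \<open>H\<close> containing it and proved by compact approximation from
  inside.\<close>

lemma brunn_minkowski_real:
  fixes A :: "'k \<Rightarrow> real set"
  assumes K: "finite K" "K \<noteq> {}" and p: "\<And>k. k \<in> K \<Longrightarrow> p k > 0" "sum p K = 1"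
    and A: "\<And>k. k \<in> K \<Longrightarrow> A k \<in> sets borel" "\<And>k. k \<in> K \<Longrightarrow> emeasure lborel (A k) < \<infinity>"
      "\<And>k. k \<in> K \<Longrightarrow> A k \<noteq> {}"
    and H: "H \<in> sets borel" "\<And>a. (\<And>k. k \<in> K \<Longrightarrow> a k \<in> A k) \<Longrightarrow> (\<Sum>k\<in>K. p k * a k) \<in> H"
  shows "(\<Sum>k\<in>K. ennreal (p k) * emeasure lborel (A k)) \<le> emeasure lborel H"
proof (rule ennreal_le_epsilon)
  fix e :: real assume e: "e > 0"
  have "\<exists>B. compact B \<and> B \<subseteq> A k \<and> B \<noteq> {} \<and> emeasure lborel (A k) \<le> emeasure lborel B + ennreal e"
    if "k \<in> K" for k
    using lborel_inner_compact[OF A(1,2,3)[OF that] e] by metis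
  then obtain B where B: "\<And>k. k \<in> K \<Longrightarrow> compact (B k) \<and> B k \<subseteq> A k \<and> B k \<noteq> {} \<and>
      emeasure lborel (A k) \<le> emeasure lborel (B k) + ennreal e"
    by metis
  obtain S where S: "compact S" "\<forall>s\<in>S. \<exists>a. (\<forall>k\<in>K. a k \<in> B k) \<and> s = (\<Sum>k\<in>K. p k * a k)"
    "(\<Sum>k\<in>K. ennreal (p k) * emeasure lborel (B k)) \<le> emeasure lborel S"
    using brunn_minkowski_real_compact[of K p B] K p B by auto
  have "(\<Sum>k\<in>K. ennreal (p k) * emeasure lborel (A k))
      \<le> (\<Sum>k\<in>K. ennreal (p k) * (emeasure lborel (B k) + ennreal e))"
    using B by (intro sum_mono mult_left_mono) auto
  also have "\<dots> = (\<Sum>k\<in>K. ennreal (p k) * emeasure lborel (B k)) + (\<Sum>k\<in>K. ennreal (p k)) * ennreal e"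
    by (simp add: distrib_left sum.distrib sum_distrib_right)
  also have "(\<Sum>k\<in>K. ennreal (p k)) = 1"
    using p by (subst sum_ennreal) (auto intro: less_imp_le)
  also have "(\<Sum>k\<in>K. ennreal (p k) * emeasure lborel (B k)) \<le> emeasure lborel S"
    by (rule S)
  also have "emeasure lborel S \<le> emeasure lborel H"
  proof (rule emeasure_mono)
    show "S \<subseteq> H"
    proof
      fix s assume "s \<in> S"
      then obtain a where "\<forall>k\<in>K. a k \<in> B k" "s = (\<Sum>k\<in>K. p k * a k)"
        using S(2) by blast
      then show "s \<in> H"
        using B H(2)[of a] by blast
    qed
  qed (use H in auto)
  finally show "(\<Sum>k\<in>K. ennreal (p k) * emeasure lborel (A k)) \<le> emeasure lborel H + ennreal e"
    by (simp add: add_right_mono)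
qed

section \<open>Prekopa-Leindler on the line and on finite products\<close>

lemma nn_integral_layer_cake:
  fixes f :: "real \<Rightarrow> real"
  assumes [measurable]: "f \<in> borel_measurable borel"
  shows "(\<integral>\<^sup>+x. ennreal (f x) \<partial>lborel) = (\<integral>\<^sup>+t. indicator {0..} t * emeasure lborel {x. t < f x} \<partial>lborel)"
proof -
  have "(\<integral>\<^sup>+x. ennreal (f x) \<partial>lborel) = (\<integral>\<^sup>+x. (\<integral>\<^sup>+t. indicator {0..} t * indicator {..<f x} t \<partial>lborel) \<partial>lborel)"
  proof (rule nn_integral_cong)
    fix x
    have "(\<integral>\<^sup>+t. indicator {0..} t * indicator {..<f x} t \<partial>lborel) = (\<integral>\<^sup>+t. indicator {0..<f x} t \<partial>lborel)"
      by (intro nn_integral_cong) (auto split: split_indicator)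
    also have "\<dots> = ennreal (f x)"
      by (cases "0 \<le> f x") (auto simp: ennreal_neg)
    finally show "ennreal (f x) = (\<integral>\<^sup>+t. indicator {0..} t * indicator {..<f x} t \<partial>lborel)" ..
  qed
  also have "\<dots> = (\<integral>\<^sup>+t. (\<integral>\<^sup>+x. indicator {0..} t * indicator {..<f x} t \<partial>lborel) \<partial>lborel)"
  proof (rule lborel_pair.Fubini'[symmetric])
    have "(\<lambda>(x, t). indicator {0..} t * indicator {..<f x} t :: ennreal) =
        (\<lambda>z. indicator {0..} (snd z) * indicator {z. snd z < f (fst z)} z)"
      by (auto simp: fun_eq_iff split: split_indicator)
    also have "\<dots> \<in> borel_measurable (lborel \<Otimes>\<^sub>M lborel)"
      by measurable
    finally show "(\<lambda>(x, t). indicator {0..} t * indicator {..<f x} t :: ennreal) \<in> borel_measurable (lborel \<Otimes>\<^sub>M lborel)" .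
  qed
  also have "\<dots> = (\<integral>\<^sup>+t. (\<integral>\<^sup>+x. indicator {0..} t * indicator {x. t < f x} x \<partial>lborel) \<partial>lborel)"
    by (intro nn_integral_cong) (auto split: split_indicator)
  also have "\<dots> = (\<integral>\<^sup>+t. indicator {0..} t * emeasure lborel {x. t < f x} \<partial>lborel)"
    by (intro nn_integral_cong) (simp add: nn_integral_cmult)
  finally show ?thesis .
qed

text \<open>Brunn-Minkowski is applied to the level sets at each height t and integrated over t. It
  requires them to be nonempty, and suprema equal to 1 make all of them nonempty for t < 1 and empty
  for t >= 1. The result bounds the weighted arithmetic mean of the integrals, not only the
  geometric one.\<close>

lemma prekopa_leindler_real_normalized:
  fixes g :: "'k \<Rightarrow> real \<Rightarrow> real" and h :: "real \<Rightarrow> real"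
  assumes K: "finite K" "K \<noteq> {}" and p: "\<And>k. k \<in> K \<Longrightarrow> p k > 0" "sum p K = 1"
    and g[measurable]: "\<And>k. k \<in> K \<Longrightarrow> g k \<in> borel_measurable borel"
    and g01: "\<And>k x. k \<in> K \<Longrightarrow> 0 \<le> g k x" "\<And>k x. k \<in> K \<Longrightarrow> g k x \<le> 1"
    and sup: "\<And>k t. k \<in> K \<Longrightarrow> t < 1 \<Longrightarrow> \<exists>x. t < g k x"
    and fin: "\<And>k. k \<in> K \<Longrightarrow> (\<integral>\<^sup>+x. ennreal (g k x) \<partial>lborel) < \<infinity>"
    and h[measurable]: "h \<in> borel_measurable borel"
    and dom: "\<And>x. (\<Prod>k\<in>K. g k (x k) powr p k) \<le> h (\<Sum>k\<in>K. p k * x k)"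
  shows "(\<Sum>k\<in>K. ennreal (p k) * (\<integral>\<^sup>+x. ennreal (g k x) \<partial>lborel)) \<le> (\<integral>\<^sup>+x. ennreal (h x) \<partial>lborel)"
proof -
  have meas: "{x. t < f x} \<in> sets borel" if "f \<in> borel_measurable borel" for f :: "real \<Rightarrow> real" and t
    using that by measurable
  have meas_e: "(\<lambda>t. indicator {0..} t * emeasure lborel {x. t < f x}) \<in> borel_measurable borel"
    if f[measurable]: "f \<in> borel_measurable borel" for f :: "real \<Rightarrow> real"
  proof -
    have "(\<lambda>t. \<integral>\<^sup>+x. indicator {z. fst z < f (snd z)} (t, x) \<partial>lborel) \<in> borel_measurable lborel"
      by measurable
    also have "(\<lambda>t. \<integral>\<^sup>+x. indicator {z. fst z < f (snd z)} (t, x) \<partial>lborel) = (\<lambda>t. emeasure lborel {x. t < f x})"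
    proof
      fix t
      have "(\<integral>\<^sup>+x. indicator {z. fst z < f (snd z)} (t, x) \<partial>lborel) = (\<integral>\<^sup>+x. indicator {x. t < f x} x \<partial>lborel)"
        by (intro nn_integral_cong) (auto split: split_indicator)
      then show "(\<integral>\<^sup>+x. indicator {z. fst z < f (snd z)} (t, x) \<partial>lborel) = emeasure lborel {x. t < f x}"
        using meas[OF f, of t] by simp
    qed
    finally show ?thesis
      by (intro borel_measurable_times_ennreal) auto
  qed
  have level: "(\<Sum>k\<in>K. ennreal (p k) * emeasure lborel {x. t < g k x}) \<le> emeasure lborel {x. t < h x}"
    if t: "0 < t" for t
  proof (cases "t < 1")
    case True
    show ?thesis
    proof (rule brunn_minkowski_real[OF K p])
      show "emeasure lborel {x. t < g k x} < \<infinity>" if k: "k \<in> K" for k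
      proof -
        \<comment> \<open>Markov's inequality bounds the level set by the finite integral divided by
          t.\<close>
        have "emeasure lborel {x. t < g k x} \<le> emeasure lborel {x\<in>space lborel. 1 \<le> ennreal (1/t) * ennreal (g k x)}"
        proof (rule emeasure_mono)
          have "1 \<le> ennreal (1/t) * ennreal (g k x)" if "t < g k x" for x
            using that t g01(1)[OF k] by (simp add: ennreal_mult[symmetric] ennreal_le_iff2 field_simps
                flip: ennreal_1)
          then show "{x. t < g k x} \<subseteq> {x\<in>space lborel. 1 \<le> ennreal (1/t) * ennreal (g k x)}"
            by auto
        qed (use k in measurable)
        also have "\<dots> \<le> ennreal (1/t) * (\<integral>\<^sup>+x. ennreal (g k x) * indicator (space lborel) x \<partial>lborel)"
          using nn_integral_Markov_inequality[of "\<lambda>x. ennreal (g k x)" "space lborel" lborel "ennreal (1/t)"] k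
          by simp
        also have "\<dots> < \<infinity>"
          using fin[OF k] by (simp add: ennreal_mult_less_top)
        finally show ?thesis .
      qed
      show "{x. t < g k x} \<noteq> {}" if "k \<in> K" for k
        using sup[OF that True] by auto
      show "(\<Sum>k\<in>K. p k * a k) \<in> {x. t < h x}" if a: "\<And>k. k \<in> K \<Longrightarrow> a k \<in> {x. t < g k x}" for a
      proof -
        have "t = (\<Prod>k\<in>K. t powr p k)"
          using t p(2) K(1) by (simp add: powr_sum[symmetric])
        also have "\<dots> < (\<Prod>k\<in>K. g k (a k) powr p k)"
        proof -
          obtain i where i: "i \<in> K"
            using K by auto
          have less: "t powr p k < g k (a k) powr p k" if "k \<in> K" for k
            using a[OF that] t p(1)[OF that] by (intro powr_less_mono2) auto
          show ?thesis
          proof (rule prod_mono_strict[where f = "\<lambda>k. t powr p k", OF i _ K(1)])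
            show "0 < g k (a k) powr p k" if "k \<in> K" for k
              using less[OF that] powr_ge_zero[of t "p k"] by linarith
          qed (use less i in \<open>auto intro: less_imp_le\<close>)
        qed
        also have "\<dots> \<le> h (\<Sum>k\<in>K. p k * a k)"
          by (rule dom)
        finally show ?thesis by simp
      qed
    qed (use meas g h in auto)
  next
    case False
    have "emeasure lborel {x. t < g k x} = 0" if "k \<in> K" for k
    proof -
      have "{x. t < g k x} = {}"
        using g01(2)[OF that] False by (auto simp: not_less intro: order_trans)
      then show ?thesis by simp
    qed
    then show ?thesis by simp
  qed
  have "(\<Sum>k\<in>K. ennreal (p k) * (\<integral>\<^sup>+x. ennreal (g k x) \<partial>lborel)) =
      (\<Sum>k\<in>K. \<integral>\<^sup>+t. ennreal (p k) * (indicator {0..} t * emeasure lborel {x. t < g k x}) \<partial>lborel)"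
    using g meas_e by (intro sum.cong refl) (simp add: nn_integral_layer_cake nn_integral_cmult)
  also have "\<dots> = (\<integral>\<^sup>+t. (\<Sum>k\<in>K. ennreal (p k) * (indicator {0..} t * emeasure lborel {x. t < g k x})) \<partial>lborel)"
    using g meas_e by (intro nn_integral_sum[symmetric]) auto
  also have "\<dots> \<le> (\<integral>\<^sup>+t. indicator {0..} t * emeasure lborel {x. t < h x} \<partial>lborel)"
  proof (rule nn_integral_mono_AE)
    have "AE t in lborel. t \<noteq> (0::real)"
      by (rule AE_lborel_singleton)
    then show "AE t in lborel. (\<Sum>k\<in>K. ennreal (p k) * (indicator {0..} t * emeasure lborel {x. t < g k x}))
        \<le> indicator {0..} t * emeasure lborel {x. t < h x}"
    proof eventually_elim
      case (elim t)
      then show ?case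
        using level[of t] by (cases "0 < t") (auto split: split_indicator)
    qed
  qed
  also have "\<dots> = (\<integral>\<^sup>+x. ennreal (h x) \<partial>lborel)"
    by (rule nn_integral_layer_cake[symmetric]) simp
  finally show ?thesis .
qed

text \<open>Each function is divided by its supremum, and \<open>h\<close> by the weighted geometric
  mean \<open>S\<close> of the suprema, which preserves the domination hypothesis. AM-GM then brings
  the arithmetic mean of the normalised integrals back to a geometric one. If an integral is 0, so
  is the left side.\<close>

lemma prekopa_leindler_real:
  fixes f :: "'k \<Rightarrow> real \<Rightarrow> real" and h :: "real \<Rightarrow> real"
  assumes K: "finite K" "K \<noteq> {}" and p: "\<And>k. k \<in> K \<Longrightarrow> p k > 0" "sum p K = 1"
    and f[measurable]: "\<And>k. k \<in> K \<Longrightarrow> f k \<in> borel_measurable borel"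
    and f0: "\<And>k x. k \<in> K \<Longrightarrow> 0 \<le> f k x"
    and bdd: "\<And>k. k \<in> K \<Longrightarrow> bdd_above (range (f k))"
    and fin: "\<And>k. k \<in> K \<Longrightarrow> (\<integral>\<^sup>+x. ennreal (f k x) \<partial>lborel) < \<infinity>"
    and h[measurable]: "h \<in> borel_measurable borel"
    and dom: "\<And>x. (\<Prod>k\<in>K. f k (x k) powr p k) \<le> h (\<Sum>k\<in>K. p k * x k)"
  shows "ennreal (\<Prod>k\<in>K. enn2real (\<integral>\<^sup>+x. ennreal (f k x) \<partial>lborel) powr p k) \<le> (\<integral>\<^sup>+x. ennreal (h x) \<partial>lborel)"
proof (cases "\<exists>k\<in>K. (\<integral>\<^sup>+x. ennreal (f k x) \<partial>lborel) = 0")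
  case True
  then have "(\<Prod>k\<in>K. enn2real (\<integral>\<^sup>+x. ennreal (f k x) \<partial>lborel) powr p k) = 0"
    using K(1) by (intro prod_zero) force+
  then show ?thesis by simp
next
  case False
  define s where "s k = (SUP x. f k x)" for k
  define S where "S = (\<Prod>k\<in>K. s k powr p k)"
  define J where "J k = enn2real (\<integral>\<^sup>+x. ennreal (f k x) \<partial>lborel)" for k
  have le_s: "f k x \<le> s k" if "k \<in> K" for k x
    unfolding s_def using bdd[OF that] by (intro cSUP_upper) auto
  have s: "s k > 0" if k: "k \<in> K" for k
  proof (rule ccontr)
    assume "\<not> s k > 0"
    then have "f k x = 0" for x
      using le_s[OF k, of x] f0[OF k, of x] by linarith
    then show False
      using False k by auto
  qed
  have S: "S > 0"
    unfolding S_def using s by (intro prod_pos) force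
  have J: "ennreal (J k) = (\<integral>\<^sup>+x. ennreal (f k x) \<partial>lborel)" if "k \<in> K" for k
    unfolding J_def using fin[OF that] by (simp add: less_top)
  have int_div: "(\<integral>\<^sup>+x. ennreal (u x / c) \<partial>lborel) = ennreal (1 / c) * (\<integral>\<^sup>+x. ennreal (u x) \<partial>lborel)"
    if "c > 0" "u \<in> borel_measurable borel" for c :: real and u :: "real \<Rightarrow> real"
  proof -
    have "(\<integral>\<^sup>+x. ennreal (u x / c) \<partial>lborel) = (\<integral>\<^sup>+x. ennreal (1 / c) * ennreal (u x) \<partial>lborel)"
      using that(1) by (intro nn_integral_cong) (simp add: ennreal_mult'[symmetric])
    also have "\<dots> = ennreal (1 / c) * (\<integral>\<^sup>+x. ennreal (u x) \<partial>lborel)"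
      using that(2) by (intro nn_integral_cmult) auto
    finally show ?thesis .
  qed
  have "(\<Sum>k\<in>K. ennreal (p k) * (\<integral>\<^sup>+x. ennreal (f k x / s k) \<partial>lborel)) \<le> (\<integral>\<^sup>+x. ennreal (h x / S) \<partial>lborel)"
  proof (rule prekopa_leindler_real_normalized[OF K p])
    show "f k x / s k \<le> 1" if "k \<in> K" for k x
      using le_s[OF that, of x] s[OF that] by simp
    show "\<exists>x. t < f k x / s k" if k: "k \<in> K" and t: "t < 1" for k t
    proof -
      have "t * s k < s k"
        using t s[OF k] by simp
      then obtain x where "t * s k < f k x"
        unfolding s_def[of k] using bdd[OF k] by (auto simp: less_cSUP_iff)
      then show ?thesis
        using s[OF k] by (auto simp: field_simps)
    qed
    show "(\<integral>\<^sup>+x. ennreal (f k x / s k) \<partial>lborel) < \<infinity>" if k: "k \<in> K" for k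
      using int_div[OF s[OF k] f[OF k]] fin[OF k] by (simp add: ennreal_mult_less_top)
    show "(\<Prod>k\<in>K. (f k (x k) / s k) powr p k) \<le> h (\<Sum>k\<in>K. p k * x k) / S" for x
    proof -
      have "(\<Prod>k\<in>K. (f k (x k) / s k) powr p k) = (\<Prod>k\<in>K. f k (x k) powr p k) / S"
        unfolding S_def prod_dividef[symmetric]
        by (intro prod.cong refl powr_divide)
      also have "\<dots> \<le> h (\<Sum>k\<in>K. p k * x k) / S"
        using dom[of x] S by (intro divide_right_mono) auto
      finally show ?thesis .
    qed
  qed (use f0 s in \<open>auto intro!: divide_nonneg_pos\<close>)
  also have "\<dots> = ennreal (1 / S) * (\<integral>\<^sup>+x. ennreal (h x) \<partial>lborel)"
    by (rule int_div[OF S h])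
  also have "(\<Sum>k\<in>K. ennreal (p k) * (\<integral>\<^sup>+x. ennreal (f k x / s k) \<partial>lborel)) = ennreal (\<Sum>k\<in>K. p k * (J k / s k))"
  proof -
    have "ennreal (p k) * (\<integral>\<^sup>+x. ennreal (f k x / s k) \<partial>lborel) = ennreal (p k * (J k / s k))" if k: "k \<in> K" for k
    proof -
      have "ennreal (p k) * (\<integral>\<^sup>+x. ennreal (f k x / s k) \<partial>lborel) = ennreal (p k) * (ennreal (1 / s k) * ennreal (J k))"
        unfolding int_div[OF s[OF k] f[OF k]] J[OF k] ..
      also have "\<dots> = ennreal (p k) * ennreal (1 / s k * J k)"
        using s[OF k] by (subst ennreal_mult') auto
      also have "\<dots> = ennreal (p k * (1 / s k * J k))"
        using p(1)[OF k] by (subst ennreal_mult') auto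
      finally show ?thesis by simp
    qed
    then have "(\<Sum>k\<in>K. ennreal (p k) * (\<integral>\<^sup>+x. ennreal (f k x / s k) \<partial>lborel)) = (\<Sum>k\<in>K. ennreal (p k * (J k / s k)))"
      by simp
    also have "\<dots> = ennreal (\<Sum>k\<in>K. p k * (J k / s k))"
      using p s by (intro sum_ennreal) (auto simp: J_def intro!: mult_nonneg_nonneg divide_nonneg_pos less_imp_le[OF p(1)])
    finally show ?thesis .
  qed
  finally have main: "ennreal (\<Sum>k\<in>K. p k * (J k / s k)) \<le> ennreal (1 / S) * (\<integral>\<^sup>+x. ennreal (h x) \<partial>lborel)" .
  have "(\<Prod>k\<in>K. J k powr p k) / S = (\<Prod>k\<in>K. (J k / s k) powr p k)"
    unfolding S_def prod_dividef[symmetric]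
    by (intro prod.cong refl powr_divide[symmetric])
  also have "\<dots> \<le> (\<Sum>k\<in>K. p k * (J k / s k))"
    using p s by (intro weighted_am_gm[OF K]) (auto simp: J_def intro: less_imp_le intro!: divide_nonneg_pos)
  finally have "ennreal ((\<Prod>k\<in>K. J k powr p k) / S) \<le> ennreal (1 / S) * (\<integral>\<^sup>+x. ennreal (h x) \<partial>lborel)"
    using main by (meson ennreal_leI order_trans)
  then have "ennreal S * ennreal ((\<Prod>k\<in>K. J k powr p k) / S) \<le> ennreal S * (ennreal (1 / S) * (\<integral>\<^sup>+x. ennreal (h x) \<partial>lborel))"
    by (rule mult_left_mono) simp
  then show ?thesis
    using S by (simp add: J_def ennreal_mult'[symmetric] mult.assoc[symmetric])
qed

text \<open>By induction on the dimension: the one-dimensional inequality for the slices says that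
  the marginals again satisfy the domination hypothesis. The bound by \<open>B\<close> times a
  product of values of \<open>e\<close> is stable under this step, with \<open>B\<close> multiplied
  by the integral of \<open>e\<close>. It supplies the boundedness and finiteness that the
  one-dimensional case requires.\<close>

lemma prekopa_leindler_PiM:
  fixes f :: "'k \<Rightarrow> ('i \<Rightarrow> real) \<Rightarrow> real" and h :: "('i \<Rightarrow> real) \<Rightarrow> real" and e :: "real \<Rightarrow> real"
  assumes I: "finite I" and K: "finite K" "K \<noteq> {}" and p: "\<And>k. k \<in> K \<Longrightarrow> p k > 0" "sum p K = 1"
    and e: "\<And>t. 0 \<le> e t" "\<And>t. e t \<le> 1" "e \<in> borel_measurable borel" "(\<integral>\<^sup>+t. ennreal (e t) \<partial>lborel) < \<infinity>"
    and f: "\<And>k. k \<in> K \<Longrightarrow> f k \<in> borel_measurable (Pi\<^sub>M I (\<lambda>_. lborel))"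
      "\<And>k x. k \<in> K \<Longrightarrow> x \<in> I \<rightarrow>\<^sub>E UNIV \<Longrightarrow> 0 \<le> f k x"
      "\<And>k x. k \<in> K \<Longrightarrow> x \<in> I \<rightarrow>\<^sub>E UNIV \<Longrightarrow> f k x \<le> B * (\<Prod>i\<in>I. e (x i))"
    and h: "h \<in> borel_measurable (Pi\<^sub>M I (\<lambda>_. lborel))"
      "\<And>x. x \<in> I \<rightarrow>\<^sub>E UNIV \<Longrightarrow> 0 \<le> h x"
      "\<And>x. x \<in> I \<rightarrow>\<^sub>E UNIV \<Longrightarrow> h x \<le> B * (\<Prod>i\<in>I. e (x i))"
    and dom: "\<And>x. (\<And>k. k \<in> K \<Longrightarrow> x k \<in> I \<rightarrow>\<^sub>E UNIV) \<Longrightarrow>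
      (\<Prod>k\<in>K. f k (x k) powr p k) \<le> h (\<lambda>i\<in>I. \<Sum>k\<in>K. p k * x k i)"
  shows "ennreal (\<Prod>k\<in>K. enn2real (\<integral>\<^sup>+x. ennreal (f k x) \<partial>Pi\<^sub>M I (\<lambda>_. lborel)) powr p k)
    \<le> (\<integral>\<^sup>+x. ennreal (h x) \<partial>Pi\<^sub>M I (\<lambda>_. lborel))"
  using I f h dom
proof (induction I arbitrary: f h B rule: finite_induct)
  case empty
  interpret product_sigma_finite "\<lambda>_::'i. lborel :: real measure"
    by standard
  have int: "(\<integral>\<^sup>+x. ennreal (u x) \<partial>Pi\<^sub>M {} (\<lambda>_. lborel)) = ennreal (u (\<lambda>_. undefined))"
    for u :: "('i \<Rightarrow> real) \<Rightarrow> real"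
    by (simp add: PiM_empty nn_integral_count_space_finite)
  have "enn2real (ennreal (f k (\<lambda>_. undefined))) = f k (\<lambda>_. undefined)" if "k \<in> K" for k
    using empty.prems(2)[OF that] by (simp add: enn2real_ennreal)
  moreover have "(\<Prod>k\<in>K. f k (\<lambda>_. undefined) powr p k) \<le> h (\<lambda>_. undefined)"
    using empty.prems(7)[of "\<lambda>_ _. undefined"] by (simp add: restrict_def)
  ultimately show ?case
    unfolding int by (simp add: ennreal_leI)
next
  case (insert i I)
  interpret product_sigma_finite "\<lambda>_::'i. lborel :: real measure"
    by standard
  let ?M = "\<lambda>I. Pi\<^sub>M I (\<lambda>_::'i. lborel :: real measure)"
  note [measurable] = e(3)
  define E where "E = enn2real (\<integral>\<^sup>+t. ennreal (e t) \<partial>lborel)"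
  have E: "(\<integral>\<^sup>+t. ennreal (e t) \<partial>lborel) = ennreal E" "0 \<le> E"
    using e(4) by (auto simp: E_def less_top)
  \<comment> \<open>The induction hypothesis speaks of real functions. The value loses nothing,
    because by \<open>slice_fin\<close> the slices of \<open>good\<close> functions have finite
    integrals.\<close>
  define marg where "marg u x = enn2real (\<integral>\<^sup>+t. ennreal (u (x(i := t))) \<partial>lborel)"
    for u :: "('i \<Rightarrow> real) \<Rightarrow> real" and x
  define good where "good u \<longleftrightarrow> u \<in> borel_measurable (?M (insert i I)) \<and>
      (\<forall>x\<in>insert i I \<rightarrow>\<^sub>E UNIV. 0 \<le> u x \<and> u x \<le> B * (\<Prod>i\<in>insert i I. e (x i)))"
    for u :: "('i \<Rightarrow> real) \<Rightarrow> real"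
  have goodf: "good (f k)" if "k \<in> K" for k
    using insert.prems(1-3)[OF that] by (auto simp: good_def)
  have goodh: "good h"
    using insert.prems(4-6) by (auto simp: good_def)
  have upd: "x(i := t) \<in> insert i I \<rightarrow>\<^sub>E UNIV" if "x \<in> I \<rightarrow>\<^sub>E UNIV" for x :: "'i \<Rightarrow> real" and t
    using that by (auto simp: PiE_def extensional_def)
  have slice_meas: "(\<lambda>t. u (x(i := t))) \<in> borel_measurable borel" if "good u" "x \<in> I \<rightarrow>\<^sub>E UNIV" for u x
  proof -
    have "(\<lambda>t. u (x(i := t))) \<in> borel_measurable lborel"
      using measurable_comp[OF measurable_component_update[of x I "\<lambda>_. lborel" i]] that insert.hyps
      by (auto simp: good_def comp_def space_PiM)
    then show ?thesis by simp
  qed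
  have slice_bound: "0 \<le> u (x(i := t)) \<and> u (x(i := t)) \<le> B * (\<Prod>j\<in>I. e (x j)) * e t"
    if "good u" "x \<in> I \<rightarrow>\<^sub>E UNIV" for u x t
  proof -
    have "(\<Prod>j\<in>insert i I. e ((x(i := t)) j)) = (\<Prod>j\<in>I. e (x j)) * e t"
    proof -
      have "(\<Prod>j\<in>I. e ((x(i := t)) j)) = (\<Prod>j\<in>I. e (x j))"
        using insert.hyps by (intro prod.cong) auto
      then show ?thesis
        using insert.hyps by simp
    qed
    then show ?thesis
      using that upd[OF that(2), of t] by (auto simp: good_def mult.assoc)
  qed
  have slice_int: "(\<integral>\<^sup>+t. ennreal (u (x(i := t))) \<partial>lborel) \<le> ennreal (B * E * (\<Prod>j\<in>I. e (x j)))"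
    if "good u" "x \<in> I \<rightarrow>\<^sub>E UNIV" for u x
  proof -
    have "(\<integral>\<^sup>+t. ennreal (u (x(i := t))) \<partial>lborel) \<le> (\<integral>\<^sup>+t. ennreal (B * (\<Prod>j\<in>I. e (x j))) * ennreal (e t) \<partial>lborel)"
      using slice_bound[OF that] e(1)
      by (intro nn_integral_mono) (auto simp: ennreal_mult''[symmetric] intro!: ennreal_leI)
    also have "\<dots> = ennreal (B * (\<Prod>j\<in>I. e (x j))) * ennreal E"
      by (simp add: nn_integral_cmult E(1))
    also have "\<dots> = ennreal (B * E * (\<Prod>j\<in>I. e (x j)))"
      unfolding ennreal_mult''[OF E(2), symmetric] by (simp add: mult_ac)
    finally show ?thesis .
  qed
  have slice_fin: "(\<integral>\<^sup>+t. ennreal (u (x(i := t))) \<partial>lborel) < \<infinity>" if "good u" "x \<in> I \<rightarrow>\<^sub>E UNIV" for u x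
    using slice_int[OF that] by (rule order.strict_trans1) simp
  have marg: "ennreal (marg u x) = (\<integral>\<^sup>+t. ennreal (u (x(i := t))) \<partial>lborel)" if "good u" "x \<in> I \<rightarrow>\<^sub>E UNIV" for u x
    using slice_fin[OF that] by (simp add: marg_def less_top)
  have marg_meas: "marg u \<in> borel_measurable (?M I)" if "good u" for u
  proof -
    have [measurable]: "u \<in> borel_measurable (?M (insert i I))"
      using that by (simp add: good_def)
    show ?thesis
      unfolding marg_def by measurable
  qed
  have marg_le: "marg u x \<le> B * E * (\<Prod>j\<in>I. e (x j))" if "good u" "x \<in> I \<rightarrow>\<^sub>E UNIV" for u x
  proof -
    \<comment> \<open>The sign of \<open>B\<close> is not assumed. Wherever \<open>e\<close> is
      positive, the bound on a nonnegative function forces the rest to be nonnegative; otherwise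
      \<open>E\<close> is 0.\<close>
    have "0 \<le> B * E * (\<Prod>j\<in>I. e (x j))"
    proof (cases "E = 0")
      case False
      have "\<exists>t. e t \<noteq> 0"
      proof (rule ccontr)
        assume "\<nexists>t. e t \<noteq> 0"
        then have "E = 0" by (simp add: E_def)
        with False show False ..
      qed
      then obtain t where "e t > 0"
        using e(1) by (metis less_eq_real_def)
      moreover have "0 \<le> B * (\<Prod>j\<in>I. e (x j)) * e t"
        using slice_bound[OF that, of t] by linarith
      ultimately have "0 \<le> B * (\<Prod>j\<in>I. e (x j))"
        by (simp add: zero_le_mult_iff)
      then have "0 \<le> E * (B * (\<Prod>j\<in>I. e (x j)))"
        using E(2) mult_nonneg_nonneg by blast
      then show ?thesis
        by (simp add: mult_ac)
    qed simp
    then show ?thesis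
      unfolding marg_def using slice_int[OF that] by (intro enn2real_leI)
  qed
  have marg_int: "(\<integral>\<^sup>+x. ennreal (marg u x) \<partial>?M I) = (\<integral>\<^sup>+x. ennreal (u x) \<partial>?M (insert i I))" if "good u" for u
  proof -
    have "(\<integral>\<^sup>+x. ennreal (marg u x) \<partial>?M I) = (\<integral>\<^sup>+x. (\<integral>\<^sup>+t. ennreal (u (x(i := t))) \<partial>lborel) \<partial>?M I)"
      using marg[OF that] by (intro nn_integral_cong) (auto simp: space_PiM)
    also have "\<dots> = (\<integral>\<^sup>+x. ennreal (u x) \<partial>?M (insert i I))"
      using that insert.hyps by (intro product_nn_integral_insert[symmetric]) (auto simp: good_def)
    finally show ?thesis .
  qed
  have "ennreal (\<Prod>k\<in>K. enn2real (\<integral>\<^sup>+x. ennreal (marg (f k) x) \<partial>?M I) powr p k)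
      \<le> (\<integral>\<^sup>+x. ennreal (marg h x) \<partial>?M I)"
  proof (rule insert.IH)
    fix x :: "'k \<Rightarrow> 'i \<Rightarrow> real"
    assume x: "\<And>k. k \<in> K \<Longrightarrow> x k \<in> I \<rightarrow>\<^sub>E UNIV"
    let ?m = "\<lambda>i\<in>I. \<Sum>k\<in>K. p k * x k i"
    have m: "?m \<in> I \<rightarrow>\<^sub>E UNIV"
      by auto
    have "ennreal (\<Prod>k\<in>K. enn2real (\<integral>\<^sup>+t. ennreal (f k ((x k)(i := t))) \<partial>lborel) powr p k)
        \<le> (\<integral>\<^sup>+t. ennreal (h (?m(i := t))) \<partial>lborel)"
    proof (rule prekopa_leindler_real[OF K p])
      fix k assume k: "k \<in> K"
      show "(\<lambda>t. f k ((x k)(i := t))) \<in> borel_measurable borel"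
        by (rule slice_meas[OF goodf[OF k] x[OF k]])
      show "0 \<le> f k ((x k)(i := t))" for t
        using slice_bound[OF goodf[OF k] x[OF k], of t] by simp
      show "(\<integral>\<^sup>+t. ennreal (f k ((x k)(i := t))) \<partial>lborel) < \<infinity>"
        by (rule slice_fin[OF goodf[OF k] x[OF k]])
      show "bdd_above (range (\<lambda>t. f k ((x k)(i := t))))"
      proof (rule bdd_aboveI2)
        fix t
        let ?c = "B * (\<Prod>j\<in>I. e (x k j))"
        have "f k ((x k)(i := t)) \<le> ?c * e t"
          using slice_bound[OF goodf[OF k] x[OF k], of t] by simp
        also have "\<dots> \<le> \<bar>?c\<bar> * 1"
          using e(1,2)[of t] by (intro mult_mono) auto
        finally show "f k ((x k)(i := t)) \<le> \<bar>?c\<bar> * 1" .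
      qed
    next
      show "(\<lambda>t. h (?m(i := t))) \<in> borel_measurable borel"
        by (rule slice_meas[OF goodh m])
      fix t :: "'k \<Rightarrow> real"
      have "(\<Prod>k\<in>K. f k ((x k)(i := t k)) powr p k) \<le> h (\<lambda>j\<in>insert i I. \<Sum>k\<in>K. p k * ((x k)(i := t k)) j)"
        by (rule insert.prems(7)) (rule upd, rule x)
      also have "(\<lambda>j\<in>insert i I. \<Sum>k\<in>K. p k * ((x k)(i := t k)) j) = ?m(i := \<Sum>k\<in>K. p k * t k)"
        using insert.hyps by (auto simp: fun_eq_iff)
      finally show "(\<Prod>k\<in>K. f k ((x k)(i := t k)) powr p k) \<le> h (?m(i := \<Sum>k\<in>K. p k * t k))" .
    qed
    then have "ennreal (\<Prod>k\<in>K. marg (f k) (x k) powr p k) \<le> ennreal (marg h ?m)"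
      unfolding marg[OF goodh m] by (simp add: marg_def)
    then show "(\<Prod>k\<in>K. marg (f k) (x k) powr p k) \<le> marg h ?m"
      by (subst (asm) ennreal_le_iff) (auto simp: marg_def)
  next
    fix k x assume k: "k \<in> K"
    show "marg (f k) \<in> borel_measurable (?M I)"
      by (rule marg_meas[OF goodf[OF k]])
    assume x: "x \<in> I \<rightarrow>\<^sub>E (UNIV :: real set)"
    show "0 \<le> marg (f k) x"
      by (simp add: marg_def)
    show "marg (f k) x \<le> B * E * (\<Prod>i\<in>I. e (x i))"
      by (rule marg_le[OF goodf[OF k] x])
  next
    fix x assume x: "x \<in> I \<rightarrow>\<^sub>E (UNIV :: real set)"
    show "0 \<le> marg h x"
      by (simp add: marg_def)
    show "marg h x \<le> B * E * (\<Prod>i\<in>I. e (x i))"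
      by (rule marg_le[OF goodh x])
  next
    show "marg h \<in> borel_measurable (?M I)"
      by (rule marg_meas[OF goodh])
  qed
  then show ?case
    by (simp add: marg_int goodf goodh cong: prod.cong)
qed

section \<open>Log-concavity in the column sums\<close>

lemma multi_weight_nonneg: "(\<And>j. j < n \<Longrightarrow> 0 \<le> z j) \<Longrightarrow> 0 \<le> (multi_weight n d z :: real)"
  unfolding multi_weight_def by (intro mult_nonneg_nonneg prod_nonneg) auto

lemma multi_coeff_nonneg:
  "(\<And>i j. i < m \<Longrightarrow> j < n \<Longrightarrow> 0 \<le> a i j) \<Longrightarrow> 0 \<le> (multi_coeff m n R a c :: real)"
  unfolding multi_coeff_def by (intro sum_nonneg prod_nonneg multi_weight_nonneg) auto

lemma stable_multi_coeff:
  assumes a: "\<And>i j. i < m \<Longrightarrow> j < n \<Longrightarrow> 0 < a i j" and N: "N = (\<Sum>i<m. R i)"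
  shows "stable_coeffs n N (multi_coeff m n R a)"
proof
  show "0 \<le> multi_coeff m n R a c" for c
    using a by (intro multi_coeff_nonneg) (auto intro: less_imp_le)
  fix y :: "nat \<Rightarrow> complex"
  assume y: "\<And>l. l < n \<Longrightarrow> y l = 0 \<or> 0 < Re (y l)" and ex: "\<exists>l<n. y l \<noteq> 0"
  have "(\<Sum>j<n. complex_of_real (a i j) * y j) \<noteq> 0" if i: "i < m" for i
  proof -
    obtain l where l: "l < n" "y l \<noteq> 0"
      using ex by blast
    have "0 < (\<Sum>j<n. a i j * Re (y j))"
    proof (rule sum_pos2[of _ l])
      show "0 < a i l * Re (y l)"
        using a[OF i l(1)] y[OF l(1)] l(2) by simp
      show "0 \<le> a i j * Re (y j)" if "j \<in> {..<n}" for j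
        using a[OF i, of j] y[of j] that by fastforce
    qed (use l in auto)
    also have "\<dots> = Re (\<Sum>j<n. complex_of_real (a i j) * y j)"
      by simp
    finally show ?thesis
      by (metis less_irrefl zero_complex.sel(1))
  qed
  then have "(\<Prod>i<m. (\<Sum>j<n. complex_of_real (a i j) * y j) ^ R i) \<noteq> 0"
    by simp
  then show "(\<Sum>c\<in>compositions n N. complex_of_real (multi_coeff m n R a c) * (\<Prod>l<n. y l ^ c l)) \<noteq> 0"
    using sum_multi_coeff[OF N, of n "\<lambda>i j. complex_of_real (a i j)" y]
    by (simp add: multi_coeff_of_real)
qed

text \<open>The density of the standard exponential distribution. With 0 excluded,
  \<open>table_density\<close> vanishes unless all entries are positive, and the stability argument
  applies only to positive entries.\<close>

definition expo :: "real \<Rightarrow> real" where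
  "expo t = indicator {0<..} t * exp (- t)"

lemma expo_measurable [measurable]: "expo \<in> borel_measurable borel"
  unfolding expo_def[abs_def] by measurable

lemma expo_nonneg: "0 \<le> expo t"
  by (simp add: expo_def)

lemma power_expo_nonneg: "0 \<le> t ^ d * expo t"
  by (simp add: expo_def indicator_def)

lemma nn_integral_power_expo: "(\<integral>\<^sup>+t. ennreal (t ^ d * expo t) \<partial>lborel) = ennreal (fact d)"
proof -
  have "(\<integral>\<^sup>+t. ennreal (t ^ d * expo t) \<partial>lborel) = (\<integral>\<^sup>+t. ennreal (t ^ d * exp (- t)) * indicator {0..} t \<partial>lborel)"
  proof (rule nn_integral_cong_AE)
    have "AE t in lborel. t \<noteq> (0::real)"
      by (rule AE_lborel_singleton)
    then show "AE t in lborel. ennreal (t ^ d * expo t) = ennreal (t ^ d * exp (- t)) * indicator {0..} t"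
      by eventually_elim (auto simp: expo_def split: split_indicator)
  qed
  then show ?thesis
    by (simp add: nn_intergal_power_times_exp_Ici)
qed

lemma nn_integral_expo_half: "(\<integral>\<^sup>+t. ennreal (expo (t / 2)) \<partial>lborel) < \<infinity>"
proof -
  have "(\<integral>\<^sup>+t. ennreal (expo (t / 2)) \<partial>lborel) = ennreal 2 * (\<integral>\<^sup>+t. ennreal (expo t) \<partial>lborel)"
    by (subst nn_integral_real_affine[of _ 2 0]) auto
  then show ?thesis
    using nn_integral_power_expo[of 0] by (simp add: ennreal_mult_less_top)
qed

text \<open>Half of the exponential decay absorbs the power, since (t/2)^d / d! <= exp(t/2). The
  other half is the integrable function \<open>e\<close> for \<open>prekopa_leindler_PiM\<close>,
  the same for all tables.\<close>

lemma power_expo_le: "t ^ d * expo t \<le> 2 ^ d * fact d * expo (t / 2)"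
proof (cases "0 < t")
  case True
  have "(t / 2) ^ d / fact d \<le> exp (t / 2)"
  proof -
    have s: "(\<lambda>k. (t / 2) ^ k /\<^sub>R fact k) sums exp (t / 2)"
      by (rule exp_converges)
    have "(\<Sum>k\<in>{d}. (t / 2) ^ k /\<^sub>R fact k) \<le> (\<Sum>k. (t / 2) ^ k /\<^sub>R fact k)"
      by (rule sum_le_suminf[OF sums_summable[OF s]]) (use True in simp_all)
    moreover have "(\<Sum>k\<in>{d}. (t / 2) ^ k /\<^sub>R fact k) = (t / 2) ^ d / fact d"
      by (simp only: real_scaleR_def divide_inverse_commute[of _ "fact d"]) simp
    ultimately show ?thesis
      unfolding sums_unique[OF s, symmetric] by linarith
  qed
  then have "t ^ d \<le> 2 ^ d * fact d * exp (t / 2)"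
    by (simp only: power_divide divide_divide_eq_left) (simp only: pos_divide_le_eq fact_gt_zero zero_less_power mult_pos_pos zero_less_numeral mult.commute)
  then have "t ^ d * exp (- t) \<le> 2 ^ d * fact d * exp (t / 2) * exp (- t)"
    by (intro mult_right_mono) auto
  also have "\<dots> = 2 ^ d * fact d * exp (- (t / 2))"
    by (simp add: mult_exp_exp)
  finally show ?thesis
    using True by (simp add: expo_def)
qed (simp add: expo_def)

text \<open>
  As \<open>\<integral> t ^ d * exp (- t) = fact d\<close> over the positive reals, integrating out \<open>g\<close> turns the
  multinomial weights of the tables into weights \<open>\<Prod>W i j ^ D i j\<close>.
\<close>

definition table_density :: "nat \<Rightarrow> nat \<Rightarrow> (nat \<Rightarrow> nat) \<Rightarrow> (nat \<Rightarrow> nat \<Rightarrow> real) \<Rightarrow> (nat \<Rightarrow> nat) \<Rightarrow> (nat \<times> nat \<Rightarrow> real) \<Rightarrow> real" where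
  "table_density m n R W c g =
    multi_coeff m n R (\<lambda>i j. W i j * g (i, j)) c * (\<Prod>i\<in>{..<m}\<times>{..<n}. expo (g i))"

lemma table_density_eq:
  "table_density m n R W c g =
    (\<Sum>D\<in>tables m n R c. (\<Prod>i<m. multi_weight n (D i) (W i)) *
      (\<Prod>i\<in>{..<m}\<times>{..<n}. g i ^ case_prod D i * expo (g i)))"
proof -
  have "(\<Prod>i<m. \<Prod>j<n. g (i, j) ^ D i j) = (\<Prod>i\<in>{..<m}\<times>{..<n}. g i ^ case_prod D i)" for D
    by (simp add: prod.cartesian_product case_prod_unfold)
  then show ?thesis
    unfolding table_density_def multi_coeff_def sum_distrib_right
    by (simp add: multi_weight_mult prod.distrib mult.assoc)
qed

lemma prod_multi_weight_fact:
  assumes "D \<in> tables m n R c"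
  shows "(\<Prod>i<m. multi_weight n (D i) (W i)) * (\<Prod>i\<in>{..<m}\<times>{..<n}. fact (case_prod D i)) =
    (\<Prod>i<m. fact (R i)) * (\<Prod>i<m. \<Prod>j<n. W i j ^ D i j :: real)"
proof -
  have "(\<Prod>i\<in>{..<m}\<times>{..<n}. fact (case_prod D i) :: real) = (\<Prod>i<m. \<Prod>j<n. fact (D i j))"
    by (simp add: prod.cartesian_product case_prod_unfold)
  moreover have "multi_weight n (D i) (W i) * (\<Prod>j<n. fact (D i j)) = fact (R i) * (\<Prod>j<n. W i j ^ D i j)"
    if "i < m" for i
    using assms that by (simp add: multi_weight_def tables_def prod_dividef)
  ultimately show ?thesis
    by (simp add: prod.distrib[symmetric])
qed

context
  fixes m n :: nat and R :: "nat \<Rightarrow> nat" and W :: "nat \<Rightarrow> nat \<Rightarrow> real"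
  assumes W: "\<And>i j. i < m \<Longrightarrow> j < n \<Longrightarrow> 0 < W i j"
begin

lemma prod_multi_weight_nonneg: "0 \<le> (\<Prod>i<m. multi_weight n (D i) (W i))"
  using W by (intro prod_nonneg multi_weight_nonneg) (auto intro: less_imp_le)

lemma table_density_nonneg: "0 \<le> table_density m n R W c g"
  unfolding table_density_eq
  by (intro sum_nonneg mult_nonneg_nonneg prod_multi_weight_nonneg prod_nonneg power_expo_nonneg)

lemma table_density_measurable:
  "table_density m n R W c \<in> borel_measurable (Pi\<^sub>M ({..<m}\<times>{..<n}) (\<lambda>_. lborel))"
  unfolding table_density_eq[abs_def]
  by (intro borel_measurable_sum borel_measurable_times borel_measurable_prod borel_measurable_const) measurable

lemma nn_integral_table_density:
  "(\<integral>\<^sup>+g. ennreal (table_density m n R W c g) \<partial>Pi\<^sub>M ({..<m}\<times>{..<n}) (\<lambda>_. lborel)) =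
    ennreal ((\<Prod>i<m. fact (R i)) * T m n R c W)"
proof -
  interpret product_sigma_finite "\<lambda>_::nat \<times> nat. lborel :: real measure"
    by standard
  let ?I = "{..<m}\<times>{..<n}"
  let ?M = "Pi\<^sub>M ?I (\<lambda>_. lborel :: real measure)"
  let ?w = "\<lambda>D. \<Prod>i<m. multi_weight n (D i) (W i)"
  have "(\<integral>\<^sup>+g. ennreal (table_density m n R W c g) \<partial>?M) =
      (\<integral>\<^sup>+g. (\<Sum>D\<in>tables m n R c. ennreal (?w D) * (\<Prod>i\<in>?I. ennreal (g i ^ case_prod D i * expo (g i)))) \<partial>?M)"
    unfolding table_density_eq
    by (intro nn_integral_cong)
      (simp add: sum_ennreal[symmetric] prod_ennreal ennreal_mult'' prod_multi_weight_nonneg power_expo_nonneg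
        prod_nonneg mult_nonneg_nonneg del: sum_ennreal)
  also have "\<dots> = (\<Sum>D\<in>tables m n R c. \<integral>\<^sup>+g. ennreal (?w D) * (\<Prod>i\<in>?I. ennreal (g i ^ case_prod D i * expo (g i))) \<partial>?M)"
    by (rule nn_integral_sum) measurable
  also have "\<dots> = (\<Sum>D\<in>tables m n R c. ennreal (?w D) * (\<integral>\<^sup>+g. (\<Prod>i\<in>?I. ennreal (g i ^ case_prod D i * expo (g i))) \<partial>?M))"
    by (intro sum.cong refl nn_integral_cmult) measurable
  also have "\<dots> = (\<Sum>D\<in>tables m n R c. ennreal (?w D) * (\<Prod>i\<in>?I. ennreal (fact (case_prod D i))))"
    by (intro sum.cong refl arg_cong2[of _ _ _ _ "(*)"], subst product_nn_integral_prod)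
      (auto simp: nn_integral_power_expo)
  also have "\<dots> = (\<Sum>D\<in>tables m n R c. ennreal (?w D * (\<Prod>i\<in>?I. fact (case_prod D i))))"
    by (simp add: prod_ennreal ennreal_mult prod_multi_weight_nonneg prod_nonneg)
  also have "\<dots> = (\<Sum>D\<in>tables m n R c. ennreal ((\<Prod>i<m. fact (R i)) * (\<Prod>i<m. \<Prod>j<n. W i j ^ D i j)))"
    by (intro sum.cong refl) (simp only: prod_multi_weight_fact)
  also have "\<dots> = ennreal (\<Sum>D\<in>tables m n R c. (\<Prod>i<m. fact (R i)) * (\<Prod>i<m. \<Prod>j<n. W i j ^ D i j))"
    using W by (intro sum_ennreal mult_nonneg_nonneg prod_nonneg) (auto intro: less_imp_le)
  also have "\<dots> = ennreal ((\<Prod>i<m. fact (R i)) * T m n R c W)"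
    by (simp add: T_def sum_distrib_left)
  finally show ?thesis .
qed

lemma table_density_le:
  "\<exists>B\<ge>0. \<forall>g. table_density m n R W c g \<le> B * (\<Prod>i\<in>{..<m}\<times>{..<n}. expo (g i / 2))"
proof -
  let ?I = "{..<m}\<times>{..<n}"
  let ?w = "\<lambda>D. \<Prod>i<m. multi_weight n (D i) (W i)"
  let ?b = "\<lambda>D. \<Prod>i\<in>?I. 2 ^ case_prod D i * fact (case_prod D i) :: real"
  have "table_density m n R W c g \<le> (\<Sum>D\<in>tables m n R c. ?w D * ?b D) * (\<Prod>i\<in>?I. expo (g i / 2))" for g
    unfolding table_density_eq sum_distrib_right mult.assoc prod.distrib[symmetric]
    by (intro sum_mono mult_left_mono prod_multi_weight_nonneg prod_mono conjI power_expo_nonneg)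
      (simp add: power_expo_le flip: mult.assoc)
  moreover have "0 \<le> (\<Sum>D\<in>tables m n R c. ?w D * ?b D)"
    by (intro sum_nonneg mult_nonneg_nonneg prod_multi_weight_nonneg prod_nonneg) auto
  ultimately show ?thesis by blast
qed

end

lemma power_powr_swap: "(x ^ r) powr p = (x powr p) ^ r" for x :: real
  by (induction r) (auto simp: powr_mult)

text \<open>Each form is linear in its coefficients, so AM-GM for a single form gives log-concavity,
  and powers and products preserve it.\<close>

lemma linear_forms_log_concave:
  fixes p :: "'k \<Rightarrow> real"
  assumes K: "finite K" "K \<noteq> {}" "\<And>k. k \<in> K \<Longrightarrow> 0 < p k" "sum p K = 1"
    and a: "\<And>k i j. k \<in> K \<Longrightarrow> i < m \<Longrightarrow> j < n \<Longrightarrow> 0 \<le> a k i j" and y: "\<And>j. j < n \<Longrightarrow> 0 \<le> y j"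
  shows "(\<Prod>k\<in>K. (\<Prod>i<m. (\<Sum>j<n. a k i j * y j) ^ R i) powr p k) \<le>
    (\<Prod>i<m. (\<Sum>j<n. (\<Sum>k\<in>K. p k * a k i j) * y j) ^ R i)"
proof -
  have nn: "0 \<le> (\<Sum>j<n. a k i j * y j)" if "k \<in> K" "i < m" for k i
    using a y that by (intro sum_nonneg mult_nonneg_nonneg) auto
  have "(\<Prod>k\<in>K. (\<Prod>i<m. (\<Sum>j<n. a k i j * y j) ^ R i) powr p k) =
      (\<Prod>k\<in>K. \<Prod>i<m. ((\<Sum>j<n. a k i j * y j) powr p k) ^ R i)"
  proof (intro prod.cong refl)
    fix k assume k: "k \<in> K"
    have "(\<Prod>i<m. (\<Sum>j<n. a k i j * y j) ^ R i) powr p k = (\<Prod>i<m. ((\<Sum>j<n. a k i j * y j) ^ R i) powr p k)"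
      by (rule prod_powr_distrib)
    also have "\<dots> = (\<Prod>i<m. ((\<Sum>j<n. a k i j * y j) powr p k) ^ R i)"
      by (intro prod.cong refl power_powr_swap)
    finally show "(\<Prod>i<m. (\<Sum>j<n. a k i j * y j) ^ R i) powr p k = (\<Prod>i<m. ((\<Sum>j<n. a k i j * y j) powr p k) ^ R i)" .
  qed
  also have "\<dots> = (\<Prod>i<m. (\<Prod>k\<in>K. (\<Sum>j<n. a k i j * y j) powr p k) ^ R i)"
    by (subst prod.swap) (simp add: prod_power_distrib)
  also have "\<dots> \<le> (\<Prod>i<m. (\<Sum>j<n. (\<Sum>k\<in>K. p k * a k i j) * y j) ^ R i)"
  proof (intro prod_mono conjI zero_le_power prod_nonneg power_mono)
    fix i assume i: "i \<in> {..<m}"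
    have "(\<Prod>k\<in>K. (\<Sum>j<n. a k i j * y j) powr p k) \<le> (\<Sum>k\<in>K. p k * (\<Sum>j<n. a k i j * y j))"
      using K nn i by (intro weighted_am_gm) (auto intro: less_imp_le)
    also have "\<dots> = (\<Sum>j<n. (\<Sum>k\<in>K. p k * a k i j) * y j)"
      unfolding sum_distrib_left sum_distrib_right by (subst sum.swap) (simp add: mult.assoc)
    finally show "(\<Prod>k\<in>K. (\<Sum>j<n. a k i j * y j) powr p k) \<le> (\<Sum>j<n. (\<Sum>k\<in>K. p k * a k i j) * y j)" .
  qed (auto simp: prod_nonneg)
  finally show ?thesis .
qed

context
  fixes m n N :: nat and R C :: "nat \<Rightarrow> nat" and W :: "nat \<Rightarrow> nat \<Rightarrow> real"
    and K :: "(nat \<Rightarrow> nat) set" and p :: "(nat \<Rightarrow> nat) \<Rightarrow> real"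
  assumes W: "\<And>i j. i < m \<Longrightarrow> j < n \<Longrightarrow> 0 < W i j"
    and N: "N = (\<Sum>i<m. R i)" and n: "0 < n"
    and C: "C \<in> compositions n N" "\<And>j. j < n \<Longrightarrow> 0 < C j"
    and K: "K \<subseteq> compositions n N" "K \<noteq> {}" and p: "\<And>c. c \<in> K \<Longrightarrow> 0 < p c" "sum p K = 1"
    and mean: "\<And>j. j < n \<Longrightarrow> (\<Sum>c\<in>K. p c * real (c j)) = real (C j)"
begin

lemma finite_K: "finite K"
  using K(1) finite_compositions by (rule finite_subset)

text \<open>The point \<open>y\<close> is chosen for the averaged matrix and for \<open>C\<close>,
  and the same \<open>y\<close> is used for every \<open>c\<close>. A single coefficient times its
  monomial is at most the whole polynomial at any positive point, so the capacity factor arises only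
  at \<open>C\<close>. As the distribution has mean \<open>C\<close>, the monomials combine to that
  of \<open>C\<close> and cancel.\<close>

lemma multi_coeff_log_concave:
  assumes a: "\<And>c i j. c \<in> K \<Longrightarrow> i < m \<Longrightarrow> j < n \<Longrightarrow> 0 < a c i j"
  shows "(\<Prod>c\<in>K. multi_coeff m n R (a c) c powr p c) \<le>
    real (N + 1) ^ n * multi_coeff m n R (\<lambda>i j. \<Sum>c\<in>K. p c * a c i j) C"
proof -
  let ?a = "\<lambda>i j. \<Sum>c\<in>K. p c * a c i j"
  have apos: "0 < ?a i j" if "i < m" "j < n" for i j
    using K(2) finite_K p a that by (intro sum_pos) auto
  interpret stable_coeffs n N "multi_coeff m n R ?a"
    by (rule stable_multi_coeff[OF apos N])
  obtain y where y: "\<And>l. 0 < y l"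
    "(\<Sum>c\<in>compositions n N. multi_coeff m n R ?a c * (\<Prod>l<n. y l ^ c l)) \<le>
      real (N + 1) ^ n * multi_coeff m n R ?a C * (\<Prod>l<n. y l ^ C l)"
    using coeff_capacity[OF n C] by blast
  have Y: "0 < (\<Prod>l<n. y l ^ c l)" for c :: "nat \<Rightarrow> nat"
    using y(1) by (intro prod_pos) simp
  have nn: "0 \<le> multi_coeff m n R (a c) c'" if "c \<in> K" for c c'
    using a that by (intro multi_coeff_nonneg) (auto intro: less_imp_le)
  have "(\<Prod>c\<in>K. multi_coeff m n R (a c) c powr p c) * (\<Prod>l<n. y l ^ C l) =
      (\<Prod>c\<in>K. (multi_coeff m n R (a c) c * (\<Prod>l<n. y l ^ c l)) powr p c)"
  proof -
    have "(\<Prod>c\<in>K. (\<Prod>l<n. y l ^ c l) powr p c) = (\<Prod>c\<in>K. \<Prod>l<n. y l powr (p c * real (c l)))"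
    proof (intro prod.cong refl)
      fix c
      have "(\<Prod>l<n. y l ^ c l) powr p c = (\<Prod>l<n. (y l ^ c l) powr p c)"
        by (rule prod_powr_distrib)
      also have "\<dots> = (\<Prod>l<n. y l powr (p c * real (c l)))"
        using y(1) by (intro prod.cong refl) (simp add: powr_powr mult.commute flip: powr_realpow)
      finally show "(\<Prod>l<n. y l ^ c l) powr p c = (\<Prod>l<n. y l powr (p c * real (c l)))" .
    qed
    also have "\<dots> = (\<Prod>l<n. \<Prod>c\<in>K. y l powr (p c * real (c l)))"
      by (rule prod.swap)
    also have "\<dots> = (\<Prod>l<n. y l ^ C l)"
    proof (intro prod.cong refl)
      fix l assume l: "l \<in> {..<n}"
      have "(\<Prod>c\<in>K. y l powr (p c * real (c l))) = y l powr (\<Sum>c\<in>K. p c * real (c l))"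
        using y(1)[of l] by (intro powr_sum[symmetric]) (auto simp: finite_K)
      also have "\<dots> = y l ^ C l"
        using mean[of l] l y(1)[of l] by (simp add: powr_realpow)
      finally show "(\<Prod>c\<in>K. y l powr (p c * real (c l))) = y l ^ C l" .
    qed
    finally show ?thesis
      using nn Y by (simp add: powr_mult prod.distrib less_imp_le)
  qed
  also have "\<dots> \<le> (\<Prod>c\<in>K. (\<Prod>i<m. (\<Sum>j<n. a c i j * y j) ^ R i) powr p c)"
  proof (intro prod_mono conjI powr_mono2)
    fix c assume c: "c \<in> K"
    have "multi_coeff m n R (a c) c * (\<Prod>l<n. y l ^ c l) \<le>
        (\<Sum>c'\<in>compositions n N. multi_coeff m n R (a c) c' * (\<Prod>l<n. y l ^ c' l))"
      using c K(1) nn[OF c] Y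
      by (intro member_le_sum) (auto simp: finite_compositions intro!: mult_nonneg_nonneg less_imp_le[OF Y])
    then show "multi_coeff m n R (a c) c * (\<Prod>l<n. y l ^ c l) \<le> (\<Prod>i<m. (\<Sum>j<n. a c i j * y j) ^ R i)"
      by (simp add: sum_multi_coeff[OF N])
    show "0 \<le> multi_coeff m n R (a c) c * (\<Prod>l<n. y l ^ c l)"
      using nn[OF c] Y by (intro mult_nonneg_nonneg) (auto intro: less_imp_le)
    show "0 \<le> p c"
      using p(1)[OF c] by simp
  qed simp
  also have "\<dots> \<le> (\<Prod>i<m. (\<Sum>j<n. ?a i j * y j) ^ R i)"
    using a y(1) by (intro linear_forms_log_concave finite_K K(2) p) (auto intro: less_imp_le)
  also have "\<dots> \<le> real (N + 1) ^ n * multi_coeff m n R ?a C * (\<Prod>l<n. y l ^ C l)"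
    using y(2) unfolding sum_multi_coeff[OF N] .
  finally show ?thesis
    using Y by simp
qed

lemma table_density_log_concave:
  fixes x :: "(nat \<Rightarrow> nat) \<Rightarrow> nat \<times> nat \<Rightarrow> real"
  shows "(\<Prod>c\<in>K. table_density m n R W c (x c) powr p c) \<le>
    real (N + 1) ^ n * table_density m n R W C (\<lambda>i\<in>{..<m}\<times>{..<n}. \<Sum>c\<in>K. p c * x c i)"
\<comment> \<open>With a nonpositive entry the density of that table is 0, which makes the left side
  0. For positive entries the exponential factors are log-linear and combine exactly, so the loss
  comes from \<open>multi_coeff\<close> alone.\<close>
proof (cases "\<forall>c\<in>K. \<forall>i\<in>{..<m}\<times>{..<n}. 0 < x c i")
  case False
  then obtain c i where ci: "c \<in> K" "i \<in> {..<m}\<times>{..<n}" "x c i \<le> 0"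
    by (meson not_less)
  then have "(\<Prod>i\<in>{..<m}\<times>{..<n}. expo (x c i)) = 0"
    by (intro prod_zero bexI[of _ i]) (auto simp: expo_def)
  then have "table_density m n R W c (x c) = 0"
    by (simp add: table_density_def)
  then have "(\<Prod>c\<in>K. table_density m n R W c (x c) powr p c) = 0"
    using ci(1) by (intro prod_zero finite_K bexI[of _ c]) auto
  then show ?thesis
    using table_density_nonneg[OF W] by simp
next
  case True
  let ?I = "{..<m}\<times>{..<n}"
  let ?x = "\<lambda>i\<in>?I. \<Sum>c\<in>K. p c * x c i"
  have expo: "(\<Prod>c\<in>K. (\<Prod>i\<in>?I. expo (x c i)) powr p c) = (\<Prod>i\<in>?I. expo (?x i))"
  proof -
    have "(\<Prod>c\<in>K. (\<Prod>i\<in>?I. expo (x c i)) powr p c) = (\<Prod>c\<in>K. \<Prod>i\<in>?I. expo (x c i) powr p c)"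
      by (intro prod.cong refl prod_powr_distrib)
    also have "\<dots> = (\<Prod>i\<in>?I. \<Prod>c\<in>K. expo (x c i) powr p c)"
      by (rule prod.swap)
    also have "\<dots> = (\<Prod>i\<in>?I. expo (?x i))"
    proof (intro prod.cong refl)
      fix i assume i: "i \<in> ?I"
      have "(\<Prod>c\<in>K. expo (x c i) powr p c) = (\<Prod>c\<in>K. exp (- (p c * x c i)))"
      proof (intro prod.cong refl)
        fix c assume "c \<in> K"
        then have "0 < x c i"
          using True i by blast
        then show "expo (x c i) powr p c = exp (- (p c * x c i))"
          by (simp add: expo_def powr_def)
      qed
      also have "\<dots> = exp (- (\<Sum>c\<in>K. p c * x c i))"
        using finite_K by (simp add: exp_sum[symmetric] sum_negf)
      also have "\<dots> = expo (?x i)"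
      proof -
        have "0 < (\<Sum>c\<in>K. p c * x c i)"
        proof (rule sum_pos[OF finite_K K(2)])
          fix c assume c: "c \<in> K"
          then have "0 < x c i"
            using True i by blast
          then show "0 < p c * x c i"
            using p(1)[OF c] by simp
        qed
        then show ?thesis
          using i by (simp add: expo_def)
      qed
      finally show "(\<Prod>c\<in>K. expo (x c i) powr p c) = expo (?x i)" .
    qed
    finally show ?thesis .
  qed
  have "(\<Prod>c\<in>K. table_density m n R W c (x c) powr p c) =
      (\<Prod>c\<in>K. multi_coeff m n R (\<lambda>i j. W i j * x c (i, j)) c powr p c) * (\<Prod>i\<in>?I. expo (?x i))"
    unfolding expo[symmetric] prod.distrib[symmetric] table_density_def
    by (intro prod.cong refl powr_mult)
  also have "\<dots> \<le> real (N + 1) ^ n * multi_coeff m n R (\<lambda>i j. \<Sum>c\<in>K. p c * (W i j * x c (i, j))) C * (\<Prod>i\<in>?I. expo (?x i))"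
    using True W by (intro mult_right_mono multi_coeff_log_concave prod_nonneg expo_nonneg) auto
  also have "multi_coeff m n R (\<lambda>i j. \<Sum>c\<in>K. p c * (W i j * x c (i, j))) C =
      multi_coeff m n R (\<lambda>i j. W i j * ?x (i, j)) C"
    unfolding multi_coeff_def multi_weight_def
    by (intro sum.cong prod.cong refl arg_cong2[of _ _ _ _ "(*)"] arg_cong2[of _ _ _ _ "(/)"] arg_cong2[of _ _ _ _ "(^)"])
      (auto simp: sum_distrib_left mult_ac)
  finally show ?thesis
    by (simp add: table_density_def mult.assoc)
qed

theorem T_log_concave: "(\<Prod>c\<in>K. T m n R c W powr p c) \<le> real (N + 1) ^ n * T m n R C W"
proof -
  let ?I = "{..<m}\<times>{..<n}"
  let ?M = "Pi\<^sub>M ?I (\<lambda>_. lborel :: real measure)"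
  let ?A = "real (N + 1) ^ n" and ?r = "\<Prod>i<m. fact (R i) :: real"
  let ?h = "\<lambda>g. ?A * table_density m n R W C g"
  let ?e = "\<lambda>t. expo (t / 2)"
  have dens: "0 \<le> table_density m n R W c g" "table_density m n R W c \<in> borel_measurable ?M"
    "(\<integral>\<^sup>+g. ennreal (table_density m n R W c g) \<partial>?M) = ennreal (?r * T m n R c W)" for c g
  proof -
    show "0 \<le> table_density m n R W c g"
      by (rule table_density_nonneg) (rule W)
    show "table_density m n R W c \<in> borel_measurable ?M"
      by (rule table_density_measurable) (rule W)
    show "(\<integral>\<^sup>+g. ennreal (table_density m n R W c g) \<partial>?M) = ennreal (?r * T m n R c W)"
      by (rule nn_integral_table_density) (rule W)
  qed
  have Tnn: "0 \<le> T m n R c W" for c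
    unfolding T_def using W by (intro sum_nonneg prod_nonneg) (auto intro: less_imp_le)
  have "\<forall>c. \<exists>B. 0 \<le> B \<and> (\<forall>g. table_density m n R W c g \<le> B * (\<Prod>i\<in>?I. ?e (g i)))"
    by (intro allI table_density_le W)
  then obtain b where "\<forall>c. 0 \<le> b c \<and> (\<forall>g. table_density m n R W c g \<le> b c * (\<Prod>i\<in>?I. ?e (g i)))"
    unfolding choice_iff by blast
  then have b: "0 \<le> b c" "table_density m n R W c g \<le> b c * (\<Prod>i\<in>?I. ?e (g i))" for c g
    by blast+
  \<comment> \<open>One constant has to dominate all the densities on the left and the scaled
    density on the right.\<close>
  define B where "B = sum b K + ?A * b C"
  have enn: "0 \<le> (\<Prod>i\<in>?I. ?e (g i))" for g
    by (intro prod_nonneg expo_nonneg)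
  have "ennreal (\<Prod>c\<in>K. enn2real (\<integral>\<^sup>+g. ennreal (table_density m n R W c g) \<partial>?M) powr p c) \<le> (\<integral>\<^sup>+g. ennreal (?h g) \<partial>?M)"
  proof (rule prekopa_leindler_PiM[where e = ?e and B = B])
    show "?e t \<le> 1" for t
      by (auto simp: expo_def indicator_def)
    show "table_density m n R W c g \<le> B * (\<Prod>i\<in>?I. ?e (g i))" if "c \<in> K" for c g
    proof -
      have "b c \<le> B"
        unfolding B_def using that b(1) member_le_sum[of c K b] finite_K by (simp add: add_increasing2)
      then show ?thesis
        using b(2)[of c g] mult_right_mono[OF _ enn[of g], of "b c" B] by linarith
    qed
    show "?h g \<le> B * (\<Prod>i\<in>?I. ?e (g i))" for g
    proof -
      have "?h g \<le> ?A * (b C * (\<Prod>i\<in>?I. ?e (g i)))"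
        by (intro mult_left_mono b(2)) simp
      also have "\<dots> = (?A * b C) * (\<Prod>i\<in>?I. ?e (g i))"
        by simp
      also have "\<dots> \<le> B * (\<Prod>i\<in>?I. ?e (g i))"
        unfolding B_def using b(1) by (intro mult_right_mono enn) (simp add: sum_nonneg)
      finally show ?thesis .
    qed
    show "?h \<in> borel_measurable ?M"
      using dens(2)[of C] by (intro borel_measurable_times) auto
  qed (use finite_K K(2) p nn_integral_expo_half dens(1,2) table_density_log_concave in \<open>auto simp: expo_nonneg\<close>)
  also have "(\<integral>\<^sup>+g. ennreal (?h g) \<partial>?M) = (\<integral>\<^sup>+g. ennreal ?A * ennreal (table_density m n R W C g) \<partial>?M)"
    by (intro nn_integral_cong ennreal_mult') simp
  also have "\<dots> = ennreal ?A * (\<integral>\<^sup>+g. ennreal (table_density m n R W C g) \<partial>?M)"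
    using dens(2)[of C] by (intro nn_integral_cmult) auto
  also have "\<dots> = ennreal (?A * (?r * T m n R C W))"
    unfolding dens(3) by (rule ennreal_mult'[symmetric]) simp
  finally have "ennreal (\<Prod>c\<in>K. (?r * T m n R c W) powr p c) \<le> ennreal (?A * (?r * T m n R C W))"
    using Tnn by (simp add: dens(3) enn2real_ennreal prod_nonneg)
  then have "(\<Prod>c\<in>K. (?r * T m n R c W) powr p c) \<le> ?A * (?r * T m n R C W)"
    using Tnn by (subst (asm) ennreal_le_iff) (auto intro!: mult_nonneg_nonneg prod_nonneg)
  \<comment> \<open>The row factorials are the same for every \<open>c\<close> and the weights sum
    to 1, so they come out to the first power and cancel.\<close>
  moreover have "(\<Prod>c\<in>K. (?r * T m n R c W) powr p c) = ?r * (\<Prod>c\<in>K. T m n R c W powr p c)"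
  proof -
    have r: "0 < ?r"
      by (intro prod_pos) simp
    then have "(\<Prod>c\<in>K. ?r powr p c) = ?r"
      using p(2) finite_K by (subst powr_sum[symmetric]) auto
    then show ?thesis
      using Tnn r by (simp add: powr_mult prod.distrib)
  qed
  ultimately have "?r * (\<Prod>c\<in>K. T m n R c W powr p c) \<le> ?r * (?A * T m n R C W)"
    by (simp add: mult_ac)
  then show ?thesis
    by (rule mult_left_le_imp_le) (auto intro!: prod_pos)
qed

end

section \<open>Comparison with the tilted sum\<close>

lemma compact_PiE_UNIV:
  fixes S :: "'i \<Rightarrow> 'a :: topological_space set"
  assumes "\<And>i. compact (S i)"
  shows "compact (Pi\<^sub>E UNIV S)"
proof -
  have "compactin (product_topology (\<lambda>_. euclidean) UNIV) (Pi\<^sub>E UNIV S)"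
    unfolding compactin_PiE using assms by simp
  then show ?thesis
    by (simp add: euclidean_product_topology)
qed

lemma transfer_unit_in_compositions:
  assumes C: "C \<in> compositions n N" and "a < n" "b < n" "a \<noteq> b" "0 < C b"
  shows "C(a := C a + 1, b := C b - 1) \<in> compositions n N"
proof -
  let ?C = "C(a := C a + 1, b := C b - 1)"
  have "(\<Sum>j<n. ?C j + (if j = b then 1 else 0)) = (\<Sum>j<n. C j + (if j = a then 1 else 0))"
    using assms by (intro sum.cong) auto
  then have "(\<Sum>j<n. ?C j) = (\<Sum>j<n. C j)"
    unfolding sum.distrib using assms by simp
  then show ?thesis
    using assms by (simp add: compositions_def)
qed

context
  fixes n N :: nat and C :: "nat \<Rightarrow> nat" and \<tau> :: "(nat \<Rightarrow> nat) \<Rightarrow> real"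
  assumes n: "0 < n" and C: "C \<in> compositions n N" "\<And>j. j < n \<Longrightarrow> 0 < C j"
    and \<tau>: "\<And>c. c \<in> compositions n N \<Longrightarrow> 0 < \<tau> c"
begin

text \<open>With y j = exp(\<eta> j) this is the sum of \<tau> c times y^(c - C). Logarithmic
  coordinates turn the minimum over y > 0 into an unconstrained one.\<close>

definition tilt :: "(nat \<Rightarrow> real) \<Rightarrow> real" where
  "tilt \<eta> = (\<Sum>c\<in>compositions n N. \<tau> c * exp (\<Sum>j<n. \<eta> j * (real (c j) - real (C j))))"

text \<open>All c have the same total as C, so a common shift cancels. Hence the least coordinate
  can be normalised to 0 when a minimum is sought.\<close>

lemma tilt_shift: "tilt (\<lambda>j. \<eta> j + s) = tilt \<eta>"
proof -
  have "(\<Sum>j<n. (\<eta> j + s) * (real (c j) - real (C j))) = (\<Sum>j<n. \<eta> j * (real (c j) - real (C j)))"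
    if c: "c \<in> compositions n N" for c
  proof -
    have "(\<Sum>j<n. real (c j) - real (C j)) = real (\<Sum>j<n. c j) - real (\<Sum>j<n. C j)"
      by (simp add: sum_subtractf)
    also have "\<dots> = 0"
      using c C(1) by (simp add: compositions_def)
    finally show ?thesis
      by (simp add: distrib_right sum.distrib sum_distrib_left[symmetric])
  qed
  then show ?thesis
    by (simp add: tilt_def)
qed

lemma tilt_cong: "(\<And>j. j < n \<Longrightarrow> \<eta> j = \<eta>' j) \<Longrightarrow> tilt \<eta> = tilt \<eta>'"
  unfolding tilt_def by (intro sum.cong refl arg_cong2[of _ _ _ _ "(*)"] arg_cong[of _ _ exp]) auto

text \<open>Since C b > 0, moving a unit from \<open>b\<close> to \<open>a\<close> gives another
  composition, and its term alone has exponent \<eta> a - \<eta> b = \<eta> a. Positivity of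
  \<open>C\<close> is what makes the minimum exist.\<close>

lemma tilt_coercive:
  assumes ab: "a < n" "b < n" and \<eta>: "\<eta> b = 0" "0 \<le> \<eta> a"
  shows "Min (\<tau> ` compositions n N) * exp (\<eta> a) \<le> tilt \<eta>"
proof -
  let ?V = "compositions n N"
  define c where "c = (if a = b then C else C(a := C a + 1, b := C b - 1))"
  have c: "c \<in> ?V"
    using transfer_unit_in_compositions[OF C(1) ab] C ab by (simp add: c_def)
  have "(\<Sum>j<n. \<eta> j * (real (c j) - real (C j))) = (\<Sum>j<n. if j = a then \<eta> a else 0)"
    using \<eta>(1) C(2)[OF ab(2)] by (intro sum.cong) (auto simp: c_def of_nat_diff)
  then have e: "(\<Sum>j<n. \<eta> j * (real (c j) - real (C j))) = \<eta> a"
    using ab by simp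
  have "Min (\<tau> ` ?V) * exp (\<eta> a) \<le> \<tau> c * exp (\<eta> a)"
    using c by (intro mult_right_mono Min_le) (auto simp: finite_compositions)
  also have "\<dots> = \<tau> c * exp (\<Sum>j<n. \<eta> j * (real (c j) - real (C j)))"
    by (simp add: e)
  also have "\<dots> \<le> tilt \<eta>"
    unfolding tilt_def using c \<tau>
    by (intro member_le_sum[of c ?V]) (auto simp: finite_compositions less_imp_le)
  finally show ?thesis .
qed

lemma tilt_attains_min: "\<exists>\<eta>. \<forall>\<eta>'. tilt \<eta> \<le> tilt \<eta>'"
proof -
  let ?V = "compositions n N"
  define \<mu> where "\<mu> = Min (\<tau> ` ?V)"
  have \<mu>: "0 < \<mu>"
    unfolding \<mu>_def using C(1) \<tau> by (subst Min_gr_iff) (auto simp: finite_compositions)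
  \<comment> \<open>Chosen so that, after normalisation, any coordinate above \<open>B\<close> makes
    \<open>tilt\<close> at least its value at 0 by \<open>tilt_coercive\<close>. It suffices to
    minimise over the box, which is compact by Tychonoff.\<close>
  define B where "B = max 0 (ln (tilt (\<lambda>_. 0) / \<mu>))"
  have t0: "0 < tilt \<eta>" for \<eta>
    unfolding tilt_def using C(1) \<tau> by (intro sum_pos) (auto simp: finite_compositions)
  have B: "tilt (\<lambda>_. 0) \<le> \<mu> * exp t" if "B < t" for t
  proof -
    have "tilt (\<lambda>_. 0) / \<mu> = exp (ln (tilt (\<lambda>_. 0) / \<mu>))"
      using t0 \<mu> by simp
    also have "\<dots> \<le> exp t"
      using that by (simp add: B_def)
    finally show ?thesis
      using \<mu> by (simp add: field_simps)
  qed
  let ?S = "Pi\<^sub>E UNIV (\<lambda>_::nat. {0..B})"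
  have cont: "continuous_on ?S tilt"
    unfolding tilt_def
    by (intro continuous_intros continuous_on_subset[OF continuous_on_product_coordinates]) auto
  obtain \<eta> where \<eta>: "\<eta> \<in> ?S" "\<And>\<eta>'. \<eta>' \<in> ?S \<Longrightarrow> tilt \<eta> \<le> tilt \<eta>'"
    using continuous_attains_inf[OF compact_PiE_UNIV _ cont] by (auto simp: PiE_UNIV_domain B_def)
  have "tilt \<eta> \<le> tilt \<eta>'" for \<eta>'
  proof -
    define s where "s = Min (\<eta>' ` {..<n})"
    define \<zeta> where "\<zeta> j = (if j < n then \<eta>' j + (- s) else 0)" for j
    have eq: "tilt \<zeta> = tilt \<eta>'"
      using tilt_cong[of \<zeta> "\<lambda>j. \<eta>' j + (- s)"] tilt_shift[of \<eta>' "- s"] by (simp add: \<zeta>_def)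
    have ne: "\<eta>' ` {..<n} \<noteq> {}" using n by auto
    have "s \<in> \<eta>' ` {..<n}"
      unfolding s_def by (intro Min_in ne) auto
    then obtain b where b: "b < n" "\<zeta> b = 0"
      by (auto simp: \<zeta>_def)
    have nn: "0 \<le> \<zeta> j" for j
      by (auto simp: \<zeta>_def s_def)
    show ?thesis
    proof (cases "\<exists>a<n. B < \<zeta> a")
      case True
      then obtain a where a: "a < n" "B < \<zeta> a" by blast
      have "tilt \<eta> \<le> tilt (\<lambda>_. 0)"
        by (rule \<eta>(2)) (auto simp: B_def)
      also have "\<dots> \<le> \<mu> * exp (\<zeta> a)"
        by (rule B[OF a(2)])
      also have "\<dots> \<le> tilt \<zeta>"
        unfolding \<mu>_def using a(1) b nn[of a] by (rule tilt_coercive[of a b \<zeta>])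
      finally show ?thesis by (simp add: eq)
    next
      case False
      have "\<zeta> j \<le> B" for j
      proof (cases "j < n")
        case True
        then show ?thesis
          using False by (meson not_less)
      qed (simp add: \<zeta>_def B_def)
      then have "\<zeta> \<in> ?S"
        using nn by auto
      then have "tilt \<eta> \<le> tilt \<zeta>"
        by (rule \<eta>(2))
      then show ?thesis
        by (simp only: eq)
    qed
  qed
  then show ?thesis by blast
qed

lemma tilt_min_mean:
  assumes min: "\<And>\<eta>'. tilt \<eta> \<le> tilt \<eta>'" and j: "j < n"
  shows "(\<Sum>c\<in>compositions n N. \<tau> c * exp (\<Sum>i<n. \<eta> i * (real (c i) - real (C i))) * (real (c j) - real (C j))) = 0"
    (is "?D = 0")
proof -
  let ?V = "compositions n N"
  let ?w = "\<lambda>c. \<tau> c * exp (\<Sum>i<n. \<eta> i * (real (c i) - real (C i)))"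
  let ?d = "\<lambda>c. real (c j) - real (C j)"
  have eq: "tilt (\<eta>(j := \<eta> j + t)) = (\<Sum>c\<in>?V. ?w c * exp (t * ?d c))" for t
  proof -
    have "(\<Sum>i<n. (\<eta>(j := \<eta> j + t)) i * (real (c i) - real (C i))) =
        (\<Sum>i<n. \<eta> i * (real (c i) - real (C i)) + (if i = j then t * ?d c else 0))" for c
      by (intro sum.cong) (auto simp: algebra_simps)
    then have "(\<Sum>i<n. (\<eta>(j := \<eta> j + t)) i * (real (c i) - real (C i))) =
        (\<Sum>i<n. \<eta> i * (real (c i) - real (C i))) + t * ?d c" for c
      using j by (simp add: sum.distrib)
    then show ?thesis
      by (simp add: tilt_def exp_add mult.assoc)
  qed
  have "((\<lambda>t. \<Sum>c\<in>?V. ?w c * exp (t * ?d c)) has_real_derivative ?D) (at 0)"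
    by (auto intro!: derivative_eq_intros simp: mult_ac)
  moreover have "(\<Sum>c\<in>?V. ?w c * exp (0 * ?d c)) \<le> (\<Sum>c\<in>?V. ?w c * exp (t * ?d c))" for t
    using min[of "\<eta>(j := \<eta> j + t)"] eq[of 0] eq[of t] by simp
  ultimately show ?thesis
    by (intro DERIV_local_min[where d = 1]) auto
qed

text \<open>
  At a minimum of \<open>tilt\<close> its normalised terms are a probability distribution with mean \<open>C\<close>.
  Log-concavity along this distribution costs its entropy, at most \<open>ln (card (compositions n N))\<close>.
\<close>

theorem capacity_le_of_log_concave:
  assumes lc: "\<And>p. (\<And>c. c \<in> compositions n N \<Longrightarrow> 0 < p c) \<Longrightarrow> sum p (compositions n N) = 1 \<Longrightarrow>
      (\<And>j. j < n \<Longrightarrow> (\<Sum>c\<in>compositions n N. p c * real (c j)) = real (C j)) \<Longrightarrow>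
      (\<Prod>c\<in>compositions n N. \<tau> c powr p c) \<le> A * \<tau> C"
  shows "\<exists>y. (\<forall>j. 0 < y j) \<and>
    (\<Sum>c\<in>compositions n N. \<tau> c * (\<Prod>j<n. y j ^ c j)) \<le>
      real (card (compositions n N)) * A * \<tau> C * (\<Prod>j<n. y j ^ C j)"
proof -
  let ?V = "compositions n N"
  obtain \<eta> where \<eta>: "\<And>\<eta>'. tilt \<eta> \<le> tilt \<eta>'"
    using tilt_attains_min by blast
  define e where "e c = (\<Sum>i<n. \<eta> i * (real (c i) - real (C i)))" for c
  define G where "G = tilt \<eta>"
  have G: "G = (\<Sum>c\<in>?V. \<tau> c * exp (e c))"
    by (simp add: G_def tilt_def e_def)
  have Vne: "?V \<noteq> {}" using C(1) by auto
  note fin = finite_compositions[of n N]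
  have Gpos: "0 < G"
    unfolding G using Vne \<tau> by (intro sum_pos fin) auto
  define p where "p c = \<tau> c * exp (e c) / G" for c
  have p: "0 < p c" if "c \<in> ?V" for c
    using \<tau>[OF that] Gpos by (simp add: p_def)
  have p1: "sum p ?V = 1"
    unfolding p_def sum_divide_distrib[symmetric] G[symmetric] using Gpos by simp
  have mean0: "(\<Sum>c\<in>?V. p c * (real (c j) - real (C j))) = 0" if "j < n" for j
  proof -
    have "(\<Sum>c\<in>?V. p c * (real (c j) - real (C j))) = (\<Sum>c\<in>?V. \<tau> c * exp (e c) * (real (c j) - real (C j))) / G"
      by (simp add: p_def sum_divide_distrib)
    then show ?thesis
      using tilt_min_mean[OF \<eta> that] by (simp add: e_def)
  qed
  have mean: "(\<Sum>c\<in>?V. p c * real (c j)) = real (C j)" if "j < n" for j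
    using mean0[OF that] p1 by (simp add: right_diff_distrib sum_subtractf sum_distrib_right[symmetric])
  have pe: "(\<Sum>c\<in>?V. p c * e c) = 0"
  proof -
    have "(\<Sum>c\<in>?V. p c * e c) = (\<Sum>i<n. \<Sum>c\<in>?V. \<eta> i * (p c * (real (c i) - real (C i))))"
      unfolding e_def sum_distrib_left by (subst sum.swap) (simp add: mult_ac)
    also have "\<dots> = 0"
      by (simp add: sum_distrib_left[symmetric] mean0)
    finally show ?thesis .
  qed
  \<comment> \<open>Dividing by \<open>1 / p c\<close> isolates the entropy factor, the product of
    (1 / p c)^(p c). The factors with \<open>e c\<close> multiply to 1 because \<open>e\<close> has
    mean 0, and AM-GM bounds the entropy factor by the sum of p c (1 / p c), the number of
    compositions.\<close>
  have \<tau>_eq: "\<tau> c powr p c = G powr p c * exp (- (p c * e c)) / (1 / p c) powr p c" if c: "c \<in> ?V" for c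
  proof -
    have "\<tau> c = G * exp (- e c) / (1 / p c)"
      using Gpos \<tau>[OF c] by (simp add: p_def exp_minus field_simps)
    moreover have "exp (- e c) powr p c = exp (- (p c * e c))"
      by (simp add: powr_def)
    ultimately show ?thesis
      using Gpos p[OF c] by (simp add: powr_mult powr_divide)
  qed
  have "(\<Prod>c\<in>?V. \<tau> c powr p c) = (\<Prod>c\<in>?V. G powr p c) * (\<Prod>c\<in>?V. exp (- (p c * e c))) / (\<Prod>c\<in>?V. (1 / p c) powr p c)"
    by (simp add: \<tau>_eq prod_dividef prod.distrib cong: prod.cong)
  also have "(\<Prod>c\<in>?V. G powr p c) = G"
    using Gpos p1 by (subst powr_sum[symmetric]) (auto simp: fin)
  also have "(\<Prod>c\<in>?V. exp (- (p c * e c))) = 1"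
    using pe by (subst exp_sum[symmetric]) (auto simp: fin sum_negf)
  finally have "G = (\<Prod>c\<in>?V. \<tau> c powr p c) * (\<Prod>c\<in>?V. (1 / p c) powr p c)"
  proof -
    assume eq: "(\<Prod>c\<in>?V. \<tau> c powr p c) = G * 1 / (\<Prod>c\<in>?V. (1 / p c) powr p c)"
    have "0 < (\<Prod>c\<in>?V. (1 / p c) powr p c)"
      using p by (intro prod_pos) (auto simp: less_imp_neq[symmetric])
    then show ?thesis
      by (simp add: eq)
  qed
  also have "\<dots> \<le> (A * \<tau> C) * real (card ?V)"
  proof (rule mult_mono)
    show "(\<Prod>c\<in>?V. \<tau> c powr p c) \<le> A * \<tau> C"
      by (rule lc[OF p p1 mean])
    have "(\<Prod>c\<in>?V. (1 / p c) powr p c) \<le> (\<Sum>c\<in>?V. p c * (1 / p c))"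
      using p by (intro weighted_am_gm fin Vne p1) (auto intro: less_imp_le)
    also have "\<dots> = (\<Sum>c\<in>?V. 1)"
      using p by (intro sum.cong) (auto simp: less_imp_neq[symmetric])
    finally show "(\<Prod>c\<in>?V. (1 / p c) powr p c) \<le> real (card ?V)"
      by simp
    show "0 \<le> A * \<tau> C"
      by (rule order_trans[OF _ lc[OF p p1 mean]]) (auto intro: prod_nonneg)
    show "0 \<le> (\<Prod>c\<in>?V. (1 / p c) powr p c)"
      by (intro prod_nonneg) auto
  qed
  finally have main: "G \<le> real (card ?V) * A * \<tau> C"
    by (simp add: mult_ac)
  define y where "y j = exp (\<eta> j)" for j
  have Y: "0 < (\<Prod>j<n. y j ^ C j)"
    by (intro prod_pos) (simp add: y_def)
  have py: "(\<Prod>j<n. y j ^ c j) = exp (\<Sum>j<n. \<eta> j * real (c j))" for c :: "nat \<Rightarrow> nat"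
    unfolding exp_sum[OF finite_lessThan]
    by (intro prod.cong refl) (simp add: y_def mult.commute[of "\<eta> _"] exp_of_nat_mult)
  have ye: "(\<Prod>j<n. y j ^ c j) = exp (e c) * (\<Prod>j<n. y j ^ C j)" for c
    unfolding py e_def exp_add[symmetric] sum.distrib[symmetric] by (simp add: right_diff_distrib)
  have "(\<Sum>c\<in>?V. \<tau> c * (\<Prod>j<n. y j ^ c j)) = G * (\<Prod>j<n. y j ^ C j)"
    unfolding G sum_distrib_right
  proof (intro sum.cong refl)
    fix c
    show "\<tau> c * (\<Prod>j<n. y j ^ c j) = \<tau> c * exp (e c) * (\<Prod>j<n. y j ^ C j)"
      unfolding ye[of c] by (rule mult.assoc[symmetric])
  qed
  also have "\<dots> \<le> real (card ?V) * A * \<tau> C * (\<Prod>j<n. y j ^ C j)"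
    using main Y by (intro mult_right_mono) auto
  finally show ?thesis
    by (intro exI[of _ y]) (simp add: y_def)
qed

end

section \<open>Bounds on the number of tables\<close>

lemma T_nonneg:
  assumes "\<And>i j. i < m \<Longrightarrow> j < n \<Longrightarrow> 0 \<le> W i j"
  shows "0 \<le> T m n R c W"
  unfolding T_def using assms by (intro sum_nonneg prod_nonneg) auto

text \<open>That a table with the given margins exists is read off from \<open>coeff_pos\<close>:
  the coefficient is positive, so its sum over tables is not empty.\<close>

lemma T_pos:
  assumes W: "\<And>i j. i < m \<Longrightarrow> j < n \<Longrightarrow> 0 < W i j" and n: "0 < n"
    and c: "c \<in> compositions n (\<Sum>i<m. R i)"
  shows "0 < T m n R c W"
proof -
  interpret stable_coeffs n "\<Sum>i<m. R i" "multi_coeff m n R W"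
    by (rule stable_multi_coeff[OF W refl])
  have "tables m n R c \<noteq> {}"
    using coeff_pos[OF n c] by (auto simp: multi_coeff_def)
  then show ?thesis
    unfolding T_def using W by (intro sum_pos finite_tables prod_pos) auto
qed

lemma F_eq:
  "F m n R C W x y = (\<Prod>i<m. \<Prod>j<n. 1 / (1 - W i j * y j * x i)) / ((\<Prod>i<m. x i ^ R i) * (\<Prod>j<n. y j ^ C j))"
proof -
  have powi: "(\<Prod>i<k. u i powi - int (v i)) = 1 / (\<Prod>i<k. u i ^ v i)" for k v and u :: "nat \<Rightarrow> real"
    using prod_dividef[of "\<lambda>_. 1" "\<lambda>i. u i ^ v i" "{..<k}"] by (simp add: power_int_minus divide_inverse)
  show ?thesis
    by (simp add: F_def powi mult_ac)
qed

lemma T_le_F: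
  assumes W: "\<And>i j. i < m \<Longrightarrow> j < n \<Longrightarrow> 0 \<le> W i j"
    and C: "(\<Sum>i<m. R i) = N" "(\<Sum>j<n. C j) = N" and xy: "(x, y) \<in> admissible m n W"
  shows "T m n R C W \<le> F m n R C W x y"
proof -
  \<comment> \<open>\<open>compositions\<close> requires zeros beyond \<open>n\<close>, whereas
    \<open>C\<close> is arbitrary there.\<close>
  define C' where "C' j = (if j < n then C j else 0)" for j
  have C': "C' \<in> compositions n N"
    using C(2) by (simp add: compositions_def C'_def)
  have tables: "tables m n R C' = tables m n R C"
    by (auto simp: tables_def C'_def)
  have x: "0 < x i" if "i < m" for i
    using xy that by (auto simp: admissible_def)
  have y: "0 < y j" if "j < n" for j
    using xy that by (auto simp: admissible_def)
  define X where "X = (\<Prod>i<m. x i ^ R i)"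
  define Y where "Y = (\<Prod>j<n. y j ^ C j)"
  have X: "0 < X" and Y: "0 < Y"
    unfolding X_def Y_def using x y by (auto intro!: prod_pos)
  have "T m n R C W * Y = T m n R C' W * (\<Prod>j<n. y j ^ C' j)"
    unfolding T_def tables Y_def by (simp add: C'_def)
  also have "\<dots> \<le> (\<Sum>c\<in>compositions n N. T m n R c W * (\<Prod>j<n. y j ^ c j))"
    using C' T_nonneg[OF W] y
    by (intro member_le_sum[of C']) (auto simp: finite_compositions less_imp_le intro!: mult_nonneg_nonneg prod_nonneg)
  also have "\<dots> = (\<Prod>i<m. complete_homogeneous n (\<lambda>j. W i j * y j) (R i))"
    by (rule sum_T) (simp add: C)
  finally have "X * (T m n R C W * Y) \<le> X * (\<Prod>i<m. complete_homogeneous n (\<lambda>j. W i j * y j) (R i))"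
    using X by (intro mult_left_mono) auto
  also have "\<dots> = (\<Prod>i<m. complete_homogeneous n (\<lambda>j. x i * (W i j * y j)) (R i))"
    by (simp add: X_def complete_homogeneous_scale prod.distrib)
  also have "\<dots> \<le> (\<Prod>i<m. \<Prod>j<n. 1 / (1 - x i * (W i j * y j)))"
  proof (intro prod_mono conjI)
    fix i assume i: "i \<in> {..<m}"
    have nn: "0 \<le> x i * (W i j * y j)" if "j < n" for j
      using x[of i] y[OF that] W[of i j] i that by (simp add: less_imp_le)
    show "0 \<le> complete_homogeneous n (\<lambda>j. x i * (W i j * y j)) (R i)"
      by (rule complete_homogeneous_nonneg) (rule nn)
    show "complete_homogeneous n (\<lambda>j. x i * (W i j * y j)) (R i) \<le> (\<Prod>j<n. 1 / (1 - x i * (W i j * y j)))"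
      by (rule complete_homogeneous_le) (use nn xy i in \<open>auto simp: admissible_def mult_ac\<close>)
  qed
  also have "\<dots> = X * (Y * F m n R C W x y)"
  proof -
    have "(\<Prod>i<m. \<Prod>j<n. 1 / (1 - x i * (W i j * y j))) = (\<Prod>i<m. \<Prod>j<n. 1 / (1 - W i j * y j * x i))"
      by (simp add: mult_ac)
    then show ?thesis
      unfolding F_eq X_def[symmetric] Y_def[symmetric] using X Y by simp
  qed
  finally have "Y * T m n R C W \<le> Y * F m n R C W x y"
    using X by (simp add: mult.commute)
  then show ?thesis
    using Y by simp
qed

lemma rho_le_F: "(x, y) \<in> admissible m n W \<Longrightarrow> rho m n R C W \<le> F m n R C W x y"
  unfolding rho_def using cINF_lower[OF bdd_below_F, of "(x, y)"] by simp

lemma le_rhoI: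
  assumes "\<And>x y. (x, y) \<in> admissible m n W \<Longrightarrow> z \<le> F m n R C W x y"
  shows "z \<le> rho m n R C W"
  unfolding rho_def using assms by (intro cINF_greatest admissible_nonempty) auto

text \<open>Larger entries shrink the admissible set and increase \<open>F\<close>. In
  \<open>rho_le_T\<close> this replaces continuity of the infimum when zero entries are
  perturbed.\<close>

lemma rho_mono:
  assumes "\<And>i j. i < m \<Longrightarrow> j < n \<Longrightarrow> W i j \<le> W' i j"
  shows "rho m n R C W \<le> rho m n R C W'"
proof (rule le_rhoI)
  fix x y assume xy: "(x, y) \<in> admissible m n W'"
  have pos: "0 < x i" "0 < y j" if "i < m" "j < n" for i j
    using xy that by (auto simp: admissible_def)
  have le: "W i j * x i * y j \<le> W' i j * x i * y j" if "i < m" "j < n" for i j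
    using pos[OF that] assms[OF that] by (intro mult_right_mono) auto
  have lt: "W' i j * x i * y j < 1" if "i < m" "j < n" for i j
    using xy that by (auto simp: admissible_def)
  have lt': "W i j * x i * y j < 1" if "i < m" "j < n" for i j
    using le[OF that] lt[OF that] by linarith
  then have adm: "(x, y) \<in> admissible m n W"
    using xy by (simp add: admissible_def)
  have "F m n R C W x y \<le> F m n R C W' x y"
    unfolding F_def
  proof (intro mult_left_mono prod_mono conjI divide_left_mono)
    fix i j assume ij: "i \<in> {..<m}" "j \<in> {..<n}"
    show "0 \<le> 1 / (1 - W i j * x i * y j)" "1 - W' i j * x i * y j \<le> 1 - W i j * x i * y j"
      "0 < (1 - W i j * x i * y j) * (1 - W' i j * x i * y j)"
      using le[of i j] lt[of i j] ij by auto
  next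
    fix i assume "i \<in> {..<m}"
    then show "0 \<le> (\<Prod>j<n. 1 / (1 - W i j * x i * y j))"
      using le[of i] lt[of i] by (intro prod_nonneg) fastforce
  next
    have "0 < (\<Prod>i<m. x i powi - int (R i)) * (\<Prod>j<n. y j powi - int (C j))"
      using xy by (intro mult_pos_pos prod_pos zero_less_power_int) (auto simp: admissible_def)
    then show "0 \<le> (\<Prod>i<m. x i powi - int (R i)) * (\<Prod>j<n. y j powi - int (C j))"
      by simp
  qed simp
  with rho_le_F[OF adm] show "rho m n R C W \<le> F m n R C W' x y"
    by (rule order_trans)
qed

lemma rho_le_T_pos:
  assumes W: "\<And>i j. i < m \<Longrightarrow> j < n \<Longrightarrow> 0 < W i j" and mn: "1 < m" "1 < n"
    and RC: "\<And>i. i < m \<Longrightarrow> 0 < R i" "\<And>j. j < n \<Longrightarrow> 0 < C j"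
    and N: "(\<Sum>i<m. R i) = N" "(\<Sum>j<n. C j) = N"
  shows "rho m n R C W \<le> real N ^ (4 * (m + n)) * T m n R C W"
proof -
  define C' where "C' j = (if j < n then C j else 0)" for j
  have C': "C' \<in> compositions n N" "\<And>j. j < n \<Longrightarrow> 0 < C' j"
    using N(2) RC(2) by (auto simp: compositions_def C'_def)
  have TC': "T m n R C' W = T m n R C W"
    by (simp add: T_def tables_def C'_def)
  have n0: "0 < n" using mn by simp
  have Tpos: "0 < T m n R c W" if "c \<in> compositions n N" for c
    by (rule T_pos[OF _ n0]) (use W that N in auto)
  let ?V = "compositions n N"
  have lc: "(\<Prod>c\<in>?V. T m n R c W powr p c) \<le> real (N + 1) ^ n * T m n R C' W"
    if "\<And>c. c \<in> ?V \<Longrightarrow> 0 < p c" "sum p ?V = 1"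
      "\<And>j. j < n \<Longrightarrow> (\<Sum>c\<in>?V. p c * real (c j)) = real (C' j)" for p
    by (rule T_log_concave) (use W N n0 C' that in auto)
  have "\<exists>y. (\<forall>j. 0 < y j) \<and> (\<Sum>c\<in>?V. T m n R c W * (\<Prod>j<n. y j ^ c j)) \<le>
      real (card ?V) * real (N + 1) ^ n * T m n R C' W * (\<Prod>j<n. y j ^ C' j)"
    by (rule capacity_le_of_log_concave[OF n0 C' Tpos lc])
  then obtain y where y: "\<And>j. 0 < y j"
    "(\<Sum>c\<in>?V. T m n R c W * (\<Prod>j<n. y j ^ c j)) \<le>
      real (card ?V) * real (N + 1) ^ n * T m n R C' W * (\<Prod>j<n. y j ^ C' j)"
    by auto
  let ?H = "\<lambda>i. complete_homogeneous n (\<lambda>j. W i j * y j) (R i)"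
  have "\<forall>i\<in>{..<m}. \<exists>x. 0 < x \<and> (\<forall>j<n. W i j * y j * x < 1) \<and>
      (\<Prod>j<n. 1 / (1 - W i j * y j * x)) \<le> 4 * real (R i + 1) * ?H i * x ^ R i"
    using W y(1) RC(1) by (intro ballI complete_homogeneous_capacity n0) auto
  from bchoice[OF this] obtain x where
    "\<forall>i\<in>{..<m}. 0 < x i \<and> (\<forall>j<n. W i j * y j * x i < 1) \<and>
      (\<Prod>j<n. 1 / (1 - W i j * y j * x i)) \<le> 4 * real (R i + 1) * ?H i * x i ^ R i" ..
  then have x: "\<And>i. i < m \<Longrightarrow> 0 < x i" "\<And>i j. i < m \<Longrightarrow> j < n \<Longrightarrow> W i j * y j * x i < 1"
    "\<And>i. i < m \<Longrightarrow> (\<Prod>j<n. 1 / (1 - W i j * y j * x i)) \<le> 4 * real (R i + 1) * ?H i * x i ^ R i"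
    by auto
  define X where "X = (\<Prod>i<m. x i ^ R i)"
  define Y where "Y = (\<Prod>j<n. y j ^ C j)"
  have X: "0 < X" and Y: "0 < Y"
    unfolding X_def Y_def using x y by (auto intro!: prod_pos)
  have Hnn: "0 \<le> ?H i" if "i < m" for i
    using W[OF that] y(1) by (intro complete_homogeneous_nonneg) (simp add: less_imp_le)
  have "(x, y) \<in> admissible m n W"
    using x y(1) by (auto simp: admissible_def mult_ac)
  then have "rho m n R C W \<le> F m n R C W x y"
    by (rule rho_le_F)
  also have "\<dots> = (\<Prod>i<m. \<Prod>j<n. 1 / (1 - W i j * y j * x i)) / (X * Y)"
    unfolding X_def Y_def by (rule F_eq)
  also have "\<dots> \<le> (\<Prod>i<m. 4 * real (N + 1) * ?H i * x i ^ R i) / (X * Y)"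
  proof (intro divide_right_mono prod_mono conjI)
    fix i assume i: "i \<in> {..<m}"
    show "0 \<le> (\<Prod>j<n. 1 / (1 - W i j * y j * x i))"
      using x(2) i by (intro prod_nonneg) (simp add: less_imp_le)
    have "R i \<le> N"
      unfolding N(1)[symmetric] using i by (intro member_le_sum) auto
    then have "4 * real (R i + 1) * ?H i * x i ^ R i \<le> 4 * real (N + 1) * ?H i * x i ^ R i"
      using i Hnn x(1) by (intro mult_right_mono) (auto intro: less_imp_le)
    with x(3) i show "(\<Prod>j<n. 1 / (1 - W i j * y j * x i)) \<le> 4 * real (N + 1) * ?H i * x i ^ R i"
      by (meson lessThan_iff order_trans)
  qed (use X Y in simp)
  also have "\<dots> = (4 * real (N + 1)) ^ m * (\<Prod>i<m. ?H i) / Y"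
    using X by (simp add: prod.distrib X_def[symmetric])
  also have "(\<Prod>i<m. ?H i) = (\<Sum>c\<in>?V. T m n R c W * (\<Prod>j<n. y j ^ c j))"
    by (rule sum_T[symmetric]) (simp add: N)
  also have "(4 * real (N + 1)) ^ m * (\<Sum>c\<in>?V. T m n R c W * (\<Prod>j<n. y j ^ c j)) / Y
      \<le> (4 * real (N + 1)) ^ m * (real (card ?V) * real (N + 1) ^ n * T m n R C' W * (\<Prod>j<n. y j ^ C' j)) / Y"
    using y(2) Y by (intro divide_right_mono mult_left_mono) auto
  also have "\<dots> = (4 * real (N + 1)) ^ m * (real (card ?V) * real (N + 1) ^ n * T m n R C W)"
    using Y by (simp add: TC' C'_def Y_def[symmetric])
  \<comment> \<open>Each row pays 4 (N + 1) <= N^4. Each column pays N + 1 twice, for the entropy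
    and for the capacity of the coefficients, hence at most N^2 N^2.\<close>
  also have "\<dots> \<le> (real N ^ 4) ^ m * ((real N ^ 4) ^ n * T m n R C W)"
  proof -
    \<comment> \<open>Every row sum is at least 1, so m > 1 gives N >= 2, without which N + 1 is not
      bounded by a power of N.\<close>
    have "m \<le> N"
      unfolding N(1)[symmetric] using sum_mono[of "{..<m}" "\<lambda>_. 1" R] RC(1) by (force simp: Suc_le_eq)
    then have N2: "2 \<le> real N"
      using mn by linarith
    have sq: "real (N + 1) \<le> real N ^ 2"
    proof -
      have "2 * real N \<le> real N * real N"
        using N2 by (intro mult_right_mono) auto
      moreover have "real (N + 1) \<le> 2 * real N"
        using N2 by simp
      ultimately show ?thesis
        unfolding power2_eq_square by linarith
    qed
    have four: "4 * real (N + 1) \<le> real N ^ 4"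
    proof -
      have "4 * real (N + 1) \<le> 4 * real N ^ 2"
        using sq by simp
      also have "\<dots> \<le> real N ^ 2 * real N ^ 2"
        using N2 power_mono[of 2 "real N" 2] by (intro mult_right_mono) auto
      finally show ?thesis
        by (simp add: power_add[symmetric])
    qed
    have "real (card ?V) \<le> real (N + 1) ^ n"
      using card_compositions_le[of n N] by (metis of_nat_le_iff of_nat_power)
    then have "real (card ?V) * real (N + 1) ^ n \<le> real (N + 1) ^ n * real (N + 1) ^ n"
      by (intro mult_right_mono) auto
    also have "\<dots> = (real (N + 1) * real (N + 1)) ^ n"
      by (simp add: power_mult_distrib)
    also have "\<dots> \<le> (real N ^ 2 * real N ^ 2) ^ n"
      using sq by (intro power_mono mult_mono) auto
    also have "\<dots> = (real N ^ 4) ^ n"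
      by (simp add: power_add[symmetric])
    finally have "real (card ?V) * real (N + 1) ^ n * T m n R C W \<le> (real N ^ 4) ^ n * T m n R C W"
      using Tpos[OF C'(1)] by (intro mult_right_mono) (auto simp: TC')
    moreover have "(4 * real (N + 1)) ^ m \<le> (real N ^ 4) ^ m"
      using four by (intro power_mono) auto
    ultimately show ?thesis
      using Tpos[OF C'(1)] by (intro mult_mono) (auto simp: TC' intro!: mult_nonneg_nonneg)
  qed
  also have "\<dots> = real N ^ (4 * (m + n)) * T m n R C W"
    by (simp add: power_mult[symmetric] power_add distrib_left)
  finally show ?thesis .
qed

text \<open>Adding \<epsilon> > 0 to every entry makes the matrix positive and does not decrease the
  infimum, while \<open>T\<close> is a polynomial in \<epsilon> and tends to its value at 0.\<close>

lemma rho_le_T: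
  assumes W: "\<And>i j. i < m \<Longrightarrow> j < n \<Longrightarrow> 0 \<le> W i j" and mn: "1 < m" "1 < n"
    and RC: "\<And>i. i < m \<Longrightarrow> 0 < R i" "\<And>j. j < n \<Longrightarrow> 0 < C j"
    and N: "(\<Sum>i<m. R i) = N" "(\<Sum>j<n. C j) = N"
  shows "rho m n R C W \<le> real N ^ (4 * (m + n)) * T m n R C W"
proof (rule tendsto_lowerbound)
  let ?T = "\<lambda>\<epsilon>. T m n R C (\<lambda>i j. W i j + \<epsilon>)"
  have "((\<lambda>\<epsilon>. real N ^ (4 * (m + n)) * ?T \<epsilon>) \<longlongrightarrow> real N ^ (4 * (m + n)) * ?T 0) (at_right 0)"
    unfolding T_def by (intro tendsto_intros)
  then show "((\<lambda>\<epsilon>. real N ^ (4 * (m + n)) * ?T \<epsilon>) \<longlongrightarrow> real N ^ (4 * (m + n)) * T m n R C W) (at_right 0)"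
    by simp
  have "rho m n R C W \<le> real N ^ (4 * (m + n)) * ?T \<epsilon>" if "0 < \<epsilon>" for \<epsilon>
  proof -
    have "rho m n R C W \<le> rho m n R C (\<lambda>i j. W i j + \<epsilon>)"
      using that by (intro rho_mono) auto
    also have "\<dots> \<le> real N ^ (4 * (m + n)) * ?T \<epsilon>"
      using W that by (intro rho_le_T_pos mn RC N) (auto intro: add_nonneg_pos)
    finally show ?thesis .
  qed
  then show "\<forall>\<^sub>F \<epsilon> in at_right 0. rho m n R C W \<le> real N ^ (4 * (m + n)) * ?T \<epsilon>"
    by (auto simp: eventually_at_filter)
qed simp

theorem theorem1p3:
  "\<exists>\<gamma>::real. \<gamma> > 0 \<and>
     (\<forall>(m::nat) (n::nat) (R::nat \<Rightarrow> nat) (C::nat \<Rightarrow> nat) (W::nat \<Rightarrow> nat \<Rightarrow> real) (N::nat).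
        m > 1 \<longrightarrow> n > 1 \<longrightarrow>
        (\<forall>i<m. R i > 0) \<longrightarrow> (\<forall>j<n. C j > 0) \<longrightarrow>
        (\<Sum>i<m. R i) = N \<longrightarrow> (\<Sum>j<n. C j) = N \<longrightarrow>
        (\<forall>i<m. \<forall>j<n. W i j \<ge> 0) \<longrightarrow>
        rho m n R C W \<ge> T m n R C W \<and>
        T m n R C W \<ge> real N powr (- \<gamma> * real (m + n)) * rho m n R C W)"
proof (intro exI[of _ 4] conjI allI impI)
  fix m n N :: nat and R C :: "nat \<Rightarrow> nat" and W :: "nat \<Rightarrow> nat \<Rightarrow> real"
  assume *: "1 < m" "1 < n" "\<forall>i<m. 0 < R i" "\<forall>j<n. 0 < C j"
    "(\<Sum>i<m. R i) = N" "(\<Sum>j<n. C j) = N" "\<forall>i<m. \<forall>j<n. (0::real) \<le> W i j"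
  show "T m n R C W \<le> rho m n R C W"
    by (rule le_rhoI, rule T_le_F) (use * in auto)
  have "0 < R 0" "R 0 \<le> (\<Sum>i<m. R i)"
    using * by (auto intro!: member_le_sum)
  then have N: "0 < real N"
    using * by linarith
  define P where "P = real N ^ (4 * (m + n))"
  have "real N powr (- 4 * real (m + n)) = 1 / P"
    unfolding P_def powr_realpow[OF N, symmetric] powr_minus_divide[symmetric] by simp
  moreover have "rho m n R C W \<le> P * T m n R C W"
    unfolding P_def by (rule rho_le_T) (use * in auto)
  moreover have "0 < P"
    using N by (simp add: P_def)
  ultimately show "real N powr (- 4 * real (m + n)) * rho m n R C W \<le> T m n R C W"
    by (simp add: pos_divide_le_eq mult.commute)
qed simp

end
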